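(* Let $\mu\ge 0$, let $m\ge 0$ be an integer, and let $\phi_\nu=\frac{2\nu\pi}{2m+1}$ for $0\le\nu\le 2m$. Then for every $f\in L^2(W_\mu;B^3)$ and $\mathbf x\in B^3$, the partial sum $S_{2m,3}^\mu f(\mathbf x)=\sum_{l=0}^{2m}\operatorname{proj}_{l,3}^\mu f(\mathbf x)$ satisfies $$S_{2m,3}^\mu f(\mathbf x)=\frac{1}{2m+1}\sum_{\nu=0}^{2m}\int_{-1}^1\int_{-1}^1\mathcal R_{\phi_\nu}^\mu(f;t,w)\,\Phi_{2m}^\mu(\phi_\nu,t,w;\mathbf x)\,dt\,\sqrt{1-w^2}\,dw,$$ where $\Phi_{2m}^\mu(\xi,t,w;\mathbf x)=\sum_{l=0}^{2m}G_l(\xi,t,w;\mathbf x)$ and $$G_l(\xi,t,w;\mathbf x)=a_{\mu,3}\sum_{k=0}^l h_k^2\,D_k^{\mu+1/2}\Bigl(\xi,t;\tfrac{x_1}{\sqrt{1-x_3^2}},\tfrac{x_2}{\sqrt{1-x_3^2}}\Bigr)(1-w^2)^{k/2}(1-x_3^2)^{k/2}\,\widetilde C_{l-k}^{k+\mu+1}(w)\,\widetilde C_{l-k}^{k+\mu+1}(x_3).$$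
   Context: Ball: $B^3$ is the closed unit ball in $\mathbb R^3$; $W_\mu(\mathbf x)=(1-\|\mathbf x\|^2)^{\mu-1/2}$ on $B^3$; $a_{\mu,3}=\frac{\Gamma(\mu+2)}{\pi^{3/2}\Gamma(\mu+1/2)}=1/\int_{B^3}W_\mu$. $\mathcal V_l^3(W_\mu)$ is the space of polynomials in three variables of degree $l$ (together with $0$) orthogonal to all polynomials of degree $<l$ under $\langle P,Q\rangle=a_{\mu,3}\int_{B^3}PQW_\mu\,d\mathbf x$, and $\operatorname{proj}_{l,3}^\mu$ is the orthogonal projection of $L^2(W_\mu;B^3)$ onto $\mathcal V_l^3(W_\mu)$ (polynomial representative). For $t,w\in(-1,1)$, $\mathcal R_\theta^\mu(f;t,w)$ is the integral of $fW_\mu$ with respect to arc length over the segment $\{\mathbf x\in B^3: x_3=w,\ x_1\cos\theta+x_2\sin\theta=t\sqrt{1-w^2}\}$ (defined for a.e. $(t,w)$ when $f\in L^2(W_\mu;B^3)$). $h_k^2=(\mu+2)_k/(\mu+3/2)_k$ with $(a)_k=a(a+1)\cdots(a+k-1)$. $C_k^\lambda$ is the Gegenbauer polynomial of degree $k$, orthogonal for $(1-s^2)^{\lambda-1/2}$ on $[-1,1]$, with $C_k^\lambda(1)=(2\lambda)_k/k!$; $\widetilde C_k^\lambda=C_k^\lambda\big/\sqrt{\lambda(2\lambda)_k/((k+\lambda)k!)}$ is orthonormal for that weight normalized to integral $1$. Disk: on the closed unit disk $B^2$, $W_\mu(x,y)=(1-x^2-y^2)^{\mu-1/2}$, $a_\mu=(\mu+1/2)/\pi=1/\int_{B^2}W_\mu$,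 and $\mathcal V_k^2(W_\mu)$ is the space of polynomials in two variables of degree $k$ (with $0$) orthogonal to all polynomials of degree $<k$ under $a_\mu\int_{B^2}PQW_\mu$. $p_l^{(\alpha,\beta)}$ is the Jacobi polynomial of degree $l$ with positive leading coefficient, orthonormal for $(1-t)^\alpha(1+t)^\beta$ normalized to integral $1$ on $[-1,1]$. Orthonormal basis of $\mathcal V_k^2(W_\mu)$: with $x=r\cos\phi$, $y=r\sin\phi$, $$P_{i,\varepsilon}^k(x,y)=h_{i,k}\,p_i^{(\mu-1/2,\,k-2i)}(2r^2-1)\,r^{k-2i}S_{k-2i,\varepsilon}(\phi),$$ $S_{j,0}(\phi)=\cos j\phi$, $S_{j,1}(\phi)=\sin j\phi$, $0\le2i\le k$ if $\varepsilon=0$, $0\le2i\le k-1$ if $\varepsilon=1$, $$h_{i,k}^2=\frac1{d_{i,k}}\frac{\Gamma(k-2i+\mu+3/2)}{\Gamma(\mu+3/2)\Gamma(k-2i+1)},\quad h_{i,k}>0,\qquad d_{i,k}=\tfrac12\ (2i<k),\ d_{i,k}=1\ (2i=k).$$ $$\lambda_{i,k}^\mu=\frac{i!\,(k-i)!\,(k-i+\mu+\frac12)}{(\mu+\frac12)_i(\mu+\frac32)_{k-i}(k+\mu+\frac12)},\qquad D_k^{\mu+1/2}(\xi;x,y)=\sum_{i,\varepsilon}\lambda_{i,k}^\mu P_{i,\varepsilon}^k(\cos\xi,\sin\xi)P_{i,\varepsilon}^k(x,y)$$ (all admissible $(i,\varepsilon)$), and $$D_k^{\mu+1/2}(\xi,t;x,y)=\frac{k+\mu+1/2}{\mu+1/2}\,C_k^{\mu+1/2}(t)\,D_k^{\mu+1/2}(\xi;x,y).$$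 The expression $(1-x_3^2)^{k/2}D_k^{\mu+1/2}(\xi,t;x_1/\sqrt{1-x_3^2},x_2/\sqrt{1-x_3^2})$ is a polynomial in $\mathbf x$ and is so interpreted when $|x_3|=1$. *)

theory Defs
  imports "HOL-Analysis.Analysis"
begin

section \<open>Weighted space on the unit ball of dimension three\<close>

text \<open>
  Weights are only ever used under integrals. On the unit sphere \<open>ball_weight\<close> takes the value 0
  (\<^term>\<open>0 powr a = 0\<close> for every \<open>a\<close>, including \<open>a = 0\<close>); this concerns null sets only, both in
  the ball and on the chords along which functions are integrated below.
\<close>

definition ball_weight :: "real \<Rightarrow> real ^ 3 \<Rightarrow> real" where
  "ball_weight \<mu> x = (1 - (norm x)\<^sup>2) powr (\<mu> - 1/2)"

definition ball_const :: "real \<Rightarrow> real" where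
  "ball_const \<mu> = Gamma (\<mu> + 2) / (pi powr (3/2) * Gamma (\<mu> + 1/2))"

definition ball_L2 :: "real \<Rightarrow> (real ^ 3 \<Rightarrow> real) set" where
  "ball_L2 \<mu> = {f. f \<in> borel_measurable (lebesgue_on (cball 0 1)) \<and>
     set_integrable lebesgue (cball 0 1) (\<lambda>x. (f x)\<^sup>2 * ball_weight \<mu> x)}"

definition ball_inner :: "real \<Rightarrow> (real ^ 3 \<Rightarrow> real) \<Rightarrow> (real ^ 3 \<Rightarrow> real) \<Rightarrow> real" where
  "ball_inner \<mu> f g =
     ball_const \<mu> * (LINT x:cball 0 1|lebesgue. f x * g x * ball_weight \<mu> x)"

text \<open>
  Polynomials in three variables of total degree less than \<open>n\<close>, as functions on the whole space
  (so \<open>poly3_less 0\<close> contains only the zero function); \<open>\<alpha>\<close> ranges over exponent vectors.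
\<close>

definition poly3_less :: "nat \<Rightarrow> (real ^ 3 \<Rightarrow> real) set" where
  "poly3_less n = {p. \<exists>c :: (3 \<Rightarrow> nat) \<Rightarrow> real.
     p = (\<lambda>x. \<Sum>\<alpha> | sum \<alpha> UNIV < n. c \<alpha> * (\<Prod>i\<in>UNIV. x $ i ^ \<alpha> i))}"

definition ball_V :: "real \<Rightarrow> nat \<Rightarrow> (real ^ 3 \<Rightarrow> real) set" where
  "ball_V \<mu> l = {p \<in> insert (\<lambda>x. 0) (poly3_less (Suc l) - poly3_less l).
     \<forall>q \<in> poly3_less l. ball_inner \<mu> p q = 0}"

definition ball_proj :: "real \<Rightarrow> nat \<Rightarrow> (real ^ 3 \<Rightarrow> real) \<Rightarrow> real ^ 3 \<Rightarrow> real" where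
  "ball_proj \<mu> l f =
     (THE p. p \<in> ball_V \<mu> l \<and> (\<forall>q \<in> ball_V \<mu> l. ball_inner \<mu> (\<lambda>x. f x - p x) q = 0))"

definition ball_partial_sum :: "real \<Rightarrow> nat \<Rightarrow> (real ^ 3 \<Rightarrow> real) \<Rightarrow> real ^ 3 \<Rightarrow> real" where
  "ball_partial_sum \<mu> n f x = (\<Sum>l\<le>n. ball_proj \<mu> l f x)"


section \<open>Integrals over horizontal chords\<close>

definition chord :: "real \<Rightarrow> real \<Rightarrow> real \<Rightarrow> (real ^ 3) set" where
  "chord \<theta> t w = {x \<in> cball 0 1.
     x $ 3 = w \<and> x $ 1 * cos \<theta> + x $ 2 * sin \<theta> = t * sqrt (1 - w\<^sup>2)}"

text \<open>Unit-speed parametrization of the line containing \<open>chord \<theta> t w\<close>.\<close>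

definition chord_line :: "real \<Rightarrow> real \<Rightarrow> real \<Rightarrow> real \<Rightarrow> real ^ 3" where
  "chord_line \<theta> t w s =
     vector [t * sqrt (1 - w\<^sup>2) * cos \<theta> - s * sin \<theta>, t * sqrt (1 - w\<^sup>2) * sin \<theta> + s * cos \<theta>, w]"

definition radon :: "real \<Rightarrow> real \<Rightarrow> (real ^ 3 \<Rightarrow> real) \<Rightarrow> real \<Rightarrow> real \<Rightarrow> real" where
  "radon \<mu> \<theta> f t w = (LINT s:{s. chord_line \<theta> t w s \<in> chord \<theta> t w}|lebesgue.
     f (chord_line \<theta> t w s) * ball_weight \<mu> (chord_line \<theta> t w s))"


section \<open>Gegenbauer and Jacobi polynomials\<close>

text \<open>Intended for \<open>a > 0\<close>.\<close>

definition gegenbauer :: "real \<Rightarrow> nat \<Rightarrow> real poly" where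
  "gegenbauer a k = (THE p. degree p = k \<and>
     (\<forall>q. degree q < k \<longrightarrow>
        (LINT s:{-1..1}|lebesgue. poly p s * poly q s * (1 - s\<^sup>2) powr (a - 1/2)) = 0) \<and>
     poly p 1 = pochhammer (2 * a) k / fact k)"

definition gegenbauer_normed :: "real \<Rightarrow> nat \<Rightarrow> real \<Rightarrow> real" where
  "gegenbauer_normed a k s = poly (gegenbauer a k) s /
     sqrt (a * pochhammer (2 * a) k / ((real k + a) * fact k))"

text \<open>Intended for \<open>\<alpha>, \<beta> > -1\<close>.\<close>

definition jacobi_inner :: "real \<Rightarrow> real \<Rightarrow> real poly \<Rightarrow> real poly \<Rightarrow> real" where
  "jacobi_inner \<alpha> \<beta> p q =
     (LINT t:{-1..1}|lebesgue. poly p t * poly q t * ((1 - t) powr \<alpha> * (1 + t) powr \<beta>)) /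
     (LINT t:{-1..1}|lebesgue. (1 - t) powr \<alpha> * (1 + t) powr \<beta>)"

definition jacobi :: "real \<Rightarrow> real \<Rightarrow> nat \<Rightarrow> real poly" where
  "jacobi \<alpha> \<beta> l = (THE p. degree p = l \<and> lead_coeff p > 0 \<and>
     (\<forall>q. degree q < l \<longrightarrow> jacobi_inner \<alpha> \<beta> p q = 0) \<and> jacobi_inner \<alpha> \<beta> p p = 1)"


section \<open>Orthonormal basis on the disk\<close>

definition disk_index :: "nat \<Rightarrow> (nat \<times> nat) set" where
  "disk_index k = {(i, \<epsilon>). \<epsilon> \<in> {0, 1} \<and> 2 * i + \<epsilon> \<le> k}"

definition trig :: "nat \<Rightarrow> nat \<Rightarrow> real \<Rightarrow> real" where
  "trig j \<epsilon> \<phi> = (if \<epsilon> = 0 then cos (real j * \<phi>) else sin (real j * \<phi>))"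

definition disk_norm :: "real \<Rightarrow> nat \<Rightarrow> nat \<Rightarrow> real" where
  "disk_norm \<mu> k i = sqrt (1 / (if 2 * i < k then 1/2 else 1) *
     (Gamma (real (k - 2 * i) + \<mu> + 3/2) / (Gamma (\<mu> + 3/2) * Gamma (real (k - 2 * i) + 1))))"

text \<open>
  The polar coordinates of \<open>(x, y)\<close> are the modulus and argument of the corresponding complex
  number. At the origin the choice of the angle is immaterial.
\<close>

definition disk_basis :: "real \<Rightarrow> nat \<Rightarrow> nat \<Rightarrow> nat \<Rightarrow> real \<Rightarrow> real \<Rightarrow> real" where
  "disk_basis \<mu> k i \<epsilon> x y = (let r = cmod (Complex x y); \<phi> = Arg (Complex x y) in
     disk_norm \<mu> k i * poly (jacobi (\<mu> - 1/2) (real (k - 2 * i)) i) (2 * r\<^sup>2 - 1)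
       * r ^ (k - 2 * i) * trig (k - 2 * i) \<epsilon> \<phi>)"

definition disk_lambda :: "real \<Rightarrow> nat \<Rightarrow> nat \<Rightarrow> real" where
  "disk_lambda \<mu> k i = fact i * fact (k - i) * (real (k - i) + \<mu> + 1/2) /
     (pochhammer (\<mu> + 1/2) i * pochhammer (\<mu> + 3/2) (k - i) * (real k + \<mu> + 1/2))"

definition disk_D :: "real \<Rightarrow> nat \<Rightarrow> real \<Rightarrow> real \<Rightarrow> real \<Rightarrow> real" where
  "disk_D \<mu> k \<xi> x y = (\<Sum>(i, \<epsilon>)\<in>disk_index k.
     disk_lambda \<mu> k i * disk_basis \<mu> k i \<epsilon> (cos \<xi>) (sin \<xi>) * disk_basis \<mu> k i \<epsilon> x y)"

definition disk_Dt :: "real \<Rightarrow> nat \<Rightarrow> real \<Rightarrow> real \<Rightarrow> real \<Rightarrow> real \<Rightarrow> real" where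
  "disk_Dt \<mu> k \<xi> t x y = (real k + \<mu> + 1/2) / (\<mu> + 1/2) * poly (gegenbauer (\<mu> + 1/2) k) t
     * disk_D \<mu> k \<xi> x y"


section \<open>The reconstruction kernel\<close>

text \<open>
  \<open>D_hom \<mu> k \<xi> t x\<close> stands for
  \<open>(1 - x\<^sub>3\<^sup>2)\<^bsup>k/2\<^esup> D\<^sub>k(\<xi>, t; x\<^sub>1 / sqrt (1 - x\<^sub>3\<^sup>2), x\<^sub>2 / sqrt (1 - x\<^sub>3\<^sup>2))\<close>. For \<open>\<bar>x\<^sub>3\<bar> = 1\<close> it is the
  value of the polynomial in \<open>x\<close> with which this expression agrees at the points of the ball where
  \<open>\<bar>x\<^sub>3\<bar> < 1\<close>.
\<close>

definition D_hom_formula :: "real \<Rightarrow> nat \<Rightarrow> real \<Rightarrow> real \<Rightarrow> real ^ 3 \<Rightarrow> real" where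
  "D_hom_formula \<mu> k \<xi> t x = (1 - (x $ 3)\<^sup>2) powr (real k / 2) *
     disk_Dt \<mu> k \<xi> t (x $ 1 / sqrt (1 - (x $ 3)\<^sup>2)) (x $ 2 / sqrt (1 - (x $ 3)\<^sup>2))"

definition D_hom :: "real \<Rightarrow> nat \<Rightarrow> real \<Rightarrow> real \<Rightarrow> real ^ 3 \<Rightarrow> real" where
  "D_hom \<mu> k \<xi> t x =
     (if \<bar>x $ 3\<bar> < 1 then D_hom_formula \<mu> k \<xi> t x
      else (THE Q. real_polynomial_function Q \<and>
              (\<forall>y\<in>cball 0 1. \<bar>y $ 3\<bar> < 1 \<longrightarrow> Q y = D_hom_formula \<mu> k \<xi> t y)) x)"

text \<open>
  \<open>(1 - w\<^sup>2)\<^bsup>k/2\<^esup>\<close> is written as a power of the square root, hence is 1 for \<open>k = 0\<close> and every \<open>w\<close>.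
\<close>

definition kernel_G ::
  "real \<Rightarrow> nat \<Rightarrow> real \<Rightarrow> real \<Rightarrow> real \<Rightarrow> real ^ 3 \<Rightarrow> real" where
  "kernel_G \<mu> l \<xi> t w x = ball_const \<mu> * (\<Sum>k\<le>l.
     pochhammer (\<mu> + 2) k / pochhammer (\<mu> + 3/2) k * D_hom \<mu> k \<xi> t x * sqrt (1 - w\<^sup>2) ^ k
       * gegenbauer_normed (real k + \<mu> + 1) (l - k) w
       * gegenbauer_normed (real k + \<mu> + 1) (l - k) (x $ 3))"

definition kernel_Phi ::
  "real \<Rightarrow> nat \<Rightarrow> real \<Rightarrow> real \<Rightarrow> real \<Rightarrow> real ^ 3 \<Rightarrow> real" where
  "kernel_Phi \<mu> n \<xi> t w x = (\<Sum>l\<le>n. kernel_G \<mu> l \<xi> t w x)"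

end

theory Submission
  imports Defs
begin

text \<open>
  On the disk, a polynomial \<open>P\<close> of \<open>\<V>\<^sub>k\<^sup>2\<close> has chord integrals proportional to
  \<open>P(\<xi>) C\<^sub>k\<^sup>\<lambda>(t) (1 - t\<^sup>2)\<^sup>\<mu>\<close>, where \<open>\<lambda> = \<mu> + 1/2\<close> (Marr): these integrals are \<open>(1 - t\<^sup>2)\<^sup>\<mu>\<close> times a polynomial
  of degree at most \<open>k\<close> that is orthogonal to all lower degrees and whose value at \<open>t = 1\<close> is a
  multiple of \<open>P(\<xi>)\<close>. Slicing the ball horizontally, the kernel reproduces an element of the standard
  basis of \<open>\<V>\<^sub>l\<^sup>3\<close> as soon as sampling the disk basis on the circle at the \<open>2 m + 1\<close> nodes does. That is discrete
  orthogonality: two angular frequencies of equal parity add up to an even number of size at most \<open>4 m\<close>,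
  so aliasing modulo the odd number \<open>2 m + 1\<close> cannot occur, and \<open>\<lambda>\<^bsub>i,k\<^esub>\<close> is the inverse of the
  mean square of the basis function on the circle. The basis spans all polynomials, so the reconstruction operator
  is the identity on polynomials of degree at most \<open>2 m\<close>; as its kernel is such a polynomial in the
  integration variable, it annihilates the orthogonal complement.
\<close>

section \<open>Jacobi and Gegenbauer polynomials\<close>

text \<open>Samples on the circle see the radial polynomials only at the endpoint 1, so Jacobi and
  Gegenbauer polynomials are both expressed through one hypergeometric polynomial with value 1
  there. The inner products of the basis elements among themselves are never evaluated: only their
  pairings with ridge polynomials are, and the pairing of a function with a ridge polynomial is a
  moment of its Radon data. The rest is duality; in particular the uniqueness of the projections
  comes from the reproducing identity and not from positivity of the inner product. The constants
  are forced: \<open>ball_const \<mu>\<close> times h_k^2 is the reciprocal of a product of three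
  weight integrals, along the chord, in t and in w. Two analytic obstacles shape the measure theory.
  The weight is unbounded for \<mu> < 1/2, so even its integrability needs an argument. And a
  Lebesgue measurable function may restrict badly to single chords, so a Borel representative is
  used and exceptional null sets are carried through the iterated integrals.\<close>

lemma measurable_poly [measurable]: "poly (p :: real poly) \<in> borel_measurable borel"
  by (intro borel_measurable_continuous_onI continuous_intros)

definition jacobi_weight :: "real \<Rightarrow> real \<Rightarrow> real \<Rightarrow> real" where
  "jacobi_weight \<alpha> \<beta> t = (1 - t) powr \<alpha> * (1 + t) powr \<beta>"

definition jint :: "real \<Rightarrow> real \<Rightarrow> real poly \<Rightarrow> real" where
  "jint \<alpha> \<beta> p = (LINT t:{-1..1}|lebesgue. poly p t * jacobi_weight \<alpha> \<beta> t)"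

lemma has_integral_jacobi_weight:
  assumes "\<alpha> > -1" "\<beta> > -1"
  shows "(jacobi_weight \<alpha> \<beta> has_integral 2 powr (\<alpha> + \<beta> + 1) * Beta (\<alpha> + 1) (\<beta> + 1)) {-1..1}"
proof -
  have "((\<lambda>t. t powr (\<beta> + 1 - 1) * (1 - t) powr (\<alpha> + 1 - 1)) has_integral Beta (\<beta> + 1) (\<alpha> + 1)) {0..1}"
    using assms by (intro has_integral_Beta_real) auto
  then have "((\<lambda>t. t powr \<beta> * (1 - t) powr \<alpha>) has_integral Beta (\<alpha> + 1) (\<beta> + 1)) (cbox 0 1)"
    by (simp add: Beta_commute cbox_interval)
  from has_integral_affinity[OF this, of "1/2" "1/2"]
  have "((\<lambda>x. (x / 2 + 1 / 2) powr \<beta> * (1 - (x / 2 + 1 / 2)) powr \<alpha>) has_integral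
     2 * Beta (\<alpha> + 1) (\<beta> + 1)) {-1..1}"
    by (simp add: cbox_interval image_affinity_atLeastAtMost_diff)
  then have "((\<lambda>x. 2 powr (\<alpha> + \<beta>) * ((x / 2 + 1 / 2) powr \<beta> * (1 - (x / 2 + 1 / 2)) powr \<alpha>)) has_integral
     2 powr (\<alpha> + \<beta>) * (2 * Beta (\<alpha> + 1) (\<beta> + 1))) {-1..1}"
    by (rule has_integral_mult_right)
  moreover have "2 powr (\<alpha> + \<beta>) * ((x / 2 + 1 / 2) powr \<beta> * (1 - (x / 2 + 1 / 2)) powr \<alpha>) = jacobi_weight \<alpha> \<beta> x"
    if "x \<in> {-1..1}" for x
  proof -
    have "(2 powr \<beta> * (x / 2 + 1 / 2) powr \<beta>) = (1 + x) powr \<beta>"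
      using that by (subst powr_mult[symmetric]) (auto simp: algebra_simps)
    moreover have "(2 powr \<alpha> * (1 - (x / 2 + 1 / 2)) powr \<alpha>) = (1 - x) powr \<alpha>"
      using that by (subst powr_mult[symmetric]) (auto simp: algebra_simps)
    ultimately show ?thesis
      unfolding jacobi_weight_def powr_add by (metis mult.assoc mult.commute)
  qed
  ultimately show ?thesis
    by (subst has_integral_cong[symmetric]) (auto simp: powr_add mult_ac)
qed

lemma integrable_jacobi_weight:
  assumes "\<alpha> > -1" "\<beta> > -1"
  shows "set_integrable lebesgue {-1..1} (jacobi_weight \<alpha> \<beta>)"
  using has_integral_jacobi_weight[OF assms]
  by (intro nonnegative_absolutely_integrable_1) (auto simp: jacobi_weight_def integrable_on_def)

lemma set_integrable_continuous_mult:
  fixes g f :: "real \<Rightarrow> real"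
  assumes "set_integrable lebesgue {a..b} f" "continuous_on {a..b} g"
  shows "set_integrable lebesgue {a..b} (\<lambda>t. g t * f t)"
  using assms
  by (intro absolutely_integrable_bounded_measurable_product_real
       continuous_imp_measurable_on_sets_lebesgue compact_imp_bounded compact_continuous_image) auto

lemma integrable_poly_jacobi_weight:
  assumes "\<alpha> > -1" "\<beta> > -1"
  shows "set_integrable lebesgue {-1..1} (\<lambda>t. poly p t * jacobi_weight \<alpha> \<beta> t)"
  by (intro set_integrable_continuous_mult integrable_jacobi_weight assms continuous_intros)

lemma jint_add:
  assumes "\<alpha> > -1" "\<beta> > -1"
  shows "jint \<alpha> \<beta> (p + q) = jint \<alpha> \<beta> p + jint \<alpha> \<beta> q"
  unfolding jint_def poly_add distrib_right
  by (intro set_integral_add integrable_poly_jacobi_weight assms)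

lemma jint_smult: "jint \<alpha> \<beta> (smult c p) = c * jint \<alpha> \<beta> p"
  unfolding jint_def by (simp add: mult.assoc)

lemma jint_0 [simp]: "jint \<alpha> \<beta> 0 = 0"
  unfolding jint_def by simp

lemma jint_sum:
  assumes "\<alpha> > -1" "\<beta> > -1"
  shows "jint \<alpha> \<beta> (\<Sum>i\<in>A. p i) = (\<Sum>i\<in>A. jint \<alpha> \<beta> (p i))"
  by (induction A rule: infinite_finite_induct) (auto simp: jint_add assms)

lemma jint_diff:
  assumes "\<alpha> > -1" "\<beta> > -1"
  shows "jint \<alpha> \<beta> (p - q) = jint \<alpha> \<beta> p - jint \<alpha> \<beta> q"
  using jint_add[OF assms, of "p - q" q] by simp

text \<open>Powers of 1 - t and 1 + t merely shift the exponents of the weight. All Jacobi integrals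
  below are reduced to these.\<close>

lemma jint_powers:
  assumes "\<alpha> > -1" "\<beta> > -1"
  shows "jint \<alpha> \<beta> ([:1, -1:] ^ k * [:1, 1:] ^ n) =
    2 powr (\<alpha> + \<beta> + real k + real n + 1) * Beta (\<alpha> + 1 + real k) (\<beta> + 1 + real n)"
proof -
  have "jint \<alpha> \<beta> ([:1, -1:] ^ k * [:1, 1:] ^ n) =
     (LINT t:{-1..1}|lebesgue. jacobi_weight (\<alpha> + real k) (\<beta> + real n) t)"
    unfolding jint_def
  proof (rule set_lebesgue_integral_cong_AE)
    show "AE t\<in>{-1..1} in lebesgue. poly ([:1, - 1:] ^ k * [:1, 1:] ^ n) t * jacobi_weight \<alpha> \<beta> t =
            jacobi_weight (\<alpha> + real k) (\<beta> + real n) t"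
    proof -
      \<comment> \<open>The endpoints are dropped because a real power turns into a natural one only
        for a positive base.\<close>
      have "AE t in lborel. t \<noteq> -1 \<and> t \<noteq> (1::real)"
        by (auto intro!: AE_conjI AE_lborel_singleton)
      then have "AE t in lebesgue. t \<noteq> -1 \<and> t \<noteq> (1::real)"
        by (rule AE_completion)
      then show ?thesis
        by eventually_elim (auto simp: jacobi_weight_def powr_add powr_realpow mult_ac)
    qed
  qed (use assms in \<open>auto simp: jacobi_weight_def intro!: measurable_completion\<close>)
  also have "\<dots> = integral {-1..1} (jacobi_weight (\<alpha> + real k) (\<beta> + real n))"
    using assms by (intro set_lebesgue_integral_eq_integral integrable_jacobi_weight) auto
  also have "\<dots> = 2 powr (\<alpha> + \<beta> + real k + real n + 1) * Beta (\<alpha> + 1 + real k) (\<beta> + 1 + real n)"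
    using has_integral_jacobi_weight[of "\<alpha> + real k" "\<beta> + real n"] assms
    by (intro integral_unique) (simp add: add_ac)
  finally show ?thesis .
qed

text \<open>The terminating hypergeometric sum 2F1(-l, l + \<alpha> + \<beta> + 1; \<alpha> + 1; (1
  - t)/2): the Jacobi polynomial scaled to the value 1 at t = 1.\<close>

definition jacobi_base :: "real \<Rightarrow> real \<Rightarrow> nat \<Rightarrow> real poly" where
  "jacobi_base \<alpha> \<beta> l = (\<Sum>k\<le>l. smult
     (pochhammer (real l + \<alpha> + \<beta> + 1) k * pochhammer (- real l) k /
       (fact k * pochhammer (\<alpha> + 1) k) / 2 ^ k) ([:1, -1:] ^ k))"

lemma degree_linear_power_le: "degree ([:a, b:] ^ k :: real poly) \<le> k"
  by (rule order_trans[OF degree_power_le]) (auto)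

lemma coeff_linear_power_top: "coeff ([:a, b:] ^ k :: real poly) k = b ^ k"
proof (induction k)
  case (Suc k)
  have "coeff ([:a, b:] ^ Suc k) (Suc k) = a * coeff ([:a, b:] ^ k) (Suc k) + b * coeff ([:a, b:] ^ k) k"
    by (simp add: mult_pCons_left)
  also have "coeff ([:a, b:] ^ k) (Suc k) = 0"
    using degree_linear_power_le[of a b k] by (intro coeff_eq_0) auto
  finally show ?case using Suc by simp
qed auto

lemma degree_jacobi_base_le: "degree (jacobi_base \<alpha> \<beta> l) \<le> l"
  unfolding jacobi_base_def
  by (intro degree_sum_le) (auto intro: order_trans[OF degree_smult_le] order_trans[OF degree_linear_power_le])

lemma poly_jacobi_base_1 [simp]: "poly (jacobi_base \<alpha> \<beta> l) 1 = 1"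
proof -
  have "poly (jacobi_base \<alpha> \<beta> l) 1 = (\<Sum>k\<le>l. if k = 0 then 1 else 0)"
    unfolding jacobi_base_def poly_sum by (intro sum.cong) auto
  then show ?thesis by simp
qed

lemma coeff_jacobi_base:
  "coeff (jacobi_base \<alpha> \<beta> l) l = pochhammer (real l + \<alpha> + \<beta> + 1) l / (pochhammer (\<alpha> + 1) l * 2 ^ l)"
proof -
  have "coeff (jacobi_base \<alpha> \<beta> l) l = (\<Sum>k\<le>l. (if k = l then
     (pochhammer (real l + \<alpha> + \<beta> + 1) l * pochhammer (- real l) l /
       (fact l * pochhammer (\<alpha> + 1) l) / 2 ^ l) * (- 1) ^ l else 0))"
    unfolding jacobi_base_def coeff_sum
  proof (intro sum.cong refl)
    fix k assume "k \<in> {..l}"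
    then show "coeff (smult (pochhammer (real l + \<alpha> + \<beta> + 1) k * pochhammer (- real l) k /
       (fact k * pochhammer (\<alpha> + 1) k) / 2 ^ k) ([:1, -1:] ^ k)) l = (if k = l then
     (pochhammer (real l + \<alpha> + \<beta> + 1) l * pochhammer (- real l) l /
       (fact l * pochhammer (\<alpha> + 1) l) / 2 ^ l) * (- 1) ^ l else 0)"
      using degree_linear_power_le[of 1 "-1" k] by (auto simp: coeff_linear_power_top intro!: coeff_eq_0)
  qed
  also have "\<dots> = pochhammer (real l + \<alpha> + \<beta> + 1) l / (pochhammer (\<alpha> + 1) l * 2 ^ l)"
    using pochhammer_same[of l, where ?'a = real] by (simp add: power_mult_distrib[symmetric])
  finally show ?thesis .
qed

lemma coeff_jacobi_base_pos:
  assumes "\<alpha> > -1" "\<beta> > -1"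
  shows "coeff (jacobi_base \<alpha> \<beta> l) l > 0"
\<comment> \<open>For l = 0 the number \<alpha> + \<beta> + 1 may be negative, but the Pochhammer
  symbols are empty; for l \<ge> 1 all factors are positive.\<close>
proof (cases l)
  case (Suc n)
  then have "real l \<ge> 1" by simp
  with assms show ?thesis
    unfolding coeff_jacobi_base by (intro divide_pos_pos mult_pos_pos pochhammer_pos) auto
qed (simp add: coeff_jacobi_base)

lemma degree_jacobi_base:
  assumes "\<alpha> > -1" "\<beta> > -1"
  shows "degree (jacobi_base \<alpha> \<beta> l) = l"
  using coeff_jacobi_base_pos[OF assms, of l] degree_jacobi_base_le[of \<alpha> \<beta> l]
  by (intro antisym le_degree) auto

lemma pos_not_nonpos_Ints: "x > 0 \<Longrightarrow> x \<notin> \<int>\<^sub>\<le>\<^sub>0" for x :: real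
  by (auto elim!: nonpos_Ints_cases)

lemma Beta_pochhammer:
  assumes "a > 0" "b > (0::real)"
  shows "Beta (a + real k) b = pochhammer a k / pochhammer (a + b) k * Beta a b"
proof -
  have "Gamma a \<noteq> 0" "Gamma (a + b) \<noteq> 0"
    using Gamma_real_pos[of a] Gamma_real_pos[of "a + b"] assms
    by (metis add_pos_pos less_irrefl)+
  then have "pochhammer a k * Gamma a = Gamma (a + real k)"
       "pochhammer (a + b) k * Gamma (a + b) = Gamma (a + b + real k)"
    using assms by (simp_all add: pochhammer_Gamma pos_not_nonpos_Ints)
  moreover have "Gamma (a + b) > 0" "Gamma (a + b + real k) > 0" "pochhammer (a + b) k > 0"
    using assms by (auto intro!: Gamma_real_pos pochhammer_pos)
  ultimately show ?thesis
    unfolding Beta_def by (auto simp: field_simps)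
qed

text \<open>Integrating termwise, the factor (\<alpha> + 1)_k of the Beta value cancels the one in
  \<open>jacobi_base\<close>, and the remaining sum is evaluated by Chu-Vandermonde. The factor (n +
  1 - l)_l contains 0 whenever n < l; this is the orthogonality relation.\<close>

lemma jint_jacobi_base_power:
  assumes "\<alpha> > -1" "\<beta> > -1"
  shows "jint \<alpha> \<beta> (jacobi_base \<alpha> \<beta> l * [:1, 1:] ^ n) =
    2 powr (\<alpha> + \<beta> + real n + 1) * Beta (\<alpha> + 1) (\<beta> + 1 + real n) *
    (pochhammer (real n + 1 - real l) l / pochhammer (\<alpha> + \<beta> + real n + 2) l)"
proof -
  let ?c = "\<lambda>k. pochhammer (real l + \<alpha> + \<beta> + 1) k * pochhammer (- real l) k /
       (fact k * pochhammer (\<alpha> + 1) k) / 2 ^ k"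
  have "jacobi_base \<alpha> \<beta> l * [:1, 1:] ^ n = (\<Sum>k\<le>l. smult (?c k) ([:1, -1:] ^ k * [:1, 1:] ^ n))"
    unfolding jacobi_base_def sum_distrib_right by (simp only: mult_smult_left)
  then have "jint \<alpha> \<beta> (jacobi_base \<alpha> \<beta> l * [:1, 1:] ^ n) = (\<Sum>k\<le>l. ?c k *
      (2 powr (\<alpha> + \<beta> + real k + real n + 1) * Beta (\<alpha> + 1 + real k) (\<beta> + 1 + real n)))"
    by (simp only: jint_sum[OF assms] jint_smult jint_powers[OF assms])
  also have "\<dots> = (\<Sum>k\<le>l. 2 powr (\<alpha> + \<beta> + real n + 1) * Beta (\<alpha> + 1) (\<beta> + 1 + real n) *
      (pochhammer (real l + \<alpha> + \<beta> + 1) k * pochhammer (- real l) k /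
        (of_nat (fact k) * pochhammer (\<alpha> + \<beta> + real n + 2) k)))"
  proof (intro sum.cong refl)
    fix k
    have "2 powr (\<alpha> + \<beta> + real k + real n + 1) = 2 powr (\<alpha> + \<beta> + real n + 1) * 2 ^ k"
      by (simp add: powr_add powr_realpow)
    moreover have "pochhammer (\<alpha> + 1) k > 0" "pochhammer (\<alpha> + \<beta> + real n + 2) k > 0"
      using assms by (auto intro!: pochhammer_pos)
    moreover have "Beta (\<alpha> + 1 + real k) (\<beta> + 1 + real n) = pochhammer (\<alpha> + 1) k /
        pochhammer (\<alpha> + \<beta> + real n + 2) k * Beta (\<alpha> + 1) (\<beta> + 1 + real n)"
      using Beta_pochhammer[of "\<alpha> + 1" "\<beta> + 1 + real n" k] assms by (simp add: algebra_simps)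
    ultimately show "?c k *
      (2 powr (\<alpha> + \<beta> + real k + real n + 1) * Beta (\<alpha> + 1 + real k) (\<beta> + 1 + real n)) =
      2 powr (\<alpha> + \<beta> + real n + 1) * Beta (\<alpha> + 1) (\<beta> + 1 + real n) *
      (pochhammer (real l + \<alpha> + \<beta> + 1) k * pochhammer (- real l) k /
        (of_nat (fact k) * pochhammer (\<alpha> + \<beta> + real n + 2) k))"
      by (simp add: divide_simps)
  qed
  also have "\<dots> = 2 powr (\<alpha> + \<beta> + real n + 1) * Beta (\<alpha> + 1) (\<beta> + 1 + real n) *
      (pochhammer (\<alpha> + \<beta> + real n + 2 - (real l + \<alpha> + \<beta> + 1)) l / pochhammer (\<alpha> + \<beta> + real n + 2) l)"
    unfolding sum_distrib_left[symmetric] atMost_atLeast0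
    by (subst Vandermonde_pochhammer) (use assms in auto)
  finally show ?thesis by (simp add: algebra_simps)
qed

text \<open>Expand q in powers of 1 + t: every power below l is annihilated, and the coefficient of
  the power l is that of q, because the shift has leading coefficient 1.\<close>

lemma jint_jacobi_base_mult:
  assumes "\<alpha> > -1" "\<beta> > -1" "degree q \<le> l"
  shows "jint \<alpha> \<beta> (jacobi_base \<alpha> \<beta> l * q) = coeff q l *
    (2 powr (\<alpha> + \<beta> + real l + 1) * Beta (\<alpha> + 1) (\<beta> + 1 + real l) *
    (fact l / pochhammer (\<alpha> + \<beta> + real l + 2) l))"
proof -
  define r where "r = pcompose q [:-1, 1:]"
  have dr: "degree r = degree q" unfolding r_def by (simp add: degree_pcompose)
  have "poly q x = poly (\<Sum>n\<le>degree q. smult (coeff r n) ([:1, 1:] ^ n)) x" for x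
  proof -
    have "poly q x = poly r (1 + x)" by (simp add: r_def poly_pcompose)
    also have "\<dots> = poly (\<Sum>n\<le>degree q. smult (coeff r n) ([:1, 1:] ^ n)) x"
      by (simp add: poly_altdef[of r] dr poly_sum)
    finally show ?thesis .
  qed
  then have q: "q = (\<Sum>n\<le>degree q. smult (coeff r n) ([:1, 1:] ^ n))"
    by (simp add: poly_eq_poly_eq_iff[symmetric] fun_eq_iff)
  have "coeff q l = coeff r l"
  proof (cases "degree q = l")
    case True
    then show ?thesis
      using lead_coeff_comp[of "[:-1, 1:]" q] dr unfolding r_def by (auto simp: )
  next
    case False
    then show ?thesis using assms dr by (simp add: coeff_eq_0)
  qed
  have "jacobi_base \<alpha> \<beta> l * q = (\<Sum>n\<le>degree q. smult (coeff r n) (jacobi_base \<alpha> \<beta> l * [:1, 1:] ^ n))"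
    by (subst q) (simp only: sum_distrib_left mult_smult_right)
  then have "jint \<alpha> \<beta> (jacobi_base \<alpha> \<beta> l * q) =
    (\<Sum>n\<le>degree q. coeff r n * jint \<alpha> \<beta> (jacobi_base \<alpha> \<beta> l * [:1, 1:] ^ n))"
    by (simp only: jint_sum[OF assms(1,2)] jint_smult)
  also have "\<dots> = (\<Sum>n\<le>degree q. if n = l then coeff r l * jint \<alpha> \<beta> (jacobi_base \<alpha> \<beta> l * [:1, 1:] ^ l) else 0)"
  proof (intro sum.cong refl)
    fix n assume n: "n \<in> {..degree q}"
    show "coeff r n * jint \<alpha> \<beta> (jacobi_base \<alpha> \<beta> l * [:1, 1:] ^ n) =
       (if n = l then coeff r l * jint \<alpha> \<beta> (jacobi_base \<alpha> \<beta> l * [:1, 1:] ^ l) else 0)"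
    proof (cases "n = l")
      case False
      then have "n < l" using n assms by auto
      then have "pochhammer (real n + 1 - real l) l = 0"
        using pochhammer_of_nat_eq_0_lemma[of "l - Suc n" l, where ?'a = real]
        by (simp add: of_nat_diff algebra_simps)
      then show ?thesis using False by (simp add: jint_jacobi_base_power[OF assms(1,2)])
    qed simp
  qed
  also have "\<dots> = coeff r l * jint \<alpha> \<beta> (jacobi_base \<alpha> \<beta> l * [:1, 1:] ^ l)"
    using assms(3) dr by (auto simp: coeff_eq_0)
  finally show ?thesis
    unfolding \<open>coeff q l = coeff r l\<close> jint_jacobi_base_power[OF assms(1,2)]
    by (simp add: pochhammer_fact)
qed


lemma jint_jacobi_base_self_pos:
  assumes "\<alpha> > -1" "\<beta> > -1"
  shows "jint \<alpha> \<beta> (jacobi_base \<alpha> \<beta> l * jacobi_base \<alpha> \<beta> l) > 0"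
proof -
  have "Beta (\<alpha> + 1) (\<beta> + 1 + real l) > 0"
    unfolding Beta_def using assms by (intro divide_pos_pos mult_pos_pos Gamma_real_pos) auto
  moreover have "pochhammer (\<alpha> + \<beta> + real l + 2) l > 0"
    using assms by (intro pochhammer_pos) auto
  ultimately show ?thesis
    using jint_jacobi_base_mult[OF assms, of "jacobi_base \<alpha> \<beta> l" l] degree_jacobi_base_le
      coeff_jacobi_base_pos[OF assms, of l] by simp
qed

text \<open>The case q = \<open>jacobi_base\<close> of the preceding formula, rewritten with the
  Pochhammer symbol shifted by one. The condition on \<alpha> + \<beta> keeps the denominator
  \<alpha> + \<beta> + 2 l + 1 positive at l = 0.\<close>

lemma jint_jacobi_base_self:
  assumes "\<alpha> > -1" "\<beta> > -1" "\<alpha> + \<beta> + 1 > 0"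
  shows "jint \<alpha> \<beta> (jacobi_base \<alpha> \<beta> l * jacobi_base \<alpha> \<beta> l) = jint \<alpha> \<beta> 1 *
    (fact l * pochhammer (\<beta> + 1) l * (\<alpha> + \<beta> + real l + 1) /
      (pochhammer (\<alpha> + 1) l * pochhammer (\<alpha> + \<beta> + 2) l * (\<alpha> + \<beta> + 2 * real l + 1)))"
proof -
  have B: "Beta (\<alpha> + 1) (\<beta> + 1 + real l) = pochhammer (\<beta> + 1) l / pochhammer (\<alpha> + \<beta> + 2) l * Beta (\<alpha> + 1) (\<beta> + 1)"
    using Beta_pochhammer[of "\<beta> + 1" "\<alpha> + 1" l] assms
    by (simp add: Beta_commute algebra_simps)
  have one: "jint \<alpha> \<beta> 1 = 2 powr (\<alpha> + \<beta> + 1) * Beta (\<alpha> + 1) (\<beta> + 1)"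
    using jint_powers[OF assms(1,2), of 0 0] by simp
  have pw: "2 powr (\<alpha> + \<beta> + real l + 1) = 2 powr (\<alpha> + \<beta> + 1) * 2 ^ l"
    by (simp add: powr_add powr_realpow)
  let ?x = "real l + \<alpha> + \<beta> + 1"
  have "pochhammer ?x l * (?x + real l) = ?x * pochhammer (?x + 1) l"
    using pochhammer_rec[of ?x l] pochhammer_rec'[of ?x l] by (simp add: mult.commute)
  then have P: "pochhammer ?x l = ?x * pochhammer (\<alpha> + \<beta> + real l + 2) l / (\<alpha> + \<beta> + 2 * real l + 1)"
    using assms(3) by (simp add: field_simps)
  have pos: "pochhammer (\<alpha> + 1) l > 0" "pochhammer (\<alpha> + \<beta> + 2) l > 0" "pochhammer (\<alpha> + \<beta> + real l + 2) l > 0"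
    "\<alpha> + \<beta> + 2 * real l + 1 > 0"
    using assms by (auto intro!: pochhammer_pos)
  show ?thesis
    unfolding jint_jacobi_base_mult[OF assms(1,2) degree_jacobi_base_le] coeff_jacobi_base B one pw P
    using pos by (simp add: divide_simps)
qed

lemma jint_jacobi_base_lower:
  assumes "\<alpha> > -1" "\<beta> > -1" "degree q < l"
  shows "jint \<alpha> \<beta> (jacobi_base \<alpha> \<beta> l * q) = 0"
  using jint_jacobi_base_mult[OF assms(1,2), of q l] assms(3) by (simp add: coeff_eq_0)

text \<open>Subtract the multiple of \<open>jacobi_base\<close> that matches the coefficient of
  degree l. A nonzero remainder of degree d < l would pair with \<open>jacobi_base\<close> of degree
  d to zero by orthogonality, and to a nonzero multiple of its leading coefficient by
  \<open>jint_jacobi_base_mult\<close>. Evaluation at 1 identifies the factor. The bound on the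
  degree is not an equality, so polynomials of lower degree (necessarily 0) are covered.\<close>

lemma orthogonal_poly_unique:
  assumes "\<alpha> > -1" "\<beta> > -1" "degree p \<le> l"
    and orth: "\<And>q. degree q < l \<Longrightarrow> jint \<alpha> \<beta> (p * q) = 0"
  shows "p = smult (poly p 1) (jacobi_base \<alpha> \<beta> l)"
proof -
  define c where "c = coeff p l / coeff (jacobi_base \<alpha> \<beta> l) l"
  define r where "r = p - smult c (jacobi_base \<alpha> \<beta> l)"
  have dr: "degree r \<le> l"
    unfolding r_def using assms(3) degree_jacobi_base_le
    by (intro degree_diff_le) (auto intro: order_trans[OF degree_smult_le])
  have cr: "coeff r l = 0"
    unfolding r_def c_def using coeff_jacobi_base_pos[OF assms(1,2), of l] by simp
  have "r = 0"
  proof (rule ccontr)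
    assume "r \<noteq> 0"
    then have dl: "degree r < l" using dr cr
      by (metis le_neq_implies_less leading_coeff_0_iff)
    let ?d = "degree r"
    have "jint \<alpha> \<beta> (jacobi_base \<alpha> \<beta> ?d * r) =
        jint \<alpha> \<beta> (p * jacobi_base \<alpha> \<beta> ?d) - c * jint \<alpha> \<beta> (jacobi_base \<alpha> \<beta> l * jacobi_base \<alpha> \<beta> ?d)"
      unfolding jint_smult[symmetric] jint_diff[OF assms(1,2), symmetric]
      by (simp add: r_def algebra_simps)
    also have "\<dots> = 0"
      using orth[of "jacobi_base \<alpha> \<beta> ?d"] jint_jacobi_base_lower[OF assms(1,2), of "jacobi_base \<alpha> \<beta> ?d" l] dl
      by (simp add: degree_jacobi_base[OF assms(1,2)])
    finally have "jint \<alpha> \<beta> (jacobi_base \<alpha> \<beta> ?d * r) = 0" .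
    moreover have "jint \<alpha> \<beta> (jacobi_base \<alpha> \<beta> ?d * r) = lead_coeff r * (jint \<alpha> \<beta> (jacobi_base \<alpha> \<beta> ?d * jacobi_base \<alpha> \<beta> ?d) /
         coeff (jacobi_base \<alpha> \<beta> ?d) ?d)"
      using coeff_jacobi_base_pos[OF assms(1,2), of ?d]
      by (subst (1 2) jint_jacobi_base_mult[OF assms(1,2)]) (auto simp: degree_jacobi_base_le)
    ultimately show False
      using \<open>r \<noteq> 0\<close> jint_jacobi_base_self_pos[OF assms(1,2), of ?d] coeff_jacobi_base_pos[OF assms(1,2), of ?d]
      by auto
  qed
  then have p: "p = smult c (jacobi_base \<alpha> \<beta> l)" by (simp add: r_def)
  then have "poly p 1 = c" by simp
  with p show ?thesis by simp
qed

section \<open>Gegenbauer and orthonormal Jacobi polynomials as multiples of the hypergeometric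
  polynomial\<close>

lemma gegenbauer_weight_eq:
  assumes "t \<in> {-1..1}"
  shows "(1 - t\<^sup>2) powr a = jacobi_weight a a t"
proof -
  have "1 - t\<^sup>2 = (1 - t) * (1 + t)" by (simp add: algebra_simps power2_eq_square)
  with assms show ?thesis by (simp add: jacobi_weight_def powr_mult)
qed

lemma jint_gegenbauer_eq:
  "(LINT s:{-1..1}|lebesgue. poly p s * poly q s * (1 - s\<^sup>2) powr a) = jint a a (p * q)"
  unfolding jint_def by (intro set_lebesgue_integral_cong) (auto simp: gegenbauer_weight_eq)

lemma gegenbauer_eq:
  assumes "a > 0"
  shows "gegenbauer a k = smult (pochhammer (2 * a) k / fact k) (jacobi_base (a - 1/2) (a - 1/2) k)"
  unfolding gegenbauer_def jint_gegenbauer_eq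
proof (rule the_equality, goal_cases)
  case 1
  have "a - 1/2 > -1" using assms by simp
  moreover have "pochhammer (2 * a) k > 0" using assms by (intro pochhammer_pos) auto
  ultimately show ?case
    by (auto simp: degree_jacobi_base jint_smult jint_jacobi_base_lower)
next
  case (2 p)
  then show ?case
    using orthogonal_poly_unique[of "a - 1/2" "a - 1/2" p k] assms by auto
qed

lemma degree_gegenbauer:
  assumes "a > 0"
  shows "degree (gegenbauer a k) = k"
proof -
  have "pochhammer (2 * a) k > 0" using assms by (intro pochhammer_pos) auto
  then show ?thesis using assms by (auto simp: gegenbauer_eq degree_jacobi_base)
qed

lemma poly_gegenbauer_1: "a > 0 \<Longrightarrow> poly (gegenbauer a k) 1 = pochhammer (2 * a) k / fact k"
  by (simp add: gegenbauer_eq)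

lemma jint_gegenbauer_lower:
  assumes "a > 0" "degree q < k"
  shows "jint (a - 1/2) (a - 1/2) (gegenbauer a k * q) = 0"
  using assms by (simp add: gegenbauer_eq jint_smult jint_jacobi_base_lower)

text \<open>Justifies the square root in \<open>gegenbauer_normed\<close>: the number under it is
  the normalized square norm.\<close>

lemma jint_gegenbauer_self:
  assumes "a > 0"
  shows "jint (a - 1/2) (a - 1/2) (gegenbauer a k * gegenbauer a k) =
    jint (a - 1/2) (a - 1/2) 1 * (a * pochhammer (2 * a) k / ((real k + a) * fact k))"
proof -
  have "2 * a * pochhammer (2 * a + 1) k = pochhammer (2 * a) k * (2 * a + real k)"
    using pochhammer_rec[of "2 * a" k] pochhammer_rec'[of "2 * a" k] by (simp add: mult.commute)
  then have P: "pochhammer (2 * a + 1) k = pochhammer (2 * a) k * (2 * a + real k) / (2 * a)"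
    using assms by (simp add: field_simps)
  have pos: "pochhammer (a + 1/2) k > 0" "pochhammer (2 * a) k > 0" "2 * a + real k > 0" "a + real k > 0"
    using assms by (auto intro!: pochhammer_pos)
  have "jint (a - 1/2) (a - 1/2) (jacobi_base (a - 1/2) (a - 1/2) k * jacobi_base (a - 1/2) (a - 1/2) k) =
    jint (a - 1/2) (a - 1/2) 1 *
    (fact k * pochhammer (a + 1/2) k * (2 * a + real k) /
      (pochhammer (a + 1/2) k * (pochhammer (2 * a) k * (2 * a + real k) / (2 * a)) * (2 * (a + real k))))"
    using jint_jacobi_base_self[of "a - 1/2" "a - 1/2" k] assms
    unfolding P[symmetric] by (simp add: algebra_simps)
  also have "\<dots> = jint (a - 1/2) (a - 1/2) 1 * (fact k * a / (pochhammer (2 * a) k * (real k + a)))"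
    using pos assms by (simp add: divide_simps)
  finally show ?thesis
    using pos assms by (simp add: gegenbauer_eq jint_smult divide_simps mult_ac)
qed

lemma jint_reflect: "jint a a (pcompose p [:0, -1:]) = jint a a p"
proof -
  have "jint a a p = (LINT t|lebesgue. indicator {-1..1} t * (poly p t * jacobi_weight a a t))"
    by (simp add: jint_def set_lebesgue_integral_def)
  also have "\<dots> = (LINT t|lborel. indicator {-1..1} t * (poly p t * jacobi_weight a a t))"
    by (intro integral_completion) (simp add: jacobi_weight_def)
  also have "\<dots> = (LINT t|lborel. indicator {-1..1} (-t) * (poly p (-t) * jacobi_weight a a (-t)))"
    by (subst lborel_integral_real_affine[where c = "-1" and t = 0]) auto
  also have "\<dots> = (LINT t|lborel. indicator {-1..1} t * (poly (pcompose p [:0, -1:]) t * jacobi_weight a a t))"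
    by (intro Bochner_Integration.integral_cong) (auto simp: jacobi_weight_def poly_pcompose indicator_def)
  also have "\<dots> = (LINT t|lebesgue. indicator {-1..1} t * (poly (pcompose p [:0, -1:]) t * jacobi_weight a a t))"
    by (intro integral_completion[symmetric]) (simp add: jacobi_weight_def)
  finally show ?thesis by (simp add: jint_def set_lebesgue_integral_def)
qed

lemma pcompose_reflect_twice: "pcompose (pcompose p [:0, -1:]) [:0, -1:] = (p :: real poly)"
  by (simp add: poly_eq_poly_eq_iff[symmetric] fun_eq_iff poly_pcompose)

text \<open>Reflection preserves the symmetric weight, so the reflected polynomial is again
  orthogonal to lower degrees and is a multiple of the original; leading coefficients give the
  factor (-1)^k. Parity is what later lets the homogenization avoid odd powers of a square
  root.\<close>

lemma gegenbauer_parity: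
  assumes "a > 0" "odd (k + n)"
  shows "coeff (gegenbauer a k) n = 0"
proof -
  let ?C = "gegenbauer a k" and ?r = "pcompose (gegenbauer a k) [:0, -1:]"
  have "?r = smult (poly ?r 1) (jacobi_base (a - 1/2) (a - 1/2) k)"
  proof (rule orthogonal_poly_unique)
    fix q :: "real poly" assume q: "degree q < k"
    have "?r * q = pcompose (?C * pcompose q [:0, -1:]) [:0, -1:]"
      by (simp add: pcompose_mult pcompose_reflect_twice)
    then show "jint (a - 1/2) (a - 1/2) (?r * q) = 0"
      using jint_gegenbauer_lower[OF assms(1), of "pcompose q [:0, -1:]" k] q
      by (simp add: jint_reflect degree_pcompose)
  qed (use assms in \<open>auto simp: degree_pcompose degree_gegenbauer\<close>)
  moreover have "pochhammer (2 * a) k > 0" using assms by (intro pochhammer_pos) auto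
  ultimately obtain e where e: "?r = smult e ?C"
    using assms(1) that[of "poly ?r 1 * fact k / pochhammer (2 * a) k"] by (simp add: gegenbauer_eq)
  have cr: "coeff ?r m = (-1) ^ m * coeff ?C m" for m
    by (simp add: coeff_pcompose_linear)
  have "coeff ?C k \<noteq> 0"
    using degree_gegenbauer[OF assms(1), of k] \<open>pochhammer (2 * a) k > 0\<close> poly_gegenbauer_1[OF assms(1), of k]
    by (metis divide_eq_0_iff fact_nonzero leading_coeff_0_iff less_irrefl poly_0)
  then have "e = (-1) ^ k"
    using cr[of k] e by simp
  then have "(-1) ^ n * coeff ?C n = (-1) ^ k * coeff ?C n"
    using cr[of n] e by (metis coeff_smult)
  moreover have "(-1 :: real) ^ n \<noteq> (-1) ^ k" using assms(2)
    by (cases "even n"; cases "even k") auto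
  ultimately show ?thesis by simp
qed

lemma jacobi_inner_eq: "jacobi_inner \<alpha> \<beta> p q = jint \<alpha> \<beta> (p * q) / jint \<alpha> \<beta> 1"
  unfolding jacobi_inner_def jint_def jacobi_weight_def by simp

lemma jint_1_pos:
  assumes "\<alpha> > -1" "\<beta> > -1"
  shows "jint \<alpha> \<beta> 1 > 0"
  using jint_jacobi_base_self_pos[OF assms, of 0] by (simp add: jacobi_base_def one_pCons)

lemma jacobi_eq:
  assumes "\<alpha> > -1" "\<beta> > -1"
  shows "jacobi \<alpha> \<beta> l = smult (sqrt (jint \<alpha> \<beta> 1 / jint \<alpha> \<beta> (jacobi_base \<alpha> \<beta> l * jacobi_base \<alpha> \<beta> l)))
    (jacobi_base \<alpha> \<beta> l)"
  unfolding jacobi_def jacobi_inner_eq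
proof (rule the_equality, goal_cases)
  note pos = jint_1_pos[OF assms] jint_jacobi_base_self_pos[OF assms, of l] coeff_jacobi_base_pos[OF assms, of l]
  {
    case 1
    show ?case
      using pos by (auto simp: degree_jacobi_base[OF assms] jint_smult jint_jacobi_base_lower[OF assms])
  next
    case (2 p)
    then have p: "p = smult (poly p 1) (jacobi_base \<alpha> \<beta> l)"
      using pos by (intro orthogonal_poly_unique) (auto simp: assms)
    \<comment> \<open>The sign condition on the leading coefficient becomes a sign condition at 1
      and selects the positive root.\<close>
    then have c: "poly p 1 > 0"
      using 2 pos by (metis coeff_smult degree_jacobi_base[OF assms] zero_less_mult_pos2)
    have "jint \<alpha> \<beta> (p * p) = jint \<alpha> \<beta> 1" using 2 pos by auto
    moreover have "jint \<alpha> \<beta> (p * p) = (poly p 1)\<^sup>2 * jint \<alpha> \<beta> (jacobi_base \<alpha> \<beta> l * jacobi_base \<alpha> \<beta> l)"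
      by (subst (1 2) p) (simp add: jint_smult power2_eq_square)
    ultimately have "poly p 1 = sqrt (jint \<alpha> \<beta> 1 / jint \<alpha> \<beta> (jacobi_base \<alpha> \<beta> l * jacobi_base \<alpha> \<beta> l))"
      using pos c by (intro real_sqrt_unique[symmetric]) (auto simp: field_simps)
    with p show ?case by simp
  }
qed

lemma jint_jacobi_lower:
  assumes "\<alpha> > -1" "\<beta> > -1" "degree q < l"
  shows "jint \<alpha> \<beta> (jacobi \<alpha> \<beta> l * q) = 0"
  by (simp add: jacobi_eq assms jint_smult jint_jacobi_base_lower)

lemma degree_jacobi:
  assumes "\<alpha> > -1" "\<beta> > -1"
  shows "degree (jacobi \<alpha> \<beta> l) = l"
  using jint_1_pos[OF assms] jint_jacobi_base_self_pos[OF assms, of l]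
  by (simp add: jacobi_eq[OF assms] degree_jacobi_base[OF assms])

text \<open>Since \<open>jacobi_base\<close> is 1 at 1, this is the reciprocal of its normalized
  square norm. The square suffices because both factors of the kernel are built from the same basis
  function.\<close>

lemma poly_jacobi_1_squared:
  assumes "\<alpha> > -1" "\<beta> > -1" "\<alpha> + \<beta> + 1 > 0"
  shows "(poly (jacobi \<alpha> \<beta> l) 1)\<^sup>2 =
    pochhammer (\<alpha> + 1) l * pochhammer (\<alpha> + \<beta> + 2) l * (\<alpha> + \<beta> + 2 * real l + 1) /
    (fact l * pochhammer (\<beta> + 1) l * (\<alpha> + \<beta> + real l + 1))"
proof -
  have "(poly (jacobi \<alpha> \<beta> l) 1)\<^sup>2 = jint \<alpha> \<beta> 1 / jint \<alpha> \<beta> (jacobi_base \<alpha> \<beta> l * jacobi_base \<alpha> \<beta> l)"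
    using jint_1_pos[OF assms(1,2)] jint_jacobi_base_self_pos[OF assms(1,2), of l]
    by (simp add: jacobi_eq[OF assms(1,2)])
  then show ?thesis
    unfolding jint_jacobi_base_self[OF assms] using jint_1_pos[OF assms(1,2)] by simp
qed

section \<open>Chord integrals and radial integrals\<close>

text \<open>Tonelli with one-dimensional substitutions: for c \<noteq> 0 replace the second
  coordinate by the rotated one, exchange the order, then replace the first; the Jacobians 1/|c| and
  |c| cancel. For c = 0 the rotation exchanges the coordinates up to signs.\<close>

lemma distr_rotate_pair:
  fixes c s :: real
  assumes cs: "c\<^sup>2 + s\<^sup>2 = 1"
  shows "distr (lborel :: (real \<times> real) measure) borel (\<lambda>(x, y). (c * x - s * y, s * x + c * y)) = lborel"
proof (rule measure_eqI)
  fix A :: "(real \<times> real) set"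
  assume "A \<in> sets (distr lborel borel (\<lambda>(x, y). (c * x - s * y, s * x + c * y)))"
  then have A [measurable]: "A \<in> sets borel" by simp
  define h :: "real \<times> real \<Rightarrow> ennreal" where "h = indicator A"
  have h [measurable]: "h \<in> borel_measurable borel" unfolding h_def by simp
  have h' [measurable]: "h \<in> borel_measurable (borel \<Otimes>\<^sub>M borel)"
    using h by (simp add: borel_prod)
  have pair: "(\<integral>\<^sup>+z. k z \<partial>lborel) = (\<integral>\<^sup>+x. \<integral>\<^sup>+y. k (x, y) \<partial>lborel \<partial>lborel)"
    "(\<integral>\<^sup>+z. k z \<partial>lborel) = (\<integral>\<^sup>+y. \<integral>\<^sup>+x. k (x, y) \<partial>lborel \<partial>lborel)"
    if "k \<in> borel_measurable (borel \<Otimes>\<^sub>M borel)" for k :: "real \<times> real \<Rightarrow> ennreal"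
    using that lborel.nn_integral_fst[of k lborel] lborel_pair.nn_integral_snd[of k]
    by (simp_all add: lborel_prod borel_prod split_def)
  have "emeasure (distr lborel borel (\<lambda>(x, y). (c * x - s * y, s * x + c * y))) A =
      (\<integral>\<^sup>+z. h z \<partial>distr lborel borel (\<lambda>(x, y). (c * x - s * y, s * x + c * y)))"
    by (simp add: h_def)
  also have "\<dots> = (\<integral>\<^sup>+z. h (c * fst z - s * snd z, s * fst z + c * snd z) \<partial>lborel)"
    by (subst nn_integral_distr) (auto simp: split_def borel_prod[symmetric])
  also have "\<dots> = (\<integral>\<^sup>+x. \<integral>\<^sup>+y. h (c * x - s * y, s * x + c * y) \<partial>lborel \<partial>lborel)"
    by (subst pair(1)) (auto)
  also have "\<dots> = (\<integral>\<^sup>+z. h z \<partial>lborel)"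
  proof (cases "c = 0")
    case True
    with cs have s: "s = 1 \<or> s = -1" by (simp add: power2_eq_1_iff)
    then have s0: "s \<noteq> 0" "\<bar>s\<bar> = 1" by auto
    have "(\<integral>\<^sup>+x. \<integral>\<^sup>+y. h (c * x - s * y, s * x + c * y) \<partial>lborel \<partial>lborel) =
        (\<integral>\<^sup>+x. \<integral>\<^sup>+y. h (y, s * x) \<partial>lborel \<partial>lborel)"
    proof (rule nn_integral_cong)
      fix x
      show "(\<integral>\<^sup>+y. h (c * x - s * y, s * x + c * y) \<partial>lborel) = (\<integral>\<^sup>+y. h (y, s * x) \<partial>lborel)"
        using nn_integral_real_affine[of "\<lambda>y. h (y, s * x)" "-s" 0] s0 by (simp add: True)
    qed
    also have "\<dots> = (\<integral>\<^sup>+x. \<integral>\<^sup>+y. h (y, x) \<partial>lborel \<partial>lborel)"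
      using nn_integral_real_affine[of "\<lambda>x. \<integral>\<^sup>+y. h (y, x) \<partial>lborel" "s" 0] s0 by simp
    finally show ?thesis using pair(2)[of h] by simp
  next
    case False
    have "(\<integral>\<^sup>+x. \<integral>\<^sup>+y. h (c * x - s * y, s * x + c * y) \<partial>lborel \<partial>lborel) =
        (\<integral>\<^sup>+x. ennreal \<bar>1 / c\<bar> * \<integral>\<^sup>+y. h ((x - s * y) / c, y) \<partial>lborel \<partial>lborel)"
    proof (rule nn_integral_cong)
      fix x
      \<comment> \<open>This is where c^2 + s^2 = 1 enters: with y' = s x + c y, the first rotated
        coordinate is (x - s y') / c.\<close>
      have e: "(x - s * (s * x + c * y)) / c = c * x - s * y" for y
      proof -
        have "x - s * (s * x + c * y) = (c\<^sup>2 + s\<^sup>2) * x - s * (s * x + c * y)" using cs by simp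
        then show ?thesis using False by (simp add: field_simps power2_eq_square)
      qed
      have "(\<integral>\<^sup>+y. h ((x - s * y) / c, y) \<partial>lborel) =
         ennreal \<bar>c\<bar> * (\<integral>\<^sup>+y. h ((x - s * (s * x + c * y)) / c, s * x + c * y) \<partial>lborel)"
        by (rule nn_integral_real_affine) (use False in auto)
      then show "(\<integral>\<^sup>+y. h (c * x - s * y, s * x + c * y) \<partial>lborel) =
          ennreal \<bar>1 / c\<bar> * (\<integral>\<^sup>+y. h ((x - s * y) / c, y) \<partial>lborel)"
        using False by (simp add: e mult.assoc[symmetric] ennreal_mult[symmetric] abs_mult[symmetric])
    qed
    also have "\<dots> = ennreal \<bar>1 / c\<bar> * (\<integral>\<^sup>+x. \<integral>\<^sup>+y. h ((x - s * y) / c, y) \<partial>lborel \<partial>lborel)"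
      by (rule nn_integral_cmult) simp
    also have "(\<integral>\<^sup>+x. \<integral>\<^sup>+y. h ((x - s * y) / c, y) \<partial>lborel \<partial>lborel) =
        (\<integral>\<^sup>+y. \<integral>\<^sup>+x. h ((x - s * y) / c, y) \<partial>lborel \<partial>lborel)"
      by (rule lborel_pair.Fubini') simp
    also have "\<dots> = (\<integral>\<^sup>+y. ennreal \<bar>c\<bar> * \<integral>\<^sup>+x. h (x, y) \<partial>lborel \<partial>lborel)"
    proof (rule nn_integral_cong)
      fix y
      show "(\<integral>\<^sup>+x. h ((x - s * y) / c, y) \<partial>lborel) = ennreal \<bar>c\<bar> * \<integral>\<^sup>+x. h (x, y) \<partial>lborel"
        using nn_integral_real_affine[of "\<lambda>x. h ((x - s * y) / c, y)" "c" "s * y"] False by simp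
    qed
    also have "\<dots> = ennreal \<bar>c\<bar> * (\<integral>\<^sup>+y. \<integral>\<^sup>+x. h (x, y) \<partial>lborel \<partial>lborel)"
      by (rule nn_integral_cmult) simp
    finally show ?thesis
      using pair(2)[of h] False
      by (simp add: mult.assoc[symmetric] ennreal_mult[symmetric] abs_mult[symmetric])
  qed
  also have "\<dots> = emeasure lborel A" by (simp add: h_def)
  finally show "emeasure (distr lborel borel (\<lambda>(x, y). (c * x - s * y, s * x + c * y))) A = emeasure lborel A" .
qed simp

lemma vec3_eq: "(vector [a, b, c] :: real ^ 3) = a *\<^sub>R axis 1 1 + b *\<^sub>R axis 2 1 + c *\<^sub>R axis 3 1"
  by (simp add: vec_eq_iff forall_3 axis_def)

lemma measurable_vec3 [measurable]:
  assumes [measurable]: "f \<in> borel_measurable M" "g \<in> borel_measurable M" "h \<in> borel_measurable M"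
  shows "(\<lambda>x. vector [f x, g x, h x] :: real ^ 3) \<in> borel_measurable M"
  unfolding vec3_eq by measurable

lemma measurable_vec_nth' [measurable]: "(\<lambda>x :: real ^ 'n. x $ i) \<in> borel_measurable borel"
  by (intro borel_measurable_continuous_onI continuous_intros)

lemma measurable_vec3_triple: "(\<lambda>(w, p, q). vector [p, q, w] :: real ^ 3) \<in> lborel \<rightarrow>\<^sub>M borel"
  unfolding split_def by (simp add: lborel_prod[symmetric] cong: measurable_cong_sets)

lemma measurable_Complex_pair: "(\<lambda>(t, s). Complex t s) \<in> lborel \<rightarrow>\<^sub>M borel"
  unfolding split_def Complex_eq by (simp add: lborel_prod[symmetric] cong: measurable_cong_sets)

text \<open>The height is the first entry of the triple, so iterated integration begins with
  horizontal slices.\<close>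

lemma lborel_eq_distr_vec3:
  "(lborel :: (real ^ 3) measure) = distr (lborel :: (real \<times> real \<times> real) measure) borel (\<lambda>(w, p, q). vector [p, q, w])"
proof (rule lborel_eqI)
  fix l u :: "real ^ 3"
  assume le: "\<And>b. b \<in> Basis \<Longrightarrow> l \<bullet> b \<le> u \<bullet> b"
  have le': "l $ i \<le> u $ i" for i
    using le[of "axis i 1"] by (simp add: inner_axis)
  note m = measurable_vec3_triple
  have B: "(Basis :: (real ^ 3) set) = {axis 1 1, axis 2 1, axis 3 1}"
    by (auto simp: Basis_vec_def UNIV_3)
  have "emeasure (distr lborel borel (\<lambda>(w, p, q). vector [p, q, w])) (box l u) =
     emeasure lborel ({l $ 3<..<u $ 3} \<times> {l $ 1<..<u $ 1} \<times> {l $ 2<..<u $ 2})"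
    by (subst emeasure_distr[OF m])
       (auto simp: B mem_box inner_axis forall_3 intro!: arg_cong[where f = "emeasure lborel"])
  also have "\<dots> = ennreal (u $ 3 - l $ 3) * (ennreal (u $ 1 - l $ 1) * ennreal (u $ 2 - l $ 2))"
    using le' by (subst lborel_prod[symmetric], subst lborel.emeasure_pair_measure_Times)
      (simp_all add: lborel_prod[symmetric] lborel.emeasure_pair_measure_Times)
  also have "\<dots> = (\<Prod>b\<in>Basis. (u - l) \<bullet> b)"
    using le' unfolding B
    by (subst prod.insert) (auto simp: axis_eq_axis inner_axis ennreal_mult[symmetric] mult_ac)
  finally show "emeasure (distr lborel borel (\<lambda>(w, p, q). vector [p, q, w])) (box l u) =
     ennreal (\<Prod>b\<in>Basis. (u - l) \<bullet> b)" .
qed simp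

lemma lborel_eq_distr_complex:
  "(lborel :: complex measure) = distr (lborel :: (real \<times> real) measure) borel (\<lambda>(t, s). Complex t s)"
proof (rule lborel_eqI)
  fix l u :: complex
  assume le: "\<And>b. b \<in> Basis \<Longrightarrow> l \<bullet> b \<le> u \<bullet> b"
  have le': "Re l \<le> Re u" "Im l \<le> Im u"
    using le[of 1] le[of \<i>] by (auto simp: Basis_complex_def inner_complex_def)
  note m = measurable_Complex_pair
  have "emeasure (distr lborel borel (\<lambda>(t, s). Complex t s)) (box l u) =
     emeasure lborel ({Re l<..<Re u} \<times> {Im l<..<Im u})"
    by (subst emeasure_distr[OF m])
       (auto simp: Basis_complex_def mem_box inner_complex_def intro!: arg_cong[where f = "emeasure lborel"])
  also have "\<dots> = ennreal (Re u - Re l) * ennreal (Im u - Im l)"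
    using le' by (simp add: lborel_prod[symmetric] lborel.emeasure_pair_measure_Times)
  also have "\<dots> = (\<Prod>b\<in>Basis. (u - l) \<bullet> b)"
    using le' by (simp add: Basis_complex_def inner_complex_def ennreal_mult[symmetric])
  finally show "emeasure (distr lborel borel (\<lambda>(t, s). Complex t s)) (box l u) =
     ennreal (\<Prod>b\<in>Basis. (u - l) \<bullet> b)" .
qed simp

lemma distr_rotate_complex:
  assumes "cmod v = 1"
  shows "distr lborel borel (\<lambda>z. v * z) = lborel"
proof -
  have cs: "(Re v)\<^sup>2 + (Im v)\<^sup>2 = 1"
    using assms by (metis cmod_power2 power_one)
  note mC [measurable] = measurable_Complex_pair
  have mC' [measurable]: "(\<lambda>(t, s). Complex t s) \<in> borel \<rightarrow>\<^sub>M borel"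
    using mC by simp
  have mR [measurable]: "(\<lambda>(x, y). (Re v * x - Im v * y, Im v * x + Re v * y)) \<in> lborel \<rightarrow>\<^sub>M (borel :: (real \<times> real) measure)"
    unfolding split_def by (simp add: lborel_prod[symmetric] borel_prod[symmetric])
  have "distr lborel borel (\<lambda>z. v * z) = distr (lborel :: (real \<times> real) measure) borel (\<lambda>(t, s). v * Complex t s)"
    by (subst lborel_eq_distr_complex, subst distr_distr) (use mC in \<open>auto simp: comp_def split_def\<close>)
  also have "\<dots> = distr (lborel :: (real \<times> real) measure) borel
      ((\<lambda>(t, s). Complex t s) \<circ> (\<lambda>(x, y). (Re v * x - Im v * y, Im v * x + Re v * y)))"
    by (intro distr_cong) (auto simp: complex_eq_iff)
  also have "\<dots> = distr (distr lborel borel (\<lambda>(x, y). (Re v * x - Im v * y, Im v * x + Re v * y))) borel (\<lambda>(t, s). Complex t s)"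
    by (rule distr_distr[symmetric]) auto
  also have "\<dots> = lborel"
    by (simp only: distr_rotate_pair[OF cs] lborel_eq_distr_complex[symmetric])
  finally show ?thesis .
qed

text \<open>In these coordinates p is the signed distance of a chord from the vertical axis and q is
  arc length along it.\<close>

lemma lborel_eq_distr_chord:
  "(lborel :: (real ^ 3) measure) = distr (lborel :: (real \<times> real \<times> real) measure) borel
     (\<lambda>(w, p, q). vector [p * cos \<theta> - q * sin \<theta>, p * sin \<theta> + q * cos \<theta>, w])"
  (is "_ = ?D")
proof -
  let ?R = "\<lambda>(x, y). (cos \<theta> * x - sin \<theta> * y, sin \<theta> * x + cos \<theta> * y)"
  have mR: "?R \<in> lborel \<rightarrow>\<^sub>M (borel :: (real \<times> real) measure)"
    unfolding split_def by (simp add: lborel_prod[symmetric] borel_prod[symmetric])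
  have R: "distr lborel borel ?R = (lborel :: (real \<times> real) measure)"
    by (rule distr_rotate_pair) simp
  note m = measurable_vec3_triple
  have id: "distr lborel borel (\<lambda>w. w) = (lborel :: real measure)"
    by (rule distr_id2) simp
  have "distr lborel borel (\<lambda>w :: real. w) \<Otimes>\<^sub>M distr lborel borel ?R =
      distr (lborel \<Otimes>\<^sub>M lborel) (borel \<Otimes>\<^sub>M borel) (\<lambda>(w, z). ((\<lambda>w. w) w, ?R z))"
    by (rule pair_measure_distr) (use mR in \<open>auto simp: R intro: lborel.sigma_finite_measure_axioms\<close>)
  then have P: "(lborel :: (real \<times> real \<times> real) measure) =
      distr lborel borel (\<lambda>(w, z). (w, ?R z))"
    unfolding R id lborel_prod borel_prod by simp
  have mP: "(\<lambda>(w, z). (w, ?R z)) \<in> (lborel :: (real \<times> real \<times> real) measure) \<rightarrow>\<^sub>M borel"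
    unfolding split_def by (simp add: lborel_prod[symmetric] borel_prod[symmetric] cong: measurable_cong_sets)
  have "(lborel :: (real ^ 3) measure) = distr (distr lborel borel (\<lambda>(w, z). (w, ?R z))) borel (\<lambda>(w, p, q). vector [p, q, w])"
    unfolding P[symmetric] by (rule lborel_eq_distr_vec3)
  also have "\<dots> = distr lborel borel ((\<lambda>(w, p, q). vector [p, q, w]) \<circ> (\<lambda>(w, z). (w, ?R z)))"
    by (rule distr_distr) (use m mP in auto)
  also have "\<dots> = ?D"
    by (intro distr_cong) (auto simp: mult.commute)
  finally show ?thesis .
qed


text \<open>Measurability of f is a conclusion, by completeness of the Lebesgue measure. This
  permits reasoning about restrictions to chords, where nothing but almost everywhere agreement with
  a Borel function is known.\<close>

lemma lebesgue_integral_AE_borel: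
  fixes f g :: "'a :: euclidean_space \<Rightarrow> real"
  assumes ae: "AE x in lborel. f x = g x" and g: "g \<in> borel_measurable lborel"
  shows "f \<in> borel_measurable lebesgue" "integral\<^sup>L lebesgue f = integral\<^sup>L lborel g"
    "integrable lebesgue f \<longleftrightarrow> integrable lborel g"
proof -
  have ae': "AE x in lebesgue. f x = g x" using ae by (rule AE_completion)
  have g': "g \<in> borel_measurable lebesgue" using g by (rule measurable_completion)
  show f: "f \<in> borel_measurable lebesgue"
  proof (rule measurableI)
    fix A :: "real set" assume A: "A \<in> sets borel"
    show "f -` A \<inter> space lebesgue \<in> sets lebesgue"
    proof (rule completion.in_sets_AE)
      show "AE x in lebesgue. x \<in> g -` A \<inter> space lebesgue \<longleftrightarrow> x \<in> f -` A \<inter> space lebesgue"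
        using ae' by eventually_elim auto
      show "g -` A \<inter> space lebesgue \<in> sets lebesgue"
        using g' A by (rule measurable_sets)
    qed auto
  qed auto
  have "integral\<^sup>L lebesgue f = integral\<^sup>L lebesgue g"
    using f g' ae' by (rule integral_cong_AE)
  then show "integral\<^sup>L lebesgue f = integral\<^sup>L lborel g"
    using g by (simp add: integral_completion)
  have "integrable lebesgue f \<longleftrightarrow> integrable lebesgue g"
    using f g' ae' by (rule integrable_cong_AE)
  then show "integrable lebesgue f \<longleftrightarrow> integrable lborel g"
    using g by (simp add: integrable_completion)
qed

lemma AE_lborel_scale:
  fixes r :: real
  assumes "AE p in lborel. P p" "r \<noteq> 0"
  shows "AE t in lborel. P (r * t)"
proof -
  obtain N where N: "N \<in> sets lborel" "emeasure lborel N = 0" "{p. \<not> P p} \<subseteq> N"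
    using assms(1) unfolding eventually_ae_filter null_sets_def by auto
  then have [measurable]: "N \<in> sets borel" by simp
  have "0 = (\<integral>\<^sup>+p. indicator N p \<partial>lborel)" using N by simp
  also have "\<dots> = ennreal \<bar>r\<bar> * (\<integral>\<^sup>+t. indicator N (0 + r * t) \<partial>lborel)"
    by (rule nn_integral_real_affine) (use assms in auto)
  finally have "(\<integral>\<^sup>+t. indicator N (r * t) \<partial>lborel) = 0"
    using assms(2) by (auto simp: ennreal_zero_less_mult_iff dest!: sym[of 0])
  then have "AE t in lborel. (indicator N (r * t) :: ennreal) = 0"
    by (subst (asm) nn_integral_0_iff_AE) auto
  then show ?thesis
    by eventually_elim (use N in \<open>auto simp: indicator_def split: if_splits\<close>)
qed

lemma chord_line_altdef: "chord_line \<theta> t w s =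
   (\<lambda>(w, p, q). vector [p * cos \<theta> - q * sin \<theta>, p * sin \<theta> + q * cos \<theta>, w]) (w, sqrt (1 - w\<^sup>2) * t, s)"
  by (simp add: chord_line_def mult.commute)

lemma norm_vec3: "(norm (y :: real ^ 3))\<^sup>2 = (y $ 1)\<^sup>2 + (y $ 2)\<^sup>2 + (y $ 3)\<^sup>2"
  unfolding norm_vec_def L2_set_def UNIV_3
  by (subst real_sqrt_pow2) (auto simp: sum_nonneg add_nonneg_nonneg)

lemma norm_chord: "(norm (vector [p * cos \<theta> - q * sin \<theta>, p * sin \<theta> + q * cos \<theta>, w] :: real ^ 3))\<^sup>2 =
   p\<^sup>2 + q\<^sup>2 + w\<^sup>2"
proof -
  have "(p * cos \<theta> - q * sin \<theta>)\<^sup>2 + (p * sin \<theta> + q * cos \<theta>)\<^sup>2 = p\<^sup>2 + q\<^sup>2"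
    using sin_cos_squared_add[of \<theta>] by algebra
  then show ?thesis by (simp add: norm_vec3)
qed

text \<open>Fubini in the coordinates (w, p, q), followed by p = sqrt (1 - w^2) t, whose Jacobian is
  the factor sqrt (1 - w^2). Agreement of F with a Borel function almost everywhere descends to
  almost every slice and then to almost every chord.\<close>

lemma chord_integral:
  fixes F :: "real ^ 3 \<Rightarrow> real" and \<Psi> :: "real \<Rightarrow> real \<Rightarrow> real" and \<theta> :: real
  defines "d \<equiv> \<lambda>y :: real ^ 3. (y $ 1 * cos \<theta> + y $ 2 * sin \<theta>) / sqrt (1 - (y $ 3)\<^sup>2)"
  assumes F: "F \<in> borel_measurable lebesgue" and supp: "\<And>y. norm y > 1 \<Longrightarrow> F y = 0"
    and \<Psi> [measurable]: "(\<lambda>z. \<Psi> (fst z) (snd z)) \<in> borel_measurable (borel \<Otimes>\<^sub>M borel)"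
    and int: "integrable lebesgue (\<lambda>y. F y * \<Psi> (d y) (y $ 3))"
  shows "(LINT w:{-1<..<1}|lebesgue. (LINT t:{-1<..<1}|lebesgue.
       (LINT s|lebesgue. F (chord_line \<theta> t w s)) * \<Psi> t w) * sqrt (1 - w\<^sup>2)) =
     (LINT y|lebesgue. F y * \<Psi> (d y) (y $ 3))"
proof -
  obtain G0 where G0: "G0 \<in> borel_measurable lborel" "AE y in lborel. F y = G0 y"
    using completion_ex_borel_measurable_real[OF F] by auto
  \<comment> \<open>The cut-off makes the representative vanish outside the ball everywhere, not
    just almost everywhere, which is needed on individual chords.\<close>
  define G where "G y = indicator (cball 0 1) y * G0 y" for y
  have G [measurable]: "G \<in> borel_measurable borel"
    using G0 unfolding G_def[abs_def]
    by (intro borel_measurable_times borel_measurable_indicator) auto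
  have FG: "AE y in lborel. F y = G y"
    using G0(2) by eventually_elim (use supp in \<open>auto simp: G_def indicator_def not_le\<close>)
  have Gsupp: "G y = 0" if "(norm y)\<^sup>2 > 1" for y
  proof -
    have "norm y > 1" using that by (metis abs_norm_cancel abs_square_le_1 not_le)
    then show ?thesis by (simp add: G_def)
  qed
  have \<Psi>' [measurable]: "(\<lambda>x. \<Psi> (f x) (g x)) \<in> borel_measurable M"
    if "f \<in> borel_measurable M" "g \<in> borel_measurable M" for f g and M :: "'z measure"
    using measurable_compose[OF measurable_Pair[OF that] \<Psi>] by simp
  define c :: "real \<times> real \<times> real \<Rightarrow> real ^ 3" where
    "c = (\<lambda>(w, p, q). vector [p * cos \<theta> - q * sin \<theta>, p * sin \<theta> + q * cos \<theta>, w])"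
  have cm: "c \<in> lborel \<rightarrow>\<^sub>M borel"
    unfolding c_def split_def by (simp add: lborel_prod[symmetric] cong: measurable_cong_sets)
  then have cm' [measurable]: "c \<in> borel \<Otimes>\<^sub>M (borel \<Otimes>\<^sub>M borel) \<rightarrow>\<^sub>M borel"
    by (simp add: borel_prod)
  define H where "H y = G y * \<Psi> (d y) (y $ 3)" for y
  have dm [measurable]: "d \<in> borel_measurable borel"
    unfolding d_def by measurable
  have H [measurable]: "H \<in> borel_measurable borel"
    unfolding H_def by measurable
  have FH: "AE y in lborel. F y * \<Psi> (d y) (y $ 3) = H y"
    using FG by eventually_elim (simp add: H_def)
  have Hint: "integrable lborel H" and Heq: "(LINT y|lebesgue. F y * \<Psi> (d y) (y $ 3)) = (LINT y|lborel. H y)"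
    using lebesgue_integral_AE_borel[OF FH] int by auto
  have dist: "lborel = distr lborel borel c" unfolding c_def by (rule lborel_eq_distr_chord)
  have Hc: "integrable (lborel \<Otimes>\<^sub>M lborel) (\<lambda>z. H (c z))"
    using Hint cm unfolding lborel_prod by (subst (asm) dist) (simp add: integrable_distr_eq)
  have Hceq: "(LINT y|lborel. H y) = (LINT w|lborel. LINT z|lborel. H (c (w, z)))"
    unfolding lborel_pair.integral_fst'[OF Hc] lborel_prod
    using cm by (subst dist) (simp add: integral_distr)
  have cn: "(norm (c (w, p, q)))\<^sup>2 = p\<^sup>2 + q\<^sup>2 + w\<^sup>2" for w p q
    by (simp add: c_def norm_chord)
  \<comment> \<open>The argument of \<Psi> depends on w and p alone, so \<Psi> leaves the innermost
    integral.\<close>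
  have Hval: "H (c (w, p, q)) = G (c (w, p, q)) * \<Psi> (p / sqrt (1 - w\<^sup>2)) w" for w p q
  proof -
    have "(p * cos \<theta> - q * sin \<theta>) * cos \<theta> + (p * sin \<theta> + q * cos \<theta>) * sin \<theta> = p"
      using sin_cos_squared_add[of \<theta>] by algebra
    then show ?thesis by (simp add: H_def c_def d_def)
  qed
  have FGc: "AE w in lborel. AE z in lborel. F (c (w, z)) = G (c (w, z))"
  proof -
    have "AE y in distr lborel borel c. F y = G y" using FG unfolding dist[symmetric] .
    then have "AE z in lborel. F (c z) = G (c z)"
      by (rule AE_distrD[OF cm])
    then have "AE z in lborel \<Otimes>\<^sub>M lborel. F (c z) = G (c z)"
      unfolding lborel_prod .
    from lborel_pair.AE_pair[OF this] show ?thesis .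
  qed
  \<comment> \<open>The heights w = 1 and w = -1 are discarded as a null set; for |w| > 1 the slice
    misses the ball and both sides vanish.\<close>
  have main: "AE w in lborel. indicator {-1<..<1} w * ((LINT t:{-1<..<1}|lebesgue.
       (LINT s|lebesgue. F (chord_line \<theta> t w s)) * \<Psi> t w) * sqrt (1 - w\<^sup>2)) =
     (LINT z|lborel. H (c (w, z)))"
    using FGc lborel_pair.AE_integrable_fst'[OF Hc] AE_lborel_singleton[of 1] AE_lborel_singleton[of "-1"]
  proof eventually_elim
    case (elim w)
    show ?case
    proof (cases "\<bar>w\<bar> < 1")
      case False
      with elim have "w\<^sup>2 > 1"
        by (metis abs_square_le_1 abs_square_eq_1 linorder_less_linear not_le abs_eq_iff' abs_1)
      then have "1 < p\<^sup>2 + q\<^sup>2 + w\<^sup>2" for p q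
        using zero_le_power2[of p] zero_le_power2[of q] by linarith
      then have "H (c (w, p, q)) = 0" for p q
        unfolding Hval using Gsupp[of "c (w, p, q)"] by (simp add: cn)
      then have "H (c (w, z)) = 0" for z by (cases z) auto
      then show ?thesis using False by (auto simp: indicator_def)
    next
      case True
      define r where "r = sqrt (1 - w\<^sup>2)"
      have r: "r > 0" using True by (simp add: r_def abs_square_less_1)
      have r2: "r\<^sup>2 = 1 - w\<^sup>2" using True by (simp add: r_def abs_square_le_1)
      define J where "J p = (LINT q|lborel. G (c (w, p, q)))" for p
      have J [measurable]: "J \<in> borel_measurable borel" unfolding J_def by measurable
      have "integrable (lborel \<Otimes>\<^sub>M lborel) (\<lambda>z. H (c (w, z)))"
        using elim by (simp add: lborel_prod)
      then have "(LINT z|lborel. H (c (w, z))) = (LINT p|lborel. LINT q|lborel. H (c (w, p, q)))"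
        using lborel_pair.integral_fst'[of "\<lambda>z. H (c (w, z))"] by (simp add: lborel_prod)
      also have "\<dots> = (LINT p|lborel. J p * \<Psi> (p / r) w)"
        by (simp add: Hval J_def r_def)
      \<comment> \<open>The Jacobian \<open>r\<close> of p = r t is the factor sqrt (1 - w^2) of the
        outer integrand.\<close>
      also have "\<dots> = r * (LINT t|lborel. J (r * t) * \<Psi> t w)"
        using r by (subst lborel_integral_real_affine[where c = r and t = 0]) auto
      also have "(LINT t|lborel. J (r * t) * \<Psi> t w) = (LINT t|lebesgue. indicator {-1<..<1} t *
          ((LINT s|lebesgue. F (chord_line \<theta> t w s)) * \<Psi> t w))"
      proof (rule lebesgue_integral_AE_borel(2)[symmetric])
        have "AE p in lborel. AE q in lborel. F (c (w, p, q)) = G (c (w, p, q))"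
        proof -
          have "AE z in lborel \<Otimes>\<^sub>M lborel. F (c (w, z)) = G (c (w, z))"
            using elim(1) unfolding lborel_prod .
          from lborel_pair.AE_pair[OF this] show ?thesis .
        qed
        then have "AE p in lborel. (LINT q|lebesgue. F (c (w, p, q))) = J p"
        proof eventually_elim
          case (elim p)
          then show ?case unfolding J_def
            by (intro lebesgue_integral_AE_borel) auto
        qed
        from AE_lborel_scale[OF this, of r] r
        have "AE t in lborel. (LINT q|lebesgue. F (c (w, r * t, q))) = J (r * t)" by simp
        then show "AE t in lborel. indicator {-1<..<1} t *
          ((LINT s|lebesgue. F (chord_line \<theta> t w s)) * \<Psi> t w) = J (r * t) * \<Psi> t w"
          using AE_lborel_singleton[of 1] AE_lborel_singleton[of "-1"]
        proof eventually_elim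
          case (elim t)
          show ?case
          proof (cases "\<bar>t\<bar> < 1")
            case True
            then show ?thesis using elim(1) by (auto simp: chord_line_altdef c_def r_def indicator_def)
          next
            case False
            with elim have "t\<^sup>2 > 1"
              by (metis abs_square_le_1 abs_square_eq_1 linorder_less_linear not_le abs_eq_iff' abs_1)
            then have "(r * t)\<^sup>2 > r\<^sup>2" using r by (simp add: power_mult_distrib)
            then have "1 < (r * t)\<^sup>2 + q\<^sup>2 + w\<^sup>2" for q
              using r2 zero_le_power2[of q] by linarith
            then have "G (c (w, r * t, q)) = 0" for q
              by (intro Gsupp) (simp only: cn)
            then show ?thesis using False by (auto simp: J_def indicator_def)
          qed
        qed
      qed simp
      finally show ?thesis using True r
        by (auto simp: set_lebesgue_integral_def r_def mult.commute indicator_def)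
    qed
  qed
  have "(LINT w:{-1<..<1}|lebesgue. (LINT t:{-1<..<1}|lebesgue.
       (LINT s|lebesgue. F (chord_line \<theta> t w s)) * \<Psi> t w) * sqrt (1 - w\<^sup>2)) =
     (LINT w|lborel. LINT z|lborel. H (c (w, z)))"
    unfolding set_lebesgue_integral_def[of lebesgue "{-1<..<1}" "\<lambda>w. (LINT t:{-1<..<1}|lebesgue.
       (LINT s|lebesgue. F (chord_line \<theta> t w s)) * \<Psi> t w) * sqrt (1 - w\<^sup>2)"] real_scaleR_def
    by (rule lebesgue_integral_AE_borel(2)[OF main]) (use lborel_pair.integrable_fst'[OF Hc] in auto)
  then show ?thesis using Heq Hceq by simp
qed


section \<open>Radial integrals and moments on the unit disk\<close>

definition disk_measure :: "complex measure" where
  "disk_measure = density lborel (indicator (ball 0 1))"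

lemma measurable_indicator_ball: "(indicator (ball 0 1) :: complex \<Rightarrow> ennreal) \<in> borel_measurable borel"
  by (intro borel_measurable_indicator) simp

lemma sets_disk_measure [measurable_cong]: "sets disk_measure = sets borel"
  by (simp add: disk_measure_def)

text \<open>The annulus x < |z|^2 < 1 has area pi (1 - x), so tails agree and u = |z|^2 carries pi
  times Lebesgue measure. This takes the place of polar coordinates.\<close>

lemma distr_disk_measure:
  "distr disk_measure borel (\<lambda>z. (cmod z)\<^sup>2) = density lborel (\<lambda>u. ennreal pi * indicator {0..1} u)"
proof (rule measure_eqI_lessThan)
  fix x :: real
  have "emeasure (distr disk_measure borel (\<lambda>z. (cmod z)\<^sup>2)) {x<..} =
      emeasure lborel (ball 0 1 \<inter> {z. x < (cmod z)\<^sup>2})"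
  proof -
    have m: "{z :: complex. x < (cmod z)\<^sup>2} \<in> sets borel" by measurable
    have "emeasure (distr disk_measure borel (\<lambda>z. (cmod z)\<^sup>2)) {x<..} = emeasure disk_measure {z. x < (cmod z)\<^sup>2}"
      by (subst emeasure_distr) (auto simp: disk_measure_def intro!: arg_cong2[where f = emeasure])
    also have "\<dots> = (\<integral>\<^sup>+z. indicator (ball 0 1) z * indicator {z. x < (cmod z)\<^sup>2} z \<partial>lborel)"
      unfolding disk_measure_def using m by (intro emeasure_density) (auto simp: measurable_indicator_ball)
    also have "\<dots> = (\<integral>\<^sup>+z. indicator (ball 0 1 \<inter> {z. x < (cmod z)\<^sup>2}) z \<partial>lborel)"
      by (intro nn_integral_cong) (auto simp: indicator_def)
    also have "\<dots> = emeasure lborel (ball 0 1 \<inter> {z :: complex. x < (cmod z)\<^sup>2})"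
      using m by (intro nn_integral_indicator) auto
    finally show ?thesis .
  qed
  also have "\<dots> = ennreal (pi * measure lborel ({0..1} \<inter> {x<..}))"
  proof -
    consider "x < 0" | "0 \<le> x" "x < 1" | "x \<ge> 1" by linarith
    then show ?thesis
    proof cases
      case 1
      then have "ball 0 1 \<inter> {z :: complex. x < (cmod z)\<^sup>2} = ball 0 1" "{0..1} \<inter> {x<..} = {0..1}"
        by (auto intro: less_le_trans)
      then show ?thesis by (simp add: emeasure_ball unit_ball_vol_2)
    next
      case 2
      have q: "x < (cmod z)\<^sup>2 \<longleftrightarrow> sqrt x < cmod z" for z
        using real_sqrt_less_iff[of x "(cmod z)\<^sup>2"] by simp
      have e: "ball 0 1 \<inter> {z :: complex. x < (cmod z)\<^sup>2} = ball 0 1 - cball 0 (sqrt x)"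
        by (auto simp: q)
      have sx: "sqrt x < 1" using 2 by simp
      have s: "cball 0 (sqrt x) \<subseteq> (ball 0 1 :: complex set)"
        using le_less_trans[OF _ sx] by auto
      have "emeasure lborel (ball 0 1 - cball 0 (sqrt x) :: complex set) =
         emeasure lborel (ball 0 1 :: complex set) - emeasure lborel (cball 0 (sqrt x) :: complex set)"
        using 2 by (intro emeasure_Diff s) (auto simp: emeasure_cball)
      also have "\<dots> = ennreal (pi - pi * x)"
        using 2 by (simp add: emeasure_ball emeasure_cball unit_ball_vol_2 ennreal_minus)
      finally have "emeasure lborel (ball 0 1 - cball 0 (sqrt x) :: complex set) = ennreal (pi - pi * x)" .
      moreover have "{0..1} \<inter> {x<..} = {x<..1}" using 2 by auto
      ultimately show ?thesis using e 2 by (simp add: algebra_simps)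
    next
      case 3
      then have "ball 0 1 \<inter> {z :: complex. x < (cmod z)\<^sup>2} = {}" "{0..1} \<inter> {x<..} = {}"
        by (auto simp: abs_square_less_1[symmetric] dest: power_less_one_iff[THEN iffD2, rotated])
           (metis abs_norm_cancel abs_square_less_1 less_le_trans not_less_iff_gr_or_eq order_less_trans)
      then show ?thesis by simp
    qed
  qed
  finally have eq: "emeasure (distr disk_measure borel (\<lambda>z. (cmod z)\<^sup>2)) {x<..} =
      ennreal (pi * measure lborel ({0..1} \<inter> {x<..}))" .
  then show "emeasure (distr disk_measure borel (\<lambda>z. (cmod z)\<^sup>2)) {x<..} < \<infinity>" by simp
  have "emeasure (density lborel (\<lambda>u. ennreal pi * indicator {0..1} u)) {x<..} =
      (\<integral>\<^sup>+u. ennreal pi * indicator ({0..1} \<inter> {x<..}) u \<partial>lborel)"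
    by (subst emeasure_density) (auto simp: indicator_inter_arith mult.assoc)
  also have "\<dots> = ennreal pi * emeasure lborel ({0..1} \<inter> {x<..})"
    by (subst nn_integral_cmult) auto
  also have "emeasure lborel ({0..1} \<inter> {x<..}) = ennreal (measure lborel ({0..1} \<inter> {x<..}))"
  proof -
    have "emeasure lborel ({0..1} \<inter> {x<..}) \<le> emeasure lborel {0..1::real}"
      by (rule emeasure_mono) auto
    then have "emeasure lborel ({0..1} \<inter> {x<..}) < \<infinity>"
      by (rule le_less_trans) simp
    then show ?thesis by (intro emeasure_eq_ennreal_measure) auto
  qed
  finally show "emeasure (distr disk_measure borel (\<lambda>z. (cmod z)\<^sup>2)) {x<..} =
      emeasure (density lborel (\<lambda>u. ennreal pi * indicator {0..1} u)) {x<..}"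
    unfolding eq by (simp add: ennreal_mult)
qed simp_all

lemma disk_measure_radial:
  fixes G :: "real \<Rightarrow> real"
  assumes G [measurable]: "G \<in> borel_measurable borel"
  shows "integrable disk_measure (\<lambda>z. G ((cmod z)\<^sup>2)) \<longleftrightarrow> set_integrable lborel {0..1} G"
    and "(LINT z|disk_measure. G ((cmod z)\<^sup>2)) = pi * (LINT u:{0..1}|lborel. G u)"
proof -
  have d: "density lborel (\<lambda>u. ennreal pi * indicator {0..1} u) =
      density lborel (\<lambda>u. ennreal (pi * indicator {0..1} (u::real)))"
    by (intro density_cong) (auto simp: indicator_def)
  have "integrable disk_measure (\<lambda>z. G ((cmod z)\<^sup>2)) \<longleftrightarrow>
      integrable (distr disk_measure borel (\<lambda>z. (cmod z)\<^sup>2)) G"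
    by (subst integrable_distr_eq) auto
  also have "\<dots> \<longleftrightarrow> integrable lborel (\<lambda>u. pi * (indicator {0..1} u * G u))"
    unfolding distr_disk_measure d by (subst integrable_density) (auto simp: mult.assoc)
  finally show "integrable disk_measure (\<lambda>z. G ((cmod z)\<^sup>2)) \<longleftrightarrow> set_integrable lborel {0..1} G"
    by (simp add: set_integrable_def)
  have "(LINT z|disk_measure. G ((cmod z)\<^sup>2)) =
      integral\<^sup>L (distr disk_measure borel (\<lambda>z. (cmod z)\<^sup>2)) G"
    by (subst integral_distr) auto
  also have "\<dots> = (LINT u|lborel. pi * (indicator {0..1} u * G u))"
    unfolding distr_disk_measure d by (subst integral_density) (auto simp: mult.assoc)
  finally show "(LINT z|disk_measure. G ((cmod z)\<^sup>2)) = pi * (LINT u:{0..1}|lborel. G u)"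
    by (simp add: set_lebesgue_integral_def)
qed

lemma distr_rotate_disk_measure:
  assumes "cmod v = 1"
  shows "distr disk_measure borel (\<lambda>z. v * z) = disk_measure"
proof -
  have "disk_measure = density (distr lborel borel (\<lambda>z. v * z)) (indicator (ball 0 1))"
    unfolding disk_measure_def distr_rotate_complex[OF assms] ..
  also have "\<dots> = distr (density lborel (\<lambda>z. indicator (ball 0 1) (v * z))) borel (\<lambda>z. v * z)"
    by (rule density_distr) (auto simp: measurable_indicator_ball)
  also have "(\<lambda>z. indicator (ball 0 1) (v * z)) = (indicator (ball 0 1) :: complex \<Rightarrow> ennreal)"
    using assms by (auto simp: indicator_def norm_mult fun_eq_iff)
  finally show ?thesis unfolding disk_measure_def[symmetric] by (rule sym)
qed

lemma integrable_disk_moment: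
  fixes G :: "real \<Rightarrow> real"
  assumes G [measurable]: "G \<in> borel_measurable borel" and int: "set_integrable lborel {0..1} G"
    and f [measurable]: "f \<in> borel_measurable borel" and bd: "\<And>z. cmod z < 1 \<Longrightarrow> cmod (f z) \<le> 1"
  shows "integrable disk_measure (\<lambda>z. f z * complex_of_real (G ((cmod z)\<^sup>2)))"
proof (rule Bochner_Integration.integrable_bound)
  show "integrable disk_measure (\<lambda>z. G ((cmod z)\<^sup>2))"
    using disk_measure_radial(1)[OF G] int by simp
  have "AE z in disk_measure. cmod z < 1"
    unfolding disk_measure_def
    by (subst AE_density) (auto simp: measurable_indicator_ball indicator_def)
  then show "AE z in disk_measure. norm (f z * complex_of_real (G ((cmod z)\<^sup>2))) \<le> norm (G ((cmod z)\<^sup>2))"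
    by eventually_elim (use bd in \<open>auto simp: norm_mult intro!: mult_left_le_one_le\<close>)
qed simp

lemma measurable_cnj_Re [measurable]:
  "cnj \<in> borel_measurable borel" "Re \<in> borel_measurable borel"
  by (intro borel_measurable_continuous_onI continuous_intros)+

text \<open>The rotation by the angle pi / (p - q) preserves the measure and multiplies the
  integrand by -1.\<close>

lemma disk_moment_mixed:
  fixes G :: "real \<Rightarrow> real"
  assumes G [measurable]: "G \<in> borel_measurable borel" and "p \<noteq> q"
  shows "(LINT z|disk_measure. z ^ p * cnj z ^ q * complex_of_real (G ((cmod z)\<^sup>2))) = 0" (is "?I = 0")
proof -
  define v where "v = cis (pi / (real p - real q))"
  have v: "cmod v = 1" by (simp add: v_def)
  have vv: "v ^ p * cnj v ^ q = -1"
  proof -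
    have "v ^ p * cnj v ^ q = cis (real p * (pi / (real p - real q)) + real q * (- (pi / (real p - real q))))"
      unfolding v_def cis_cnj Complex.DeMoivre cis_mult by simp
    also have "real p * (pi / (real p - real q)) + real q * (- (pi / (real p - real q))) =
        (real p - real q) * (pi / (real p - real q))"
      by (simp add: left_diff_distrib diff_divide_distrib)
    also have "\<dots> = pi" using assms(2) by simp
    finally show ?thesis by simp
  qed
  have "?I = (LINT z|distr disk_measure borel (\<lambda>z. v * z). z ^ p * cnj z ^ q * complex_of_real (G ((cmod z)\<^sup>2)))"
    by (simp add: distr_rotate_disk_measure[OF v])
  also have "\<dots> = (LINT z|disk_measure. (v ^ p * cnj v ^ q) * (z ^ p * cnj z ^ q * complex_of_real (G ((cmod z)\<^sup>2))))"
    by (subst integral_distr) (auto simp: norm_mult v power_mult_distrib mult_ac)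
  also have "\<dots> = - ?I" by (simp add: vv)
  finally show ?thesis by simp
qed

lemma power_mult_cnj_power: "z ^ k * cnj z ^ k = complex_of_real (((cmod z)\<^sup>2) ^ k)"
  by (subst of_real_power, subst complex_norm_square) (rule power_mult_distrib[symmetric])

text \<open>Write Re z = (z + cnj z) / 2 and expand. A term survives only if z and
  \<open>cnj z\<close> carry the same exponent m; then 2 m = n + j, and the term is the m-th moment
  of G in u = |z|^2.\<close>

lemma disk_moment_zero:
  fixes G :: "real \<Rightarrow> real"
  assumes G [measurable]: "G \<in> borel_measurable borel" and int: "set_integrable lborel {0..1} G"
    and z: "\<And>m. 2 * m = n + j \<Longrightarrow> j \<le> m \<Longrightarrow> (LINT u:{0..1}|lborel. u ^ m * G u) = 0"
  shows "(LINT z|disk_measure. Re z ^ n * Re (c * z ^ j) * G ((cmod z)\<^sup>2)) = 0"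
proof -
  let ?g = "\<lambda>z. complex_of_real (G ((cmod z)\<^sup>2))"
  have int': "integrable disk_measure (\<lambda>z. z ^ p * cnj z ^ q * ?g z)" for p q
    by (rule integrable_disk_moment[OF G int])
       (auto simp: norm_mult norm_power intro!: mult_le_one power_le_one)
  have term0: "(LINT z|disk_measure. z ^ (a + j) * cnj z ^ (n - a) * ?g z) = 0" if "a \<le> n" for a
  proof (cases "a + j = n - a")
    case False
    then show ?thesis by (rule disk_moment_mixed[OF G])
  next
    case True
    have "(LINT z|disk_measure. z ^ (a + j) * cnj z ^ (n - a) * ?g z) =
        (LINT z|disk_measure. complex_of_real (((cmod z)\<^sup>2) ^ (n - a) * G ((cmod z)\<^sup>2)))"
      unfolding True power_mult_cnj_power by simp
    also have "\<dots> = complex_of_real (pi * (LINT u:{0..1}|lborel. u ^ (n - a) * G u))"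
      unfolding integral_complex_of_real
      by (subst disk_measure_radial(2)[of "\<lambda>u. u ^ (n - a) * G u"]) auto
    also have "(LINT u:{0..1}|lborel. u ^ (n - a) * G u) = 0"
      using True that by (intro z) auto
    finally show ?thesis by simp
  qed
  have exp: "complex_of_real (Re z) ^ n * z ^ j * ?g z =
    (\<Sum>a\<le>n. (of_nat (n choose a) / 2 ^ n) * (z ^ (a + j) * cnj z ^ (n - a) * ?g z))" for z
  proof -
    have "complex_of_real (Re z) = (z + cnj z) / 2" by (simp add: complex_add_cnj)
    then have "complex_of_real (Re z) ^ n = (z + cnj z) ^ n / 2 ^ n"
      by (simp only: power_divide)
    also have "\<dots> = (\<Sum>a\<le>n. of_nat (n choose a) * z ^ a * cnj z ^ (n - a)) / 2 ^ n"
      by (simp only: binomial_ring)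
    finally have "complex_of_real (Re z) ^ n = (\<Sum>a\<le>n. of_nat (n choose a) * z ^ a * cnj z ^ (n - a)) / 2 ^ n" .
    then show ?thesis
      by (simp add: sum_distrib_right sum_distrib_left sum_divide_distrib power_add mult_ac)
  qed
  have "(LINT z|disk_measure. complex_of_real (Re z) ^ n * z ^ j * ?g z) =
      (\<Sum>a\<le>n. (of_nat (n choose a) / 2 ^ n) * (LINT z|disk_measure. z ^ (a + j) * cnj z ^ (n - a) * ?g z))"
    unfolding exp by (subst Bochner_Integration.integral_sum) (auto intro!: int')
  also have "\<dots> = 0" by (intro sum.neutral) (auto simp: term0)
  finally have E: "(LINT z|disk_measure. complex_of_real (Re z) ^ n * z ^ j * ?g z) = 0" .
  have intE: "integrable disk_measure (\<lambda>z. c * (complex_of_real (Re z) ^ n * z ^ j * ?g z))"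
    unfolding exp by (intro integrable_mult_right Bochner_Integration.integrable_sum int')
  have "(LINT z|disk_measure. Re z ^ n * Re (c * z ^ j) * G ((cmod z)\<^sup>2)) =
      (LINT z|disk_measure. Re (c * (complex_of_real (Re z) ^ n * z ^ j * ?g z)))"
  proof (intro Bochner_Integration.integral_cong refl)
    fix z
    have "c * (complex_of_real (Re z) ^ n * z ^ j * ?g z) =
        complex_of_real (Re z ^ n * G ((cmod z)\<^sup>2)) * (c * z ^ j)" by simp
    then show "Re z ^ n * Re (c * z ^ j) * G ((cmod z)\<^sup>2) = Re (c * (complex_of_real (Re z) ^ n * z ^ j * ?g z))"
      by (simp only: scaleR_conv_of_real[symmetric] scaleR_complex.simps) simp
  qed
  also have "\<dots> = Re (LINT z|disk_measure. c * (complex_of_real (Re z) ^ n * z ^ j * ?g z))"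
    using integral_Re[OF intE] .
  also have "\<dots> = 0" by (simp add: E)
  finally show ?thesis .
qed

lemma disk_integral_iterated:
  fixes h :: "complex \<Rightarrow> real"
  assumes int: "integrable disk_measure h" and [measurable]: "h \<in> borel_measurable borel"
  shows "(LINT z|disk_measure. h z) = (LINT t|lborel. LINT s|lborel. indicator (ball 0 1) (Complex t s) * h (Complex t s))"
proof -
  have d: "disk_measure = density lborel (\<lambda>z. ennreal (indicator (ball 0 1) z))"
    unfolding disk_measure_def by (simp add: ennreal_indicator)
  have [measurable]: "indicat_real (ball (0 :: complex) 1) \<in> borel_measurable borel"
    by (intro borel_measurable_indicator) simp
  note m = measurable_Complex_pair
  have "integrable lborel (\<lambda>z. indicator (ball 0 1) z * h z)"
    using int unfolding d by (subst (asm) integrable_density) auto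
  then have i: "integrable (lborel \<Otimes>\<^sub>M lborel) (\<lambda>z. indicator (ball 0 1) (Complex (fst z) (snd z)) * h (Complex (fst z) (snd z)))"
    using m unfolding lborel_prod by (subst (asm) lborel_eq_distr_complex) (simp add: integrable_distr_eq split_def)
  have "(LINT z|disk_measure. h z) = (LINT z|lborel. indicator (ball 0 1) z * h z)"
    unfolding d by (subst integral_density) auto
  also have "\<dots> = (LINT z|(lborel \<Otimes>\<^sub>M lborel). indicator (ball 0 1) (Complex (fst z) (snd z)) * h (Complex (fst z) (snd z)))"
    using m unfolding lborel_prod by (subst lborel_eq_distr_complex) (simp add: integral_distr split_def)
  also have "\<dots> = (LINT t|lborel. LINT s|lborel. indicator (ball 0 1) (Complex t s) * h (Complex t s))"
    using lborel_pair.integral_fst'[OF i] by simp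
  finally show ?thesis .
qed

section \<open>Chord integrals of disk polynomials\<close>

lemma jint_lborel:
  "jint \<alpha> \<beta> p = (LINT t|lborel. indicator {-1..1} t * (poly p t * jacobi_weight \<alpha> \<beta> t))"
  unfolding jint_def set_lebesgue_integral_def
  by (subst integral_completion[symmetric]) (auto simp: jacobi_weight_def)

lemma integrable_jint_lborel:
  assumes "\<alpha> > -1" "\<beta> > -1"
  shows "integrable lborel (\<lambda>t. indicator {-1..1} t * (poly p t * jacobi_weight \<alpha> \<beta> t))"
  using integrable_poly_jacobi_weight[OF assms, of p] unfolding set_integrable_def
  by (subst integrable_completion[symmetric]) (auto simp: jacobi_weight_def)

lemma jint_unit_interval:
  assumes "\<alpha> > -1"
  shows "set_integrable lborel {0..1} (\<lambda>u. poly r (2 * u - 1) * u ^ j * (1 - u) powr \<alpha>)"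
    and "(LINT u:{0..1}|lborel. poly r (2 * u - 1) * u ^ j * (1 - u) powr \<alpha>) =
      jint \<alpha> (real j) r / 2 powr (\<alpha> + real j + 1)"
proof -
  define h where "h t = indicator {-1..1} t * (poly r t * jacobi_weight \<alpha> (real j) t)" for t
  have [measurable]: "h \<in> borel_measurable borel"
    unfolding h_def jacobi_weight_def by measurable
  have h: "integrable lborel h"
    unfolding h_def using assms by (intro integrable_jint_lborel) auto
  have eq: "AE u in lborel. h (-1 + 2 * u) = 2 powr (\<alpha> + real j) *
      (indicator {0..1} u *\<^sub>R (poly r (2 * u - 1) * u ^ j * (1 - u) powr \<alpha>))"
    \<comment> \<open>At u = 0 and j = 0 the sides may differ, since \<open>0 powr 0 = 0\<close>
      while u ^ 0 = 1.\<close>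
    using AE_lborel_singleton[of 0]
  proof eventually_elim
    case (elim u)
    show ?case
    proof (cases "u \<in> {0..1}")
      case True
      have "(2 - 2 * u) powr \<alpha> = 2 powr \<alpha> * (1 - u) powr \<alpha>"
        using True by (subst powr_mult[symmetric]) (auto simp: algebra_simps)
      moreover have "(2 * u) powr real j = 2 powr real j * u ^ j"
        using True elim by (simp add: powr_mult powr_realpow)
      ultimately show ?thesis
        using True by (simp add: h_def jacobi_weight_def powr_add)
    qed (auto simp: h_def indicator_def)
  qed
  have "integrable lborel (\<lambda>u. h (-1 + 2 * u))"
    using h by (subst lborel_integrable_real_affine_iff) auto
  then have "integrable lborel (\<lambda>u. 2 powr (\<alpha> + real j) *
      (indicator {0..1} u *\<^sub>R (poly r (2 * u - 1) * u ^ j * (1 - u) powr \<alpha>)))"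
    by (subst integrable_cong_AE[symmetric, OF _ _ eq]) auto
  then show "set_integrable lborel {0..1} (\<lambda>u. poly r (2 * u - 1) * u ^ j * (1 - u) powr \<alpha>)"
    by (simp add: set_integrable_def)
  have "jint \<alpha> (real j) r = (LINT t|lborel. h t)"
    unfolding h_def by (rule jint_lborel)
  also have "\<dots> = 2 * (LINT u|lborel. h (-1 + 2 * u))"
    by (subst lborel_integral_real_affine[where c = 2 and t = "-1"]) auto
  also have "(LINT u|lborel. h (-1 + 2 * u)) = (LINT u|lborel. 2 powr (\<alpha> + real j) *
      (indicator {0..1} u *\<^sub>R (poly r (2 * u - 1) * u ^ j * (1 - u) powr \<alpha>)))"
    by (rule integral_cong_AE[OF _ _ eq]) auto
  finally show "(LINT u:{0..1}|lborel. poly r (2 * u - 1) * u ^ j * (1 - u) powr \<alpha>) =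
      jint \<alpha> (real j) r / 2 powr (\<alpha> + real j + 1)"
    by (simp add: set_lebesgue_integral_def powr_add)
qed

definition slice_fun :: "real \<Rightarrow> (real \<Rightarrow> real \<Rightarrow> real) \<Rightarrow> real \<Rightarrow> real \<Rightarrow> real" where
  "slice_fun \<mu> B t s = indicator (ball 0 1) (Complex t s) * (B t s * (1 - t\<^sup>2 - s\<^sup>2) powr (\<mu> - 1/2))"

lemma Complex_in_ball: "Complex t s \<in> ball 0 1 \<longleftrightarrow> t\<^sup>2 + s\<^sup>2 < 1"
  by (simp add: cmod_def real_sqrt_lt_1_iff)

text \<open>The integrals of B over the chords x = t of the disk are (1 - t^2)^\<mu> times a
  polynomial of degree at most d. As t tends to 1 the chord shrinks to the point (1, 0), which
  explains the value of \<open>A\<close> at 1. Recorded as an algebraic condition, that value passes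
  to linear combinations and no limit has to be taken.\<close>

definition slice_poly :: "real \<Rightarrow> nat \<Rightarrow> (real \<Rightarrow> real \<Rightarrow> real) \<Rightarrow> bool" where
  "slice_poly \<mu> d B \<longleftrightarrow> (\<exists>A. degree A \<le> d \<and> poly A 1 = jint (\<mu> - 1/2) (\<mu> - 1/2) 1 * B 1 0 \<and>
     (\<forall>t. \<bar>t\<bar> < 1 \<longrightarrow> integrable lborel (slice_fun \<mu> B t) \<and>
        (LINT s|lborel. slice_fun \<mu> B t s) = (1 - t\<^sup>2) powr \<mu> * poly A t))"

lemma slice_poly_mono: "slice_poly \<mu> d B \<Longrightarrow> d \<le> e \<Longrightarrow> slice_poly \<mu> e B"
  unfolding slice_poly_def by (meson order_trans)

lemma slice_poly_add:
  assumes "slice_poly \<mu> d B" "slice_poly \<mu> d B'"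
  shows "slice_poly \<mu> d (\<lambda>t s. B t s + B' t s)"
proof -
  from assms obtain A A' where A: "degree A \<le> d" "poly A 1 = jint (\<mu> - 1/2) (\<mu> - 1/2) 1 * B 1 0"
    "\<And>t. \<bar>t\<bar> < 1 \<Longrightarrow> integrable lborel (slice_fun \<mu> B t) \<and>
        (LINT s|lborel. slice_fun \<mu> B t s) = (1 - t\<^sup>2) powr \<mu> * poly A t"
    and A': "degree A' \<le> d" "poly A' 1 = jint (\<mu> - 1/2) (\<mu> - 1/2) 1 * B' 1 0"
    "\<And>t. \<bar>t\<bar> < 1 \<Longrightarrow> integrable lborel (slice_fun \<mu> B' t) \<and>
        (LINT s|lborel. slice_fun \<mu> B' t s) = (1 - t\<^sup>2) powr \<mu> * poly A' t"
    unfolding slice_poly_def by blast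
  have e: "slice_fun \<mu> (\<lambda>t s. B t s + B' t s) t = (\<lambda>s. slice_fun \<mu> B t s + slice_fun \<mu> B' t s)" for t
    by (auto simp: slice_fun_def algebra_simps)
  show ?thesis
    unfolding slice_poly_def e
    using A A' by (intro exI[of _ "A + A'"]) (auto intro: degree_add_le simp: algebra_simps)
qed

lemma slice_poly_scale:
  assumes "slice_poly \<mu> d B"
  shows "slice_poly \<mu> d (\<lambda>t s. c * B t s)"
proof -
  from assms obtain A where A: "degree A \<le> d" "poly A 1 = jint (\<mu> - 1/2) (\<mu> - 1/2) 1 * B 1 0"
    "\<And>t. \<bar>t\<bar> < 1 \<Longrightarrow> integrable lborel (slice_fun \<mu> B t) \<and>
        (LINT s|lborel. slice_fun \<mu> B t s) = (1 - t\<^sup>2) powr \<mu> * poly A t"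
    unfolding slice_poly_def by blast
  have e: "slice_fun \<mu> (\<lambda>t s. c * B t s) t = (\<lambda>s. c * slice_fun \<mu> B t s)" for t
    by (auto simp: slice_fun_def algebra_simps)
  show ?thesis
    unfolding slice_poly_def e
    using A by (intro exI[of _ "smult c A"]) (auto intro: order_trans[OF degree_smult_le])
qed

lemma slice_poly_zero: "slice_poly \<mu> d (\<lambda>t s. 0)"
proof -
  have e: "slice_fun \<mu> (\<lambda>t s. 0) t = (\<lambda>s. 0)" for t
    by (simp add: slice_fun_def fun_eq_iff)
  show ?thesis unfolding slice_poly_def e by (intro exI[of _ 0]) auto
qed

lemma slice_poly_sum:
  assumes "\<And>i. i \<in> I \<Longrightarrow> slice_poly \<mu> d (B i)"
  shows "slice_poly \<mu> d (\<lambda>t s. \<Sum>i\<in>I. B i t s)"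
  using assms
proof (induction I rule: infinite_finite_induct)
  case (insert x F)
  then show ?case by (simp add: slice_poly_add)
qed (simp_all add: slice_poly_zero)

text \<open>Replacing s by sqrt (1 - t^2) s factors the weight, and the Jacobian raises the exponent
  of 1 - t^2 from \<mu> - 1/2 to \<mu>. The remaining sqrt (1 - t^2)^b is a polynomial for even b;
  for odd b the integral in s vanishes by symmetry.\<close>

lemma slice_poly_monomial:
  assumes \<mu>: "\<mu> \<ge> 0"
  shows "slice_poly \<mu> (a + b) (\<lambda>t s. t ^ a * s ^ b)"
proof -
  let ?\<alpha> = "\<mu> - 1/2"
  define g where "g s = indicator {-1..1} s * (s ^ b * jacobi_weight ?\<alpha> ?\<alpha> s)" for s
  have gint: "integrable lborel g" and gval: "(LINT s|lborel. g s) = jint ?\<alpha> ?\<alpha> (monom 1 b)"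
    using integrable_jint_lborel[of ?\<alpha> ?\<alpha> "monom 1 b"] jint_lborel[of ?\<alpha> ?\<alpha> "monom 1 b"] \<mu>
    by (simp_all add: g_def[abs_def] poly_monom)
  have sub: "slice_fun \<mu> (\<lambda>t s. t ^ a * s ^ b) t (0 + sqrt (1 - t\<^sup>2) * s) =
      t ^ a * sqrt (1 - t\<^sup>2) ^ b * (1 - t\<^sup>2) powr ?\<alpha> * g s" if t: "\<bar>t\<bar> < 1" and s: "s \<noteq> 1" "s \<noteq> -1" for t s
  proof -
    have r: "1 - t\<^sup>2 > 0" using t by (simp add: abs_square_less_1)
    have *: "1 - t\<^sup>2 - (sqrt (1 - t\<^sup>2) * s)\<^sup>2 = (1 - t\<^sup>2) * (1 - s\<^sup>2)"
      using r by (simp add: power_mult_distrib algebra_simps)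
    have "Complex t (sqrt (1 - t\<^sup>2) * s) \<in> ball 0 1 \<longleftrightarrow> 0 < (1 - t\<^sup>2) * (1 - s\<^sup>2)"
      unfolding Complex_in_ball *[symmetric] by linarith
    also have "\<dots> \<longleftrightarrow> 0 < 1 - s\<^sup>2"
      using r zero_less_mult_iff[of "1 - t\<^sup>2" "1 - s\<^sup>2"] by linarith
    also have "\<dots> \<longleftrightarrow> \<bar>s\<bar> < 1" by (simp add: abs_square_less_1)
    also have "\<dots> \<longleftrightarrow> s \<in> {-1..1}" using s by auto
    finally have ind: "indicat_real (ball 0 1) (Complex t (sqrt (1 - t\<^sup>2) * s)) = indicator {-1..1} s"
      by (simp add: indicator_def)
    show ?thesis
    proof (cases "s \<in> {-1..1}")
      case True
      then have "1 - s\<^sup>2 \<ge> 0" by (simp add: abs_square_le_1 abs_le_iff)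
      then have "((1 - t\<^sup>2) * (1 - s\<^sup>2)) powr ?\<alpha> = (1 - t\<^sup>2) powr ?\<alpha> * jacobi_weight ?\<alpha> ?\<alpha> s"
        using r gegenbauer_weight_eq[OF True, of ?\<alpha>] by (simp add: powr_mult)
      then show ?thesis
        unfolding slice_fun_def add_0 ind * g_def by (simp add: power_mult_distrib)
    qed (simp add: slice_fun_def ind g_def)
  qed
  have V: "integrable lborel (slice_fun \<mu> (\<lambda>t s. t ^ a * s ^ b) t) \<and>
      (LINT s|lborel. slice_fun \<mu> (\<lambda>t s. t ^ a * s ^ b) t s) =
        (1 - t\<^sup>2) powr \<mu> * (t ^ a * sqrt (1 - t\<^sup>2) ^ b * jint ?\<alpha> ?\<alpha> (monom 1 b))" if t: "\<bar>t\<bar> < 1" for t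
  proof -
    define r where "r = sqrt (1 - t\<^sup>2)"
    have r: "r > 0" using t by (simp add: r_def abs_square_less_1)
    have pos: "1 - t\<^sup>2 > 0" using t by (simp add: abs_square_less_1)
    have [measurable]: "slice_fun \<mu> (\<lambda>t s. t ^ a * s ^ b) t \<in> borel_measurable borel"
      unfolding slice_fun_def indicator_def Complex_in_ball by measurable
    have [measurable]: "g \<in> borel_measurable borel" using gint by auto
    have ae: "AE s in lborel. slice_fun \<mu> (\<lambda>t s. t ^ a * s ^ b) t (0 + r * s) =
      t ^ a * r ^ b * (1 - t\<^sup>2) powr ?\<alpha> * g s"
      using AE_lborel_singleton[of 1] AE_lborel_singleton[of "-1"]
      by eventually_elim (use sub[OF t] in \<open>simp add: r_def\<close>)
    have "integrable lborel (\<lambda>s. slice_fun \<mu> (\<lambda>t s. t ^ a * s ^ b) t (0 + r * s))"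
      by (subst integrable_cong_AE[OF _ _ ae]) (use gint in auto)
    then have I: "integrable lborel (slice_fun \<mu> (\<lambda>t s. t ^ a * s ^ b) t)"
      using r by (subst (asm) lborel_integrable_real_affine_iff) auto
    have "(LINT s|lborel. slice_fun \<mu> (\<lambda>t s. t ^ a * s ^ b) t s) =
        r * (LINT s|lborel. slice_fun \<mu> (\<lambda>t s. t ^ a * s ^ b) t (0 + r * s))"
      using r by (subst lborel_integral_real_affine[where c = r and t = 0]) auto
    also have "(LINT s|lborel. slice_fun \<mu> (\<lambda>t s. t ^ a * s ^ b) t (0 + r * s)) =
        t ^ a * r ^ b * (1 - t\<^sup>2) powr ?\<alpha> * jint ?\<alpha> ?\<alpha> (monom 1 b)"
      by (subst integral_cong_AE[OF _ _ ae]) (auto simp: gval)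
    also have "r * (t ^ a * r ^ b * (1 - t\<^sup>2) powr ?\<alpha> * jint ?\<alpha> ?\<alpha> (monom 1 b)) =
        (r * (1 - t\<^sup>2) powr ?\<alpha>) * (t ^ a * r ^ b * jint ?\<alpha> ?\<alpha> (monom 1 b))" by simp
    also have "r * (1 - t\<^sup>2) powr ?\<alpha> = (1 - t\<^sup>2) powr \<mu>"
      using pos unfolding r_def by (simp add: powr_half_sqrt[symmetric] powr_add[symmetric])
    finally show ?thesis using I by (simp add: r_def)
  qed
  show ?thesis
  proof (cases "even b")
    case True
    then obtain e where e: "b = 2 * e" by (rule evenE)
    let ?A = "smult (jint ?\<alpha> ?\<alpha> (monom 1 b)) (monom 1 a * [:1, 0, -1:] ^ e)"
    have "degree ([:1, 0, -1:] ^ e :: real poly) \<le> 2 * e"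
      by (rule order_trans[OF degree_power_le]) auto
    then have "degree ?A \<le> a + b"
      by (intro order_trans[OF degree_smult_le] order_trans[OF degree_mult_le]) (auto simp: e degree_monom_eq)
    \<comment> \<open>For b > 0 both sides are 0; for b = 0 the moment is the full weight
      integral.\<close>
    moreover have "poly ?A 1 = jint ?\<alpha> ?\<alpha> 1 * (1 ^ a * 0 ^ b)"
      by (cases e) (auto simp: e poly_monom one_pCons monom_0)
    moreover have "poly ?A t = t ^ a * sqrt (1 - t\<^sup>2) ^ b * jint ?\<alpha> ?\<alpha> (monom 1 b)" if "\<bar>t\<bar> < 1" for t
    proof -
      have "1 - t\<^sup>2 > 0" using that by (simp add: abs_square_less_1)
      then have "sqrt (1 - t\<^sup>2) ^ b = (1 - t\<^sup>2) ^ e" by (simp add: e power_mult)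
      then show ?thesis by (simp add: poly_monom power2_eq_square)
    qed
    ultimately show ?thesis unfolding slice_poly_def using V
      by (intro exI[of _ ?A] conjI allI impI) (simp_all only: simp_thms)
  next
    case False
    have "pcompose (monom 1 b) [:0, -1:] = - monom (1::real) b"
      using False by (simp add: poly_eq_poly_eq_iff[symmetric] fun_eq_iff poly_pcompose poly_monom)
    then have "jint ?\<alpha> ?\<alpha> (- monom 1 b) = jint ?\<alpha> ?\<alpha> (monom 1 b)"
      using jint_reflect[of ?\<alpha> "monom 1 b"] by simp
    then have "jint ?\<alpha> ?\<alpha> (monom 1 b) = 0"
      using jint_smult[of ?\<alpha> ?\<alpha> "-1" "monom 1 b"] by simp
    moreover have "b > 0" using False by (cases b) auto
    ultimately show ?thesis unfolding slice_poly_def using V by (intro exI[of _ 0]) auto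
  qed
qed

text \<open>With z = t + i s, Re (c z^(j+1)) = t Re (c z^j) + s Re (c i z^j). Each factor z is thus
  traded for a coordinate, so c, a and b vary in the induction.\<close>

lemma slice_poly_harmonic:
  assumes \<mu>: "\<mu> \<ge> 0"
  shows "slice_poly \<mu> (j + 2 * m + a + b)
    (\<lambda>t s. Re (c * Complex t s ^ j) * (t\<^sup>2 + s\<^sup>2) ^ m * (t ^ a * s ^ b))"
proof (induction j arbitrary: c a b)
  case 0
  show ?case
  proof (induction m arbitrary: a b)
    case 0
    then show ?case using slice_poly_scale[OF slice_poly_monomial[OF \<mu>, of a b], of "Re c"] by simp
  next
    case (Suc m)
    have "slice_poly \<mu> (0 + 2 * Suc m + a + b) (\<lambda>t s.
       Re (c * Complex t s ^ 0) * (t\<^sup>2 + s\<^sup>2) ^ m * (t ^ (a + 2) * s ^ b) +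
       Re (c * Complex t s ^ 0) * (t\<^sup>2 + s\<^sup>2) ^ m * (t ^ a * s ^ (b + 2)))"
      by (intro slice_poly_add slice_poly_mono[OF Suc]) auto
    then show ?case by (rule back_subst) (auto simp: fun_eq_iff algebra_simps power2_eq_square)
  qed
next
  case (Suc j)
  have "slice_poly \<mu> (Suc j + 2 * m + a + b) (\<lambda>t s.
     Re (c * Complex t s ^ j) * (t\<^sup>2 + s\<^sup>2) ^ m * (t ^ (a + 1) * s ^ b) +
     Re ((c * \<i>) * Complex t s ^ j) * (t\<^sup>2 + s\<^sup>2) ^ m * (t ^ a * s ^ (b + 1)))"
    by (intro slice_poly_add slice_poly_mono[OF Suc]) auto
  moreover have "Re (c * Complex t s ^ Suc j) = t * Re (c * Complex t s ^ j) + s * Re ((c * \<i>) * Complex t s ^ j)" for t s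
    by (simp add: algebra_simps)
  ultimately show ?case by (elim back_subst) (auto simp: fun_eq_iff algebra_simps)
qed

lemma slice_poly_basis:
  assumes "\<mu> \<ge> 0"
  shows "slice_poly \<mu> (j + 2 * degree q) (\<lambda>t s. Re (c * Complex t s ^ j) * poly q (t\<^sup>2 + s\<^sup>2))"
proof -
  have "slice_poly \<mu> (j + 2 * degree q) (\<lambda>t s. \<Sum>m\<le>degree q. coeff q m *
      (Re (c * Complex t s ^ j) * (t\<^sup>2 + s\<^sup>2) ^ m * (t ^ 0 * s ^ 0)))"
    by (intro slice_poly_sum slice_poly_scale slice_poly_mono[OF slice_poly_harmonic[OF assms]]) auto
  then show ?thesis
    by (rule back_subst) (auto simp: fun_eq_iff poly_altdef sum_distrib_left mult_ac)
qed

text \<open>The iterated integral is a moment over the disk, and just the radial moments with 2 m =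
  n + j matter. The bound on n gives m - j < i, so u^(m - j) has degree below i and Jacobi
  orthogonality for the weight (1 - u)^(\<mu> - 1/2) u^j applies.\<close>

lemma slice_moment_zero:
  fixes c :: complex and i j :: nat
  assumes \<mu>: "\<mu> \<ge> 0" and n: "n < j + 2 * i"
  defines "B \<equiv> \<lambda>t s. Re (c * Complex t s ^ j) * poly (jacobi (\<mu> - 1/2) (real j) i) (2 * (t\<^sup>2 + s\<^sup>2) - 1)"
  shows "(LINT t|lborel. LINT s|lborel. t ^ n * slice_fun \<mu> B t s) = 0"
proof -
  let ?\<alpha> = "\<mu> - 1/2"
  define p where "p = jacobi ?\<alpha> (real j) i"
  define G where "G u = poly p (2 * u - 1) * (1 - u) powr ?\<alpha>" for u
  have [measurable]: "G \<in> borel_measurable borel" unfolding G_def by measurable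
  have int: "set_integrable lborel {0..1} G"
    using jint_unit_interval(1)[of ?\<alpha> p 0] \<mu> by (simp add: G_def[abs_def])
  have zero: "(LINT u:{0..1}|lborel. u ^ m * G u) = 0" if m: "2 * m = n + j" "j \<le> m" for m
  proof -
    have "m - j < i" using m n by auto
    have "(LINT u:{0..1}|lborel. u ^ m * G u) =
        (LINT u:{0..1}|lborel. poly (p * [:1/2, 1/2:] ^ (m - j)) (2 * u - 1) * u ^ j * (1 - u) powr ?\<alpha>)"
    proof (intro set_lebesgue_integral_cong allI impI)
      fix u :: real
      have "u ^ m = u ^ (m - j) * u ^ j" using m(2) by (simp flip: power_add)
      moreover have "poly [:1/2, 1/2:] (2 * u - 1) = u" by (simp add: field_simps)
      ultimately show "u ^ m * G u = poly (p * [:1/2, 1/2:] ^ (m - j)) (2 * u - 1) * u ^ j * (1 - u) powr ?\<alpha>"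
        by (simp add: G_def poly_power del: poly_pCons)
    qed simp
    also have "\<dots> = jint ?\<alpha> (real j) (p * [:1/2, 1/2:] ^ (m - j)) / 2 powr (?\<alpha> + real j + 1)"
      using \<mu> by (intro jint_unit_interval(2)) auto
    also have "jint ?\<alpha> (real j) (p * [:1/2, 1/2:] ^ (m - j)) = 0"
      unfolding p_def using \<mu> \<open>m - j < i\<close>
      by (intro jint_jacobi_lower le_less_trans[OF degree_linear_power_le]) auto
    finally show ?thesis by simp
  qed
  let ?h = "\<lambda>z. Re z ^ n * Re (c * z ^ j) * G ((cmod z)\<^sup>2)"
  \<comment> \<open>Division by |c| + 1 achieves the bound 1 required by
    \<open>integrable_disk_moment\<close>; the summand 1 covers c = 0. The factor is removed again
    below.\<close>
  have "integrable disk_measure (\<lambda>z. complex_of_real (Re z ^ n * Re (c * z ^ j) / (cmod c + 1)) * complex_of_real (G ((cmod z)\<^sup>2)))"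
  proof (rule integrable_disk_moment)
    fix z :: complex assume z: "cmod z < 1"
    have "\<bar>Re z\<bar> ^ n \<le> 1" using abs_Re_le_cmod[of z] z by (intro power_le_one) auto
    moreover have "\<bar>Re (c * z ^ j)\<bar> \<le> cmod c"
    proof -
      have "\<bar>Re (c * z ^ j)\<bar> \<le> cmod c * cmod z ^ j"
        using abs_Re_le_cmod[of "c * z ^ j"] by (simp add: norm_mult norm_power)
      also have "\<dots> \<le> cmod c * 1" using z by (intro mult_left_mono power_le_one) auto
      finally show ?thesis by simp
    qed
    ultimately have "\<bar>Re z\<bar> ^ n * \<bar>Re (c * z ^ j)\<bar> \<le> 1 * cmod c"
      by (intro mult_mono) auto
    also have "\<dots> \<le> 1 * (cmod c + 1)" by simp
    finally have "\<bar>Re z\<bar> ^ n * \<bar>Re (c * z ^ j)\<bar> \<le> 1 * (cmod c + 1)" .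
    then have "\<bar>Re z\<bar> ^ n * \<bar>Re (c * z ^ j)\<bar> / (cmod c + 1) \<le> 1"
      using add_nonneg_pos[OF norm_ge_zero[of c] zero_less_one] by (subst pos_divide_le_eq)
    then show "cmod (complex_of_real (Re z ^ n * Re (c * z ^ j) / (cmod c + 1))) \<le> 1"
      unfolding norm_of_real by (simp add: abs_mult power_abs)
  qed (use int in auto)
  then have "integrable disk_measure (\<lambda>z. Re (complex_of_real (Re z ^ n * Re (c * z ^ j) / (cmod c + 1)) * complex_of_real (G ((cmod z)\<^sup>2))))"
    by (rule integrable_Re)
  then have "integrable disk_measure (\<lambda>z. (1 / (cmod c + 1)) * ?h z)"
    by (rule back_subst) (auto simp: fun_eq_iff simp flip: of_real_mult)
  from integrable_mult_right[OF this, of "cmod c + 1"]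
  have "integrable disk_measure (\<lambda>z. (cmod c + 1) * (1 / (cmod c + 1)) * ?h z)"
    by (simp only: mult.assoc)
  moreover have "cmod c + 1 \<noteq> 0" by (metis add_nonneg_eq_0_iff norm_ge_zero zero_le_one zero_neq_one)
  ultimately have inth: "integrable disk_measure ?h"
    by (simp only: times_divide_eq_right mult_1_right divide_self mult_1_left simp_thms)
  have "0 = (LINT z|disk_measure. ?h z)"
    using disk_moment_zero[of G n j c] int zero by simp
  also have "\<dots> = (LINT t|lborel. LINT s|lborel. indicator (ball 0 1) (Complex t s) * ?h (Complex t s))"
    by (rule disk_integral_iterated[OF inth]) measurable
  also have "\<dots> = (LINT t|lborel. LINT s|lborel. t ^ n * slice_fun \<mu> B t s)"
    by (intro Bochner_Integration.integral_cong refl)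
       (simp add: slice_fun_def B_def G_def p_def cmod_power2 algebra_simps)
  finally show ?thesis by simp
qed

text \<open>The constant c is arbitrary so that it can absorb a rotation of the chord direction,
  which leaves the radial factor unchanged.\<close>

lemma slice_integral_basis:
  fixes c :: complex and i j :: nat
  assumes \<mu>: "\<mu> \<ge> 0" and t: "\<bar>t\<bar> < 1"
  defines "B \<equiv> \<lambda>t s. Re (c * Complex t s ^ j) * poly (jacobi (\<mu> - 1/2) (real j) i) (2 * (t\<^sup>2 + s\<^sup>2) - 1)"
  shows "integrable lborel (slice_fun \<mu> B t)"
    and "(LINT s|lborel. slice_fun \<mu> B t s) = jint (\<mu> - 1/2) (\<mu> - 1/2) 1 * Re c * poly (jacobi (\<mu> - 1/2) (real j) i) 1 *
      (1 - t\<^sup>2) powr \<mu> * (poly (gegenbauer (\<mu> + 1/2) (j + 2 * i)) t / poly (gegenbauer (\<mu> + 1/2) (j + 2 * i)) 1)"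
proof -
  let ?\<alpha> = "\<mu> - 1/2" and ?k = "j + 2 * i"
  define p where "p = jacobi ?\<alpha> (real j) i"
  define q where "q = pcompose p [:-1, 2:]"
  have dq: "degree q = i" using \<mu> by (simp add: q_def p_def degree_pcompose degree_jacobi)
  have q: "poly p (2 * u - 1) = poly q u" for u
    by (simp add: q_def poly_pcompose algebra_simps)
  have Bq: "B = (\<lambda>t s. Re (c * Complex t s ^ j) * poly q (t\<^sup>2 + s\<^sup>2))"
    unfolding B_def q[symmetric] p_def ..
  from slice_poly_basis[OF \<mu>, of j q c] obtain A where A: "degree A \<le> ?k"
    "poly A 1 = jint ?\<alpha> ?\<alpha> 1 * B 1 0"
    "\<And>t. \<bar>t\<bar> < 1 \<Longrightarrow> integrable lborel (slice_fun \<mu> B t)"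
    "\<And>t. \<bar>t\<bar> < 1 \<Longrightarrow> (LINT s|lborel. slice_fun \<mu> B t s) = (1 - t\<^sup>2) powr \<mu> * poly A t"
    unfolding slice_poly_def Bq dq by blast
  show "integrable lborel (slice_fun \<mu> B t)" using A(3) t .
  \<comment> \<open>The factor (1 - t^2)^\<mu> of the chord integrals is now the weight, whence the
    Gegenbauer index \<mu> + 1/2.\<close>
  have mom: "jint \<mu> \<mu> (A * monom 1 n) = 0" if n: "n < ?k" for n
  proof -
    have "jint \<mu> \<mu> (A * monom 1 n) = (LINT t|lborel. LINT s|lborel. t ^ n * slice_fun \<mu> B t s)"
      unfolding jint_lborel
    proof (rule integral_cong_AE)
      show "AE t in lborel. indicat_real {- 1..1} t * (poly (A * monom 1 n) t * jacobi_weight \<mu> \<mu> t) =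
          (LINT s|lborel. t ^ n * slice_fun \<mu> B t s)"
        using AE_lborel_singleton[of 1] AE_lborel_singleton[of "-1"]
      proof eventually_elim
        case (elim t)
        show ?case
        proof (cases "\<bar>t\<bar> < 1")
          case True
          then have "t \<in> {-1..1}" by auto
          then show ?thesis using A(4)[OF True]
            by (simp add: gegenbauer_weight_eq[symmetric] poly_monom mult_ac)
        next
          case False
          with elim have "t \<notin> {-1..1}" by auto
          have "t\<^sup>2 \<ge> 1" using False by (metis abs_square_less_1 not_le)
          then have "Complex t s \<notin> ball 0 1" for s
            unfolding Complex_in_ball using zero_le_power2[of s] by linarith
          then have "slice_fun \<mu> B t s = 0" for s by (simp add: slice_fun_def)
          then show ?thesis using \<open>t \<notin> {-1..1}\<close> by simp
        qed
      qed
      have m: "(\<lambda>z. Complex (fst z) (snd z)) \<in> borel \<Otimes>\<^sub>M borel \<rightarrow>\<^sub>M borel"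
        unfolding Complex_eq by measurable
          have "(\<lambda>(t, s). t ^ n * slice_fun \<mu> B t s) \<in> borel_measurable (borel \<Otimes>\<^sub>M borel)"
        unfolding split_def slice_fun_def Bq indicator_def Complex_in_ball using m by measurable
      then have "(\<lambda>(t, s). t ^ n * slice_fun \<mu> B t s) \<in> borel_measurable (lborel \<Otimes>\<^sub>M lborel)"
        by (simp cong: measurable_cong_sets)
      from lborel.borel_measurable_lebesgue_integral[OF this]
      show "(\<lambda>t. LINT s|lborel. t ^ n * slice_fun \<mu> B t s) \<in> borel_measurable lborel"
        by (simp add: split_def)
    qed (simp add: jacobi_weight_def)
    then show ?thesis using slice_moment_zero[OF \<mu> n, of c] by (simp add: B_def)
  qed
  \<comment> \<open>If Re c = 0 then \<open>A\<close> is 0, so its exact degree is unknown; the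
    degree bound is enough here.\<close>
  have "A = smult (poly A 1) (jacobi_base \<mu> \<mu> ?k)"
  proof (rule orthogonal_poly_unique[OF _ _ A(1)])
    fix r :: "real poly" assume r: "degree r < ?k"
    have "A * r = (\<Sum>n\<le>degree r. smult (coeff r n) (A * monom 1 n))"
      by (subst (1) poly_as_sum_of_monoms[of r, symmetric]) (simp add: sum_distrib_left smult_monom flip: mult_smult_right)
    then have "jint \<mu> \<mu> (A * r) = (\<Sum>n\<le>degree r. coeff r n * jint \<mu> \<mu> (A * monom 1 n))"
      using \<mu> by (simp add: jint_sum jint_smult)
    also have "\<dots> = 0" using r by (intro sum.neutral) (auto simp: mom)
    finally show "jint \<mu> \<mu> (A * r) = 0" .
  qed (use \<mu> in auto)
  then have "poly A t = poly A 1 * poly (jacobi_base \<mu> \<mu> ?k) t" by (metis poly_smult)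
  moreover have "poly (jacobi_base \<mu> \<mu> ?k) t = poly (gegenbauer (\<mu> + 1/2) ?k) t / poly (gegenbauer (\<mu> + 1/2) ?k) 1"
  proof -
    have "pochhammer (2 * (\<mu> + 1/2)) ?k > 0" using \<mu> by (intro pochhammer_pos) auto
    then show ?thesis using \<mu> by (simp add: gegenbauer_eq)
  qed
  moreover have "B 1 0 = Re c * poly p 1"
    by (simp add: B_def p_def complex_eq_iff flip: one_complex.code)
  ultimately show "(LINT s|lborel. slice_fun \<mu> B t s) = jint ?\<alpha> ?\<alpha> 1 * Re c * poly (jacobi ?\<alpha> (real j) i) 1 *
      (1 - t\<^sup>2) powr \<mu> * (poly (gegenbauer (\<mu> + 1/2) ?k) t / poly (gegenbauer (\<mu> + 1/2) ?k) 1)"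
    using A(4)[OF t] A(2) by (simp add: p_def)
qed

section \<open>Homogeneous forms of the disk basis\<close>

text \<open>The homogenization sqrt v ^ k P(p / sqrt v) of a polynomial P with the parity of k: just
  even powers of sqrt v occur, so the result is polynomial in p and v.\<close>

definition hom_even :: "nat \<Rightarrow> real poly \<Rightarrow> real \<Rightarrow> real \<Rightarrow> real" where
  "hom_even k P p v = (\<Sum>m\<le>k div 2. coeff P (k - 2 * m) * p ^ (k - 2 * m) * v ^ m)"

definition hom_poly :: "nat \<Rightarrow> real poly \<Rightarrow> real \<Rightarrow> real \<Rightarrow> real" where
  "hom_poly i q a v = (\<Sum>m\<le>i. coeff q m * a ^ m * v ^ (i - m))"

lemma hom_even_eq:
  assumes "v > 0" "degree P \<le> k" "\<And>n. odd (k + n) \<Longrightarrow> coeff P n = 0"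
  shows "sqrt v ^ k * poly P (p / sqrt v) = hom_even k P p v"
proof -
  have "sqrt v ^ k * poly P (p / sqrt v) = (\<Sum>n\<le>k. coeff P n * p ^ n * sqrt v ^ (k - n))"
  proof -
    have "poly P (p / sqrt v) = (\<Sum>n\<le>k. coeff P n * (p / sqrt v) ^ n)"
      unfolding poly_altdef using assms(2)
      by (intro sum.mono_neutral_left) (auto simp: coeff_eq_0)
    also have "sqrt v ^ k * \<dots> = (\<Sum>n\<le>k. coeff P n * p ^ n * sqrt v ^ (k - n))"
      unfolding sum_distrib_left
    proof (intro sum.cong refl)
      fix n assume "n \<in> {..k}"
      then have "sqrt v ^ k = sqrt v ^ n * sqrt v ^ (k - n)" by (simp flip: power_add)
      then show "sqrt v ^ k * (coeff P n * (p / sqrt v) ^ n) = coeff P n * p ^ n * sqrt v ^ (k - n)"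
        using assms(1) by (simp add: power_divide)
    qed
    finally show ?thesis .
  qed
  also have "\<dots> = (\<Sum>n\<in>(\<lambda>m. k - 2 * m) ` {..k div 2}. coeff P n * p ^ n * sqrt v ^ (k - n))"
  proof (rule sum.mono_neutral_right)
    show "\<forall>n\<in>{..k} - (\<lambda>m. k - 2 * m) ` {..k div 2}. coeff P n * p ^ n * sqrt v ^ (k - n) = 0"
    proof
      fix n assume n: "n \<in> {..k} - (\<lambda>m. k - 2 * m) ` {..k div 2}"
      have "odd (k + n)"
      proof
        assume "even (k + n)"
        then have "n = k - 2 * ((k - n) div 2)" "(k - n) div 2 \<le> k div 2"
          using n by (auto simp: div_le_mono)
        then show False using n by blast
      qed
      then show "coeff P n * p ^ n * sqrt v ^ (k - n) = 0" using assms(3) by simp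
    qed
  qed auto
  also have "\<dots> = (\<Sum>m\<le>k div 2. coeff P (k - 2 * m) * p ^ (k - 2 * m) * sqrt v ^ (k - (k - 2 * m)))"
    by (subst sum.reindex) (auto simp: inj_on_def)
  also have "\<dots> = hom_even k P p v"
    unfolding hom_even_def
  proof (intro sum.cong refl)
    fix m assume "m \<in> {..k div 2}"
    then have "k - (k - 2 * m) = 2 * m" by auto
    then show "coeff P (k - 2 * m) * p ^ (k - 2 * m) * sqrt v ^ (k - (k - 2 * m)) =
        coeff P (k - 2 * m) * p ^ (k - 2 * m) * v ^ m"
      using assms(1) by (simp add: power_mult)
  qed
  finally show ?thesis .
qed

lemma hom_poly_eq:
  assumes "v \<noteq> 0" "degree q \<le> i"
  shows "v ^ i * poly q (a / v) = hom_poly i q a v"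
proof -
  have "poly q (a / v) = (\<Sum>n\<le>i. coeff q n * (a / v) ^ n)"
    unfolding poly_altdef using assms(2)
    by (intro sum.mono_neutral_left) (auto simp: coeff_eq_0)
  also have "v ^ i * \<dots> = hom_poly i q a v"
    unfolding hom_poly_def sum_distrib_left
  proof (intro sum.cong refl)
    fix n assume "n \<in> {..i}"
    then have "v ^ i = v ^ n * v ^ (i - n)" by (simp flip: power_add)
    then show "v ^ i * (coeff q n * (a / v) ^ n) = coeff q n * a ^ n * v ^ (i - n)"
      using assms(1) by (simp add: power_divide)
  qed
  finally show ?thesis .
qed

definition plane :: "real ^ 3 \<Rightarrow> complex" where
  "plane y = Complex (y $ 1) (y $ 2)"

text \<open>Chosen so that \<^term>\<open>Re (trig_unit \<epsilon> * z ^ j)\<close> is \<open>r\<^sup>j\<close> times \<^term>\<open>trig j \<epsilon>\<close> of the argument.\<close>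

definition trig_unit :: "nat \<Rightarrow> complex" where
  "trig_unit \<epsilon> = (if \<epsilon> = 0 then 1 else - \<i>)"

definition radial_poly :: "real \<Rightarrow> nat \<Rightarrow> nat \<Rightarrow> real poly" where
  "radial_poly \<mu> j i = pcompose (jacobi (\<mu> - 1/2) (real j) i) [:-1, 2:]"

text \<open>The disk basis transported to the slice at height y_3 and multiplied by (1 -
  y_3^2)^(k/2). In this form it is a polynomial in all three coordinates and is meaningful at the
  poles.\<close>

definition solid_basis :: "real \<Rightarrow> nat \<Rightarrow> nat \<Rightarrow> nat \<Rightarrow> real ^ 3 \<Rightarrow> real" where
  "solid_basis \<mu> k i \<epsilon> y = disk_norm \<mu> k i * Re (trig_unit \<epsilon> * plane y ^ (k - 2 * i)) *
     hom_poly i (radial_poly \<mu> (k - 2 * i) i) ((y $ 1)\<^sup>2 + (y $ 2)\<^sup>2) (1 - (y $ 3)\<^sup>2)"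

lemma trig_eq_Re: "r ^ j * trig j \<epsilon> \<phi> = Re (trig_unit \<epsilon> * rcis r \<phi> ^ j)"
  unfolding DeMoivre2 by (simp add: trig_def trig_unit_def)

lemma poly_radial_poly: "poly (radial_poly \<mu> j i) u = poly (jacobi (\<mu> - 1/2) (real j) i) (2 * u - 1)"
  by (simp add: radial_poly_def poly_pcompose algebra_simps)

lemma degree_radial_poly: "\<mu> \<ge> 0 \<Longrightarrow> degree (radial_poly \<mu> j i) = i"
  by (simp add: radial_poly_def degree_pcompose degree_jacobi)

lemma disk_basis_altdef:
  "disk_basis \<mu> k i \<epsilon> x y = disk_norm \<mu> k i * poly (radial_poly \<mu> (k - 2 * i) i) (x\<^sup>2 + y\<^sup>2) *
     Re (trig_unit \<epsilon> * Complex x y ^ (k - 2 * i))"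
proof -
  have "cmod (Complex x y) ^ (k - 2 * i) * trig (k - 2 * i) \<epsilon> (Arg (Complex x y)) =
      Re (trig_unit \<epsilon> * Complex x y ^ (k - 2 * i))"
    unfolding trig_eq_Re rcis_cmod_Arg ..
  moreover have "(cmod (Complex x y))\<^sup>2 = x\<^sup>2 + y\<^sup>2" by (simp add: cmod_power2)
  ultimately show ?thesis
    unfolding disk_basis_def Let_def poly_radial_poly by (simp only: mult.assoc)
qed

lemma disk_basis_circle:
  "disk_basis \<mu> k i \<epsilon> (cos \<xi>) (sin \<xi>) =
     disk_norm \<mu> k i * poly (jacobi (\<mu> - 1/2) (real (k - 2 * i)) i) 1 * trig (k - 2 * i) \<epsilon> \<xi>"
proof -
  have "Complex (cos \<xi>) (sin \<xi>) = rcis 1 \<xi>" by (simp add: complex_eq_iff)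
  then show ?thesis
    using trig_eq_Re[of 1 "k - 2 * i" \<epsilon> \<xi>] by (simp add: disk_basis_altdef poly_radial_poly)
qed

lemma disk_basis_homogeneous:
  assumes "\<mu> \<ge> 0" "\<bar>y $ 3\<bar> < 1" "2 * i \<le> k"
  shows "sqrt (1 - (y $ 3)\<^sup>2) ^ k * disk_basis \<mu> k i \<epsilon> (y $ 1 / sqrt (1 - (y $ 3)\<^sup>2)) (y $ 2 / sqrt (1 - (y $ 3)\<^sup>2)) =
    solid_basis \<mu> k i \<epsilon> y"
proof -
  define v where "v = 1 - (y $ 3)\<^sup>2"
  have v: "v > 0" using assms(2) by (simp add: v_def abs_square_less_1)
  have "(y $ 1 / sqrt v)\<^sup>2 + (y $ 2 / sqrt v)\<^sup>2 = ((y $ 1)\<^sup>2 + (y $ 2)\<^sup>2) / v"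
    using v by (simp add: power_divide add_divide_distrib)
  moreover have "Complex (y $ 1 / sqrt v) (y $ 2 / sqrt v) = (1 / sqrt v) *\<^sub>R plane y"
    by (simp add: plane_def complex_eq_iff)
  \<comment> \<open>Of the k factors sqrt v, 2 i homogenize the radial polynomial and k - 2 i the
    angular part.\<close>
  moreover have "sqrt v ^ k = v ^ i * sqrt v ^ (k - 2 * i)"
  proof -
    have "sqrt v ^ k = sqrt v ^ (2 * i) * sqrt v ^ (k - 2 * i)"
      using assms(3) by (simp flip: power_add)
    then show ?thesis using v by (simp add: power_mult)
  qed
  moreover have "Re (trig_unit \<epsilon> * ((1 / sqrt v) *\<^sub>R plane y) ^ j) = (1 / sqrt v) ^ j * Re (trig_unit \<epsilon> * plane y ^ j)" for j
    by (simp only: scaleR_power mult_scaleR_right scaleR_complex.simps)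
  ultimately show ?thesis
    using v hom_poly_eq[of v "radial_poly \<mu> (k - 2 * i) i" i "(y $ 1)\<^sup>2 + (y $ 2)\<^sup>2"] assms(1)
    unfolding solid_basis_def disk_basis_altdef v_def[symmetric]
    by (simp add: degree_radial_poly power_divide)
qed

lemma finite_disk_index [simp]: "finite (disk_index k)"
  by (rule finite_subset[of _ "{..k} \<times> {..1}"]) (auto simp: disk_index_def)

definition solid_D :: "real \<Rightarrow> nat \<Rightarrow> real \<Rightarrow> real \<Rightarrow> real ^ 3 \<Rightarrow> real" where
  "solid_D \<mu> k \<xi> t y = (real k + \<mu> + 1/2) / (\<mu> + 1/2) * poly (gegenbauer (\<mu> + 1/2) k) t *
     (\<Sum>(i, \<epsilon>)\<in>disk_index k. disk_lambda \<mu> k i * disk_basis \<mu> k i \<epsilon> (cos \<xi>) (sin \<xi>) * solid_basis \<mu> k i \<epsilon> y)"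

lemma D_hom_formula_eq:
  assumes "\<mu> \<ge> 0" "\<bar>y $ 3\<bar> < 1"
  shows "D_hom_formula \<mu> k \<xi> t y = solid_D \<mu> k \<xi> t y"
proof -
  define v where "v = 1 - (y $ 3)\<^sup>2"
  have v: "v > 0" using assms(2) by (simp add: v_def abs_square_less_1)
  have "v powr (real k / 2) = sqrt v ^ k"
    using v by (simp add: powr_half_sqrt[symmetric] powr_power mult.commute)
  moreover have "sqrt v ^ k * disk_D \<mu> k \<xi> (y $ 1 / sqrt v) (y $ 2 / sqrt v) =
     (\<Sum>(i, \<epsilon>)\<in>disk_index k. disk_lambda \<mu> k i * disk_basis \<mu> k i \<epsilon> (cos \<xi>) (sin \<xi>) * solid_basis \<mu> k i \<epsilon> y)"
    unfolding disk_D_def sum_distrib_left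
  proof (intro sum.cong refl, clarify)
    fix i \<epsilon> assume "(i, \<epsilon>) \<in> disk_index k"
    then have "2 * i \<le> k" by (simp add: disk_index_def)
    from disk_basis_homogeneous[OF assms this, of \<epsilon>]
    show "sqrt v ^ k * (disk_lambda \<mu> k i * disk_basis \<mu> k i \<epsilon> (cos \<xi>) (sin \<xi>) *
        disk_basis \<mu> k i \<epsilon> (y $ 1 / sqrt v) (y $ 2 / sqrt v)) =
      disk_lambda \<mu> k i * disk_basis \<mu> k i \<epsilon> (cos \<xi>) (sin \<xi>) * solid_basis \<mu> k i \<epsilon> y"
      unfolding v_def by (simp add: algebra_simps)
  qed
  moreover have "D_hom_formula \<mu> k \<xi> t y = (real k + \<mu> + 1/2) / (\<mu> + 1/2) * poly (gegenbauer (\<mu> + 1/2) k) t *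
      (v powr (real k / 2) * disk_D \<mu> k \<xi> (y $ 1 / sqrt v) (y $ 2 / sqrt v))"
    unfolding D_hom_formula_def disk_Dt_def v_def[symmetric] by (simp only: mult_ac)
  ultimately show ?thesis by (simp only: solid_D_def)
qed

section \<open>Polynomial functions of three variables and their total degree\<close>

lemma real_polynomial_function_line:
  fixes f :: "real ^ 'n \<Rightarrow> real"
  assumes "real_polynomial_function f"
  shows "\<exists>p. \<forall>s. f (s *\<^sub>R x) = poly p s"
  using assms
proof (induction rule: real_polynomial_function.induct)
  case (linear f)
  then have "f (s *\<^sub>R x) = poly [:0, f x:] s" for s
    by (simp add: linear_scale bounded_linear.linear)
  then show ?case by blast
next
  case (const c)
  have "c = poly [:c:] s" for s :: real by simp
  then show ?case by blast
next
  case (add f g)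
  then obtain p q where "\<And>s. f (s *\<^sub>R x) = poly p s" "\<And>s. g (s *\<^sub>R x) = poly q s" by blast
  then show ?case by (intro exI[of _ "p + q"]) auto
next
  case (mult f g)
  then obtain p q where "\<And>s. f (s *\<^sub>R x) = poly p s" "\<And>s. g (s *\<^sub>R x) = poly q s" by blast
  then show ?case by (intro exI[of _ "p * q"]) auto
qed

text \<open>On each line through the origin both functions are univariate polynomials that agree at
  infinitely many parameters.\<close>

lemma real_polynomial_function_eqI:
  fixes f g :: "real ^ 'n \<Rightarrow> real"
  assumes "real_polynomial_function f" "real_polynomial_function g"
    and eq: "\<And>y. norm y < 1 \<Longrightarrow> f y = g y"
  shows "f = g"
proof
  fix x
  obtain p q where pq: "\<And>s. f (s *\<^sub>R x) = poly p s" "\<And>s. g (s *\<^sub>R x) = poly q s"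
    using real_polynomial_function_line[OF assms(1), of x] real_polynomial_function_line[OF assms(2), of x] by blast
  \<comment> \<open>Parameters below this bound keep s x in the open ball, including the case x =
    0.\<close>
  define e where "e = 1 / (norm x + 1)"
  have e: "e > 0" by (simp add: e_def add_nonneg_pos)
  have "poly (p - q) s = 0" if "s \<in> {0<..<e}" for s
  proof -
    have "norm (s *\<^sub>R x) \<le> s * (norm x + 1)" using that by (simp add: algebra_simps)
    also have "\<dots> < e * (norm x + 1)" using that by (intro mult_strict_right_mono) (auto simp: add_nonneg_pos)
    also have "\<dots> = 1" unfolding e_def by (simp add: add_nonneg_eq_0_iff)
    finally show ?thesis using eq[of "s *\<^sub>R x"] pq by simp
  qed
  then have "{0<..<e} \<subseteq> {s. poly (p - q) s = 0}" by blast
  then have "infinite {s. poly (p - q) s = 0}"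
    using infinite_super e by (meson infinite_Ioo)
  then have "p - q = 0" using poly_roots_finite by blast
  then show "f x = g x" using pq[of 1] by simp
qed

lemma poly3_less_monomial:
  fixes \<alpha> :: "3 \<Rightarrow> nat"
  assumes "sum \<alpha> UNIV < n"
  shows "(\<lambda>x. \<Prod>i\<in>UNIV. x $ i ^ \<alpha> i) \<in> poly3_less n"
proof -
  \<comment> \<open>Without finiteness the sum in \<open>poly3_less\<close> would be 0 by
    convention.\<close>
  have f: "finite {\<beta> :: 3 \<Rightarrow> nat. sum \<beta> UNIV < n}"
  proof (rule finite_subset)
    show "{\<beta> :: 3 \<Rightarrow> nat. sum \<beta> UNIV < n} \<subseteq> UNIV \<rightarrow>\<^sub>E {..n}"
    proof
      fix \<beta> :: "3 \<Rightarrow> nat" assume "\<beta> \<in> {\<beta>. sum \<beta> UNIV < n}"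
      moreover have "\<beta> i \<le> sum \<beta> UNIV" for i by (rule member_le_sum) auto
      ultimately show "\<beta> \<in> UNIV \<rightarrow>\<^sub>E {..n}" by (auto intro: less_imp_le le_less_trans)
    qed
  qed (auto intro: finite_PiE)
  show ?thesis unfolding poly3_less_def
  proof (intro CollectI exI[of _ "\<lambda>\<beta>. if \<beta> = \<alpha> then 1 else 0"] ext)
    fix x :: "real ^ 3"
    have "(\<Sum>\<beta> | sum \<beta> UNIV < n. (if \<beta> = \<alpha> then 1 else 0) * (\<Prod>i\<in>UNIV. x $ i ^ \<beta> i)) =
       (\<Sum>\<beta> | sum \<beta> UNIV < n. if \<beta> = \<alpha> then (\<Prod>i\<in>UNIV. x $ i ^ \<alpha> i) else 0)"
      by (intro sum.cong) auto
    then show "(\<Prod>i\<in>UNIV. x $ i ^ \<alpha> i) = (\<Sum>\<beta> | sum \<beta> UNIV < n. (if \<beta> = \<alpha> then 1 else 0) * (\<Prod>i\<in>UNIV. x $ i ^ \<beta> i))"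
      using f assms by simp
  qed
qed

lemma poly3_less_add: "p \<in> poly3_less n \<Longrightarrow> q \<in> poly3_less n \<Longrightarrow> (\<lambda>x. p x + q x) \<in> poly3_less n"
  unfolding poly3_less_def
proof clarsimp
  fix c d :: "(3 \<Rightarrow> nat) \<Rightarrow> real"
  show "\<exists>e. (\<lambda>x :: real ^ 3. (\<Sum>\<alpha> | sum \<alpha> UNIV < n. c \<alpha> * (\<Prod>i\<in>UNIV. x $ i ^ \<alpha> i)) +
      (\<Sum>\<alpha> | sum \<alpha> UNIV < n. d \<alpha> * (\<Prod>i\<in>UNIV. x $ i ^ \<alpha> i))) =
      (\<lambda>x. \<Sum>\<alpha> | sum \<alpha> UNIV < n. e \<alpha> * (\<Prod>i\<in>UNIV. x $ i ^ \<alpha> i))"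
    by (intro exI[of _ "\<lambda>\<alpha>. c \<alpha> + d \<alpha>"]) (simp add: distrib_right sum.distrib)
qed

lemma poly3_less_scale: "p \<in> poly3_less n \<Longrightarrow> (\<lambda>x. c * p x) \<in> poly3_less n"
  unfolding poly3_less_def
proof clarsimp
  fix d :: "(3 \<Rightarrow> nat) \<Rightarrow> real"
  show "\<exists>e. (\<lambda>x :: real ^ 3. c * (\<Sum>\<alpha> | sum \<alpha> UNIV < n. d \<alpha> * (\<Prod>i\<in>UNIV. x $ i ^ \<alpha> i))) =
      (\<lambda>x. \<Sum>\<alpha> | sum \<alpha> UNIV < n. e \<alpha> * (\<Prod>i\<in>UNIV. x $ i ^ \<alpha> i))"
    by (intro exI[of _ "\<lambda>\<alpha>. c * d \<alpha>"]) (simp add: sum_distrib_left mult.assoc)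
qed

lemma poly3_less_zero: "(\<lambda>x. 0) \<in> poly3_less n"
  unfolding poly3_less_def by (auto intro!: exI[of _ "\<lambda>_. 0"])

lemma poly3_less_sum: "(\<And>i. i \<in> I \<Longrightarrow> p i \<in> poly3_less n) \<Longrightarrow> (\<lambda>x. \<Sum>i\<in>I. p i x) \<in> poly3_less n"
  by (induction I rule: infinite_finite_induct) (auto simp: poly3_less_zero poly3_less_add)

lemma poly3_less_diff: "p \<in> poly3_less n \<Longrightarrow> q \<in> poly3_less n \<Longrightarrow> (\<lambda>x. p x - q x) \<in> poly3_less n"
  using poly3_less_add[of p n "\<lambda>x. -1 * q x"] poly3_less_scale[of q n "-1"] by simp

lemma poly3_less_closed_induct:
  assumes p: "p \<in> poly3_less n"
    and mono: "\<And>\<alpha>. sum \<alpha> UNIV < n \<Longrightarrow> P (\<lambda>x. \<Prod>i\<in>UNIV. x $ i ^ \<alpha> i)"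
    and add: "\<And>f g. P f \<Longrightarrow> P g \<Longrightarrow> P (\<lambda>x. f x + g x)"
    and scale: "\<And>c f. P f \<Longrightarrow> P (\<lambda>x. c * f x)"
    and zero: "P (\<lambda>x. 0)"
  shows "P p"
proof -
  from p obtain c where pc: "p = (\<lambda>x. \<Sum>\<alpha> | sum \<alpha> UNIV < n. c \<alpha> * (\<Prod>i\<in>UNIV. x $ i ^ \<alpha> i))"
    by (auto simp: poly3_less_def)
  have "P (\<lambda>x. \<Sum>\<alpha>\<in>S. c \<alpha> * (\<Prod>i\<in>UNIV. x $ i ^ \<alpha> i))" if "S \<subseteq> {\<alpha>. sum \<alpha> UNIV < n}" for S
    using that
  proof (induction S rule: infinite_finite_induct)
    case (insert \<alpha> S)
    then have "P (\<lambda>x. c \<alpha> * (\<Prod>i\<in>UNIV. x $ i ^ \<alpha> i) + (\<Sum>\<alpha>\<in>S. c \<alpha> * (\<Prod>i\<in>UNIV. x $ i ^ \<alpha> i)))"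
      by (intro add scale mono) auto
    then show ?case using insert by simp
  qed (auto intro: zero)
  then show ?thesis unfolding pc by blast
qed

lemma poly3_less_mono: "p \<in> poly3_less n \<Longrightarrow> n \<le> n' \<Longrightarrow> p \<in> poly3_less n'"
  by (erule poly3_less_closed_induct)
     (auto intro: poly3_less_monomial poly3_less_add poly3_less_scale poly3_less_zero)

text \<open>The index \<open>Suc a\<close> stands for degree at most a; in this form degrees
  add.\<close>

lemma poly3_less_mult:
  assumes p: "p \<in> poly3_less (Suc a)" and q: "q \<in> poly3_less (Suc b)"
  shows "(\<lambda>x. p x * q x) \<in> poly3_less (Suc (a + b))"
  using p
proof (rule poly3_less_closed_induct)
  fix \<alpha> :: "3 \<Rightarrow> nat" assume \<alpha>: "sum \<alpha> UNIV < Suc a"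
  show "(\<lambda>x. (\<Prod>i\<in>UNIV. x $ i ^ \<alpha> i) * q x) \<in> poly3_less (Suc (a + b))"
    using q
  proof (rule poly3_less_closed_induct)
    fix \<beta> :: "3 \<Rightarrow> nat" assume \<beta>: "sum \<beta> UNIV < Suc b"
    have "(\<lambda>x. \<Prod>i\<in>UNIV. x $ i ^ (\<alpha> i + \<beta> i)) \<in> poly3_less (Suc (a + b))"
      using \<alpha> \<beta> by (intro poly3_less_monomial) (auto simp: sum.distrib)
    then show "(\<lambda>x. (\<Prod>i\<in>UNIV. x $ i ^ \<alpha> i) * (\<Prod>i\<in>UNIV. x $ i ^ \<beta> i)) \<in> poly3_less (Suc (a + b))"
      by (simp add: power_add prod.distrib)
  qed (auto simp: distrib_left mult.left_commute poly3_less_add poly3_less_scale poly3_less_zero)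
qed (auto simp: distrib_right mult.assoc poly3_less_add poly3_less_scale poly3_less_zero)

lemma poly3_less_const: "(\<lambda>x. c) \<in> poly3_less (Suc n)"
  using poly3_less_scale[OF poly3_less_monomial[of "\<lambda>_. 0" "Suc n"], of c] by simp

lemma poly3_less_coord: "(\<lambda>x. x $ i) \<in> poly3_less (Suc 1)"
proof -
  have "(\<Prod>k\<in>UNIV. x $ k ^ (if k = i then 1 else 0)) = x $ i" for x :: "real ^ 3"
  proof -
    have "(\<Prod>k\<in>UNIV. x $ k ^ (if k = i then 1 else 0)) = (\<Prod>k\<in>UNIV. if k = i then x $ k else 1)"
      by (intro prod.cong) auto
    then show ?thesis by simp
  qed
  moreover have "(\<Sum>k\<in>UNIV. if k = i then 1 else 0 :: nat) < Suc 1" by simp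
  ultimately show ?thesis
    using poly3_less_monomial[of "\<lambda>k. if k = i then 1 else 0" "Suc 1"] by simp
qed

lemma poly3_less_power: "p \<in> poly3_less (Suc a) \<Longrightarrow> (\<lambda>x. p x ^ n) \<in> poly3_less (Suc (n * a))"
proof (induction n)
  case 0
  then show ?case using poly3_less_const[of 1] by simp
next
  case (Suc n)
  then show ?case using poly3_less_mult[of p a "\<lambda>x. p x ^ n" "n * a"] by simp
qed

lemma poly3_less_poly:
  assumes "p \<in> poly3_less (Suc a)" "degree g * a \<le> d"
  shows "(\<lambda>x. poly g (p x)) \<in> poly3_less (Suc d)"
  unfolding poly_altdef
  by (intro poly3_less_sum poly3_less_scale poly3_less_mono[OF poly3_less_power[OF assms(1)]])
     (use assms(2) in \<open>auto intro: order_trans[OF mult_le_mono1]\<close>)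

lemma real_polynomial_function_poly3: "p \<in> poly3_less n \<Longrightarrow> real_polynomial_function p"
proof (erule poly3_less_closed_induct)
  fix \<alpha> :: "3 \<Rightarrow> nat"
  have "real_polynomial_function (\<lambda>x :: real ^ 3. x $ i)" for i
    by (intro real_polynomial_function.intros(1) bounded_linear_vec_nth)
  then show "real_polynomial_function (\<lambda>x :: real ^ 3. \<Prod>i\<in>UNIV. x $ i ^ \<alpha> i)"
    by (intro real_polynomial_function_prod real_polynomial_function_power) auto
qed (auto intro: real_polynomial_function.intros)

lemma poly3_less_Re_power: "(\<lambda>y. Re (c * plane y ^ j)) \<in> poly3_less (Suc j)"
proof (induction j arbitrary: c)
  case 0
  then show ?case using poly3_less_const by simp
next
  case (Suc j)
  have "(\<lambda>y. y $ 1 * Re (c * plane y ^ j) + y $ 2 * Re (c * \<i> * plane y ^ j)) \<in> poly3_less (Suc (1 + j))"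
    by (intro poly3_less_add poly3_less_mult poly3_less_coord Suc)
  moreover have "Re (c * plane y ^ Suc j) = y $ 1 * Re (c * plane y ^ j) + y $ 2 * Re (c * \<i> * plane y ^ j)" for y
    by (simp add: plane_def algebra_simps)
  ultimately show ?case by simp
qed

lemma poly3_less_vert: "(\<lambda>y. 1 - (y $ 3)\<^sup>2) \<in> poly3_less (Suc 2)"
  using poly3_less_diff[OF poly3_less_const[of 1 2] poly3_less_mono[OF poly3_less_power[OF poly3_less_coord[of 3], of 2]]]
  by simp

lemma poly3_less_horiz: "(\<lambda>y. (y $ 1)\<^sup>2 + (y $ 2)\<^sup>2) \<in> poly3_less (Suc 2)"
  using poly3_less_add[OF poly3_less_mono[OF poly3_less_power[OF poly3_less_coord[of 1], of 2]]
      poly3_less_mono[OF poly3_less_power[OF poly3_less_coord[of 2], of 2]]]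
  by simp

lemma poly3_less_hom_poly:
  assumes "p \<in> poly3_less (Suc 2)" "q \<in> poly3_less (Suc 2)"
  shows "(\<lambda>y. hom_poly i g (p y) (q y)) \<in> poly3_less (Suc (2 * i))"
  unfolding hom_poly_def
proof (intro poly3_less_sum)
  fix m assume "m \<in> {..i}"
  then have "2 * i = (0 + m * 2) + (i - m) * 2" by simp
  then show "(\<lambda>x. coeff g m * p x ^ m * q x ^ (i - m)) \<in> poly3_less (Suc (2 * i))"
    by (simp only:) (intro poly3_less_mult poly3_less_power poly3_less_const assms)
qed

lemma poly3_less_hom_even:
  assumes "p \<in> poly3_less (Suc 1)" "q \<in> poly3_less (Suc 2)"
  shows "(\<lambda>y. hom_even k g (p y) (q y)) \<in> poly3_less (Suc k)"
  unfolding hom_even_def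
proof (intro poly3_less_sum)
  fix m assume "m \<in> {..k div 2}"
  then have "k = (0 + (k - 2 * m) * 1) + m * 2" by auto
  moreover have "(\<lambda>x. coeff g (k - 2 * m) * p x ^ (k - 2 * m) * q x ^ m) \<in> poly3_less (Suc ((0 + (k - 2 * m) * 1) + m * 2))"
    by (intro poly3_less_mult poly3_less_power poly3_less_const assms)
  ultimately show "(\<lambda>x. coeff g (k - 2 * m) * p x ^ (k - 2 * m) * q x ^ m) \<in> poly3_less (Suc k)"
    by simp
qed

lemma poly3_less_solid_basis:
  assumes "2 * i \<le> k"
  shows "solid_basis \<mu> k i \<epsilon> \<in> poly3_less (Suc k)"
proof -
  have "(\<lambda>y. disk_norm \<mu> k i * Re (trig_unit \<epsilon> * plane y ^ (k - 2 * i)) *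
     hom_poly i (radial_poly \<mu> (k - 2 * i) i) ((y $ 1)\<^sup>2 + (y $ 2)\<^sup>2) (1 - (y $ 3)\<^sup>2)) \<in> poly3_less (Suc ((0 + (k - 2 * i)) + 2 * i))"
    by (intro poly3_less_mult poly3_less_const poly3_less_hom_poly poly3_less_Re_power poly3_less_horiz poly3_less_vert)
  then show ?thesis using assms by (simp add: solid_basis_def[abs_def])
qed

lemma real_polynomial_solid_D: "real_polynomial_function (solid_D \<mu> k \<xi> t)"
proof -
  have "solid_D \<mu> k \<xi> t \<in> poly3_less (Suc k)"
    unfolding solid_D_def[abs_def] split_def
    by (intro poly3_less_scale poly3_less_sum poly3_less_solid_basis) (auto simp: disk_index_def)
  then show ?thesis by (rule real_polynomial_function_poly3)
qed

text \<open>The description picks the polynomial extension. The points where it is prescribed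
  include the open ball, and that already determines a polynomial.\<close>

lemma D_hom_eq:
  assumes "\<mu> \<ge> 0"
  shows "D_hom \<mu> k \<xi> t y = solid_D \<mu> k \<xi> t y"
proof (cases "\<bar>y $ 3\<bar> < 1")
  case True
  then show ?thesis by (simp add: D_hom_def D_hom_formula_eq assms)
next
  case False
  have "(THE Q. real_polynomial_function Q \<and>
      (\<forall>y\<in>cball 0 1. \<bar>y $ 3\<bar> < 1 \<longrightarrow> Q y = D_hom_formula \<mu> k \<xi> t y)) = solid_D \<mu> k \<xi> t"
  proof (rule the_equality)
    show "real_polynomial_function (solid_D \<mu> k \<xi> t) \<and>
      (\<forall>y\<in>cball 0 1. \<bar>y $ 3\<bar> < 1 \<longrightarrow> solid_D \<mu> k \<xi> t y = D_hom_formula \<mu> k \<xi> t y)"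
      by (simp add: real_polynomial_solid_D D_hom_formula_eq assms)
  next
    fix Q assume Q: "real_polynomial_function Q \<and>
      (\<forall>y\<in>cball 0 1. \<bar>y $ 3\<bar> < 1 \<longrightarrow> Q y = D_hom_formula \<mu> k \<xi> t y)"
    show "Q = solid_D \<mu> k \<xi> t"
    proof (rule real_polynomial_function_eqI)
      fix y :: "real ^ 3" assume y: "norm y < 1"
      then have "\<bar>y $ 3\<bar> < 1" using component_le_norm_cart[of y 3] by simp
      with y show "Q y = solid_D \<mu> k \<xi> t y" using Q by (simp add: D_hom_formula_eq assms)
    qed (use Q in \<open>auto simp: real_polynomial_solid_D\<close>)
  qed
  then show ?thesis using False by (simp add: D_hom_def)
qed

text \<open>Having one polynomial of each exact degree up to N, the leading term of g can be
  cancelled repeatedly.\<close>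

lemma poly_span_induct:
  fixes P :: "real poly \<Rightarrow> bool"
  assumes add: "\<And>p q. P p \<Longrightarrow> P q \<Longrightarrow> P (p + q)" and scale: "\<And>c p. P p \<Longrightarrow> P (smult c p)"
    and basis: "\<And>d. d \<le> N \<Longrightarrow> \<exists>p. degree p = d \<and> p \<noteq> 0 \<and> P p"
    and g: "degree g \<le> N"
  shows "P g"
  using g
proof (induction "degree g" arbitrary: g rule: less_induct)
  case less
  from basis[OF less(2)] obtain p where p: "degree p = degree g" "p \<noteq> 0" "P p" by blast
  define c where "c = lead_coeff g / lead_coeff p"
  define r where "r = g - smult c p"
  have "coeff r (degree g) = 0" using p by (simp add: r_def c_def flip: p(1))
  have dr: "degree r \<le> degree g"
    unfolding r_def using p by (intro degree_diff_le) (auto intro: order_trans[OF degree_smult_le])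
  have "P r"
  proof (cases "r = 0")
    case True
    then show ?thesis using scale[OF p(3), of 0] by simp
  next
    case False
    then have "degree r < degree g" using dr \<open>coeff r (degree g) = 0\<close>
      by (metis le_neq_implies_less leading_coeff_0_iff)
    then show ?thesis using less by simp
  qed
  then have "P (r + smult c p)" using add scale p by blast
  then show ?case by (simp add: r_def)
qed

section \<open>Spanning and discrete orthogonality\<close>

text \<open>The factor h_k of the usual normalization is omitted; its square is placed in
  \<open>ridge_coeff\<close>.\<close>

definition ball_basis :: "real \<Rightarrow> nat \<Rightarrow> nat \<Rightarrow> nat \<Rightarrow> nat \<Rightarrow> real ^ 3 \<Rightarrow> real" where
  "ball_basis \<mu> l k i \<epsilon> y = solid_basis \<mu> k i \<epsilon> y * gegenbauer_normed (real k + \<mu> + 1) (l - k) (y $ 3)"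

lemma disk_norm_pos:
  assumes "\<mu> \<ge> 0"
  shows "disk_norm \<mu> k i > 0"
proof -
  have "Gamma (real (k - 2 * i) + \<mu> + 3/2) > 0" "Gamma (\<mu> + 3/2) > 0" "Gamma (real (k - 2 * i) + 1) > 0"
    using assms by (auto intro!: Gamma_real_pos)
  then show ?thesis unfolding disk_norm_def by simp
qed

lemma gegenbauer_norm_const_pos:
  assumes "a > (0::real)"
  shows "a * pochhammer (2 * a) k / ((real k + a) * fact k) > 0"
  using assms by (intro divide_pos_pos mult_pos_pos pochhammer_pos) (auto simp: add_nonneg_pos)

lemma prod_UNIV_3: "prod f (UNIV :: 3 set) = f 1 * f 2 * f 3"
  unfolding UNIV_3 by (simp add: mult_ac)

text \<open>Stated for a predicate closed under linear combinations, so that a reproducing identity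
  can be inserted for U. The basis is converted to monomials by changes of basis, none of which
  raises the total degree above n.\<close>

lemma ball_basis_span:
  assumes \<mu>: "\<mu> \<ge> 0"
    and add: "\<And>f g. U f \<Longrightarrow> U g \<Longrightarrow> U (\<lambda>x. f x + g x)"
    and scale: "\<And>c f. U f \<Longrightarrow> U (\<lambda>x. c * f x)"
    and zero: "U (\<lambda>x. 0)"
    and basis: "\<And>l k i \<epsilon>. l \<le> n \<Longrightarrow> k \<le> l \<Longrightarrow> (i, \<epsilon>) \<in> disk_index k \<Longrightarrow> U (ball_basis \<mu> l k i \<epsilon>)"
    and p: "p \<in> poly3_less (Suc n)"
  shows "U p"
proof -
  define rho where "rho y = (y $ 1)\<^sup>2 + (y $ 2)\<^sup>2" for y :: "real ^ 3"
  define v where "v y = 1 - (y $ 3)\<^sup>2" for y :: "real ^ 3"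
  define H where "H \<epsilon> i j y = Re (trig_unit \<epsilon> * plane y ^ j) * hom_poly i (radial_poly \<mu> j i) (rho y) (v y)" for \<epsilon> i j y
  have sum: "U (\<lambda>x. \<Sum>i\<in>I. f i x)" if "\<And>i. i \<in> I \<Longrightarrow> U (f i)" for I :: "nat set" and f
    using that by (induction I rule: infinite_finite_induct) (auto intro: zero add)
  \<comment> \<open>For fixed k = j + 2 i the vertical factors are Gegenbauer polynomials of every
    degree up to n - k, hence span all polynomials in y_3 of that degree.\<close>
  have step1: "U (\<lambda>y. poly g (y $ 3) * H \<epsilon> i j y)"
    if "\<epsilon> \<le> 1" "\<epsilon> \<le> j" "degree g \<le> n - (j + 2 * i)" "j + 2 * i \<le> n" for \<epsilon> i j g
  proof (rule poly_span_induct[OF _ _ _ that(3)])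
    fix d assume d: "d \<le> n - (j + 2 * i)"
    let ?k = "j + 2 * i"
    let ?a = "real ?k + \<mu> + 1"
    have a: "?a > 0" using \<mu> by simp
    have 1: "U (ball_basis \<mu> (?k + d) ?k i \<epsilon>)"
      using that d by (intro basis) (auto simp: disk_index_def)
    let ?s = "sqrt (?a * pochhammer (2 * ?a) d / ((real d + ?a) * fact d))"
    have s: "?s > 0" using gegenbauer_norm_const_pos[OF a, of d] by simp
    have "U (\<lambda>y. ?s / disk_norm \<mu> ?k i * ball_basis \<mu> (?k + d) ?k i \<epsilon> y)"
      using 1 by (rule scale)
    moreover have "?s / disk_norm \<mu> ?k i * ball_basis \<mu> (?k + d) ?k i \<epsilon> y = poly (gegenbauer ?a d) (y $ 3) *
        H \<epsilon> i j y" for y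
    proof -
      have "gegenbauer_normed ?a d (y $ 3) = poly (gegenbauer ?a d) (y $ 3) / ?s"
        unfolding gegenbauer_normed_def by simp
      then have E: "ball_basis \<mu> (?k + d) ?k i \<epsilon> y = disk_norm \<mu> ?k i * H \<epsilon> i j y * (poly (gegenbauer ?a d) (y $ 3) / ?s)"
        unfolding ball_basis_def solid_basis_def H_def rho_def v_def by simp
      have alg: "b / a * (a * c * (e / b)) = e * c" if "a > 0" "b > 0" for a b c e :: real
        using that by simp
      show ?thesis unfolding E by (rule alg[OF disk_norm_pos[OF \<mu>] s])
    qed
    ultimately have "U (\<lambda>y. poly (gegenbauer ?a d) (y $ 3) *
        H \<epsilon> i j y)" by simp
    moreover have "gegenbauer ?a d \<noteq> 0"
    proof
      assume "gegenbauer ?a d = 0"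
      moreover have "pochhammer (2 * ?a) d > 0" using a by (intro pochhammer_pos) auto
      ultimately show False using poly_gegenbauer_1[OF a, of d] by simp
    qed
    ultimately show "\<exists>p. degree p = d \<and> p \<noteq> 0 \<and> U (\<lambda>y. poly p (y $ 3) * H \<epsilon> i j y)"
      using degree_gegenbauer[OF a] by blast
  next
    fix p q
    assume "U (\<lambda>y. poly p (y $ 3) * H \<epsilon> i j y)"
      "U (\<lambda>y. poly q (y $ 3) * H \<epsilon> i j y)"
    from add[OF this] show "U (\<lambda>y. poly (p + q) (y $ 3) * H \<epsilon> i j y)"
      by (simp add: distrib_right)
  next
    fix p c
    assume "U (\<lambda>y. poly p (y $ 3) * H \<epsilon> i j y)"
    from scale[OF this, of c] show "U (\<lambda>y. poly (smult c p) (y $ 3) * H \<epsilon> i j y)"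
      by (simp add: mult.assoc)
  qed
  \<comment> \<open>Triangular in i: the top term of \<open>hom_poly\<close> is a multiple of rho^i,
    and a lower term rho^m carries (1 - y_3^2)^(i - m), which is moved into g at unchanged total
    degree.\<close>
  have step2': "U (\<lambda>y. poly g (y $ 3) * (Re (trig_unit \<epsilon> * plane y ^ j) * rho y ^ i))"
    if "\<epsilon> \<le> 1" "\<epsilon> \<le> j" "degree g + j + 2 * i \<le> n" for \<epsilon> i j g
    using that(3)
  proof (induction i arbitrary: g rule: less_induct)
    case (less i)
    let ?q = "radial_poly \<mu> j i"
    let ?c = "coeff ?q"
    let ?Z = "\<lambda>y. Re (trig_unit \<epsilon> * plane y ^ j)"
    have "?c i \<noteq> 0"
    proof
      assume "?c i = 0"
      then have "?q = 0" using degree_radial_poly[OF \<mu>, of j i] by (metis leading_coeff_0_iff)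
      then have "poly ?q 1 = 0" by simp
      then show False
        using \<mu> jint_1_pos[of "\<mu> - 1/2" "real j"] jint_jacobi_base_self_pos[of "\<mu> - 1/2" "real j" i]
        by (simp add: poly_radial_poly jacobi_eq)
    qed
    have A: "U (\<lambda>y. poly g (y $ 3) * (?Z y * hom_poly i ?q (rho y) (v y)))"
      using step1[of \<epsilon> j g i] less.prems that unfolding H_def by auto
    have B: "U (\<lambda>y. \<Sum>m<i. - ?c m * (poly (g * [:1, 0, -1:] ^ (i - m)) (y $ 3) * (?Z y * rho y ^ m)))"
    proof (intro sum scale)
      fix m assume m: "m \<in> {..<i}"
      have "degree (g * [:1, 0, -1:] ^ (i - m)) \<le> degree g + 2 * (i - m)"
        by (rule order_trans[OF degree_mult_le] add_left_mono order_trans[OF degree_power_le])+ simp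
      then show "U (\<lambda>y. poly (g * [:1, 0, -1:] ^ (i - m)) (y $ 3) * (?Z y * rho y ^ m))"
        using m less.prems by (intro less.IH) auto
    qed
    have "U (\<lambda>y. 1 / ?c i * (poly g (y $ 3) * (?Z y * hom_poly i ?q (rho y) (v y)) +
        (\<Sum>m<i. - ?c m * (poly (g * [:1, 0, -1:] ^ (i - m)) (y $ 3) * (?Z y * rho y ^ m)))))"
      by (intro scale add A B)
    moreover have "1 / ?c i * (poly g (y $ 3) * (?Z y * hom_poly i ?q (rho y) (v y)) +
        (\<Sum>m<i. - ?c m * (poly (g * [:1, 0, -1:] ^ (i - m)) (y $ 3) * (?Z y * rho y ^ m)))) =
        poly g (y $ 3) * (?Z y * rho y ^ i)" for y
    proof -
      have E1: "hom_poly i ?q (rho y) (v y) = ?c i * rho y ^ i + (\<Sum>m<i. ?c m * rho y ^ m * v y ^ (i - m))"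
        unfolding hom_poly_def by (simp add: lessThan_Suc_atMost[symmetric])
      have E2: "(\<Sum>m<i. - ?c m * (poly (g * [:1, 0, -1:] ^ (i - m)) (y $ 3) * (?Z y * rho y ^ m))) =
          - (poly g (y $ 3) * ?Z y * (\<Sum>m<i. ?c m * rho y ^ m * v y ^ (i - m)))"
        unfolding sum_distrib_left sum_negf[symmetric]
        by (intro sum.cong) (auto simp: v_def power2_eq_square)
      have alg: "1 / a * (g * (z * (a * r + b)) + - (g * z * b)) = g * (z * r)" if "a \<noteq> 0" for a b g z r :: real
        using that by (simp add: field_simps)
      show ?thesis unfolding E1 E2 by (rule alg[OF \<open>?c i \<noteq> 0\<close>])
    qed
    ultimately show ?case by simp
  qed
  have step2: "U (\<lambda>y. poly g (y $ 3) * (Re (c * plane y ^ j) * rho y ^ i))"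
    if d: "degree g + j + 2 * i \<le> n" for c i j g
  proof -
    have 0: "U (\<lambda>y. Re c * (poly g (y $ 3) * (Re (trig_unit 0 * plane y ^ j) * rho y ^ i)))"
      using d by (intro scale step2') auto
    have 1: "U (\<lambda>y. - Im c * (poly g (y $ 3) * (Re (trig_unit 1 * plane y ^ j) * rho y ^ i)))"
    \<comment> \<open>For j = 0 the index set has no sine element, but the corresponding real part
      is zero.\<close>
    proof (cases "j = 0")
      case True
      then show ?thesis using zero by (simp add: trig_unit_def)
    next
      case False
      then show ?thesis using d by (intro scale step2') auto
    qed
    have E: "Re (c * plane y ^ j) = Re c * Re (trig_unit 0 * plane y ^ j) - Im c * Re (trig_unit 1 * plane y ^ j)" for y
      by (simp add: trig_unit_def)
    have alg: "g * ((a * x - b * z) * r) = a * (g * (x * r)) + - b * (g * (z * r))" for a b g x z r :: real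
      by (simp add: algebra_simps)
    have "poly g (y $ 3) * (Re (c * plane y ^ j) * rho y ^ i) =
        Re c * (poly g (y $ 3) * (Re (trig_unit 0 * plane y ^ j) * rho y ^ i)) +
        - Im c * (poly g (y $ 3) * (Re (trig_unit 1 * plane y ^ j) * rho y ^ i))" for y
      unfolding E by (rule alg)
    then have "(\<lambda>y. poly g (y $ 3) * (Re (c * plane y ^ j) * rho y ^ i)) =
        (\<lambda>y. Re c * (poly g (y $ 3) * (Re (trig_unit 0 * plane y ^ j) * rho y ^ i)) +
        - Im c * (poly g (y $ 3) * (Re (trig_unit 1 * plane y ^ j) * rho y ^ i)))"
      by (rule ext)
    from ssubst[of _ _ U, OF this add[OF 0 1]] show ?thesis .
  qed
  have rho: "(cmod (plane y))\<^sup>2 = rho y" for y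
    by (simp add: plane_def rho_def cmod_power2)
  have Re_of_real: "Re (w * complex_of_real r) = Re w * r" for w r by simp
  have alg1: "g * (A * x ^ a * w) + g * (B * x ^ a * w) = g * (C * x ^ Suc a * w)"
    if "A + B = C * x" for A B C g w x :: real and a
  proof -
    have "C * x ^ Suc a = (A + B) * x ^ a" using that by simp
    then show ?thesis by (simp add: algebra_simps)
  qed
  have alg2: "g * (A * w * x ^ a) + g * (B * w * x ^ a) = g * (C * w * x ^ Suc a)"
    if "A + B = C * x" for A B C g w x :: real and a
    using alg1[OF that, of g a w] by (simp only: mult_ac)
  \<comment> \<open>With z = \<open>plane y\<close>, the coordinates are (z + cnj z) / 2 and (z -
    cnj z) / (2 i); substituting them one at a time leaves z^p (cnj z)^q, which is a power of z or
    \<open>cnj z\<close> times a power of rho.\<close>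
  have step3: "U (\<lambda>y. poly g (y $ 3) * (Re (c * plane y ^ p * cnj (plane y) ^ q) * (y $ 1) ^ a * (y $ 2) ^ b))"
    if "degree g + p + q + a + b \<le> n" for a b c p q g
    using that
  proof (induction "a + b" arbitrary: a b c p q)
    case 0
    then have ab: "a = 0" "b = 0" by auto
    show ?case
    proof (cases "q \<le> p")
      case True
      have "Re (c * plane y ^ p * cnj (plane y) ^ q) = Re (c * plane y ^ (p - q)) * rho y ^ q" for y
      proof -
        have "plane y ^ p = plane y ^ (p - q) * plane y ^ q" using True by (simp flip: power_add)
        then have "c * plane y ^ p * cnj (plane y) ^ q = (c * plane y ^ (p - q)) * (plane y ^ q * cnj (plane y) ^ q)"
          by (simp only: mult_ac)
        then show ?thesis by (simp only: power_mult_cnj_power rho Re_of_real)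
      qed
      moreover have "degree g + (p - q) + 2 * q \<le> n" using 0 True by auto
      ultimately show ?thesis using step2[of g "p - q" q c] by (simp add: ab)
    next
      case False
      have "Re (c * plane y ^ p * cnj (plane y) ^ q) = Re (cnj c * plane y ^ (q - p)) * rho y ^ p" for y
      proof -
        have "cnj (plane y) ^ q = cnj (plane y) ^ (q - p) * cnj (plane y) ^ p" using False by (simp flip: power_add)
        then have "c * plane y ^ p * cnj (plane y) ^ q = (c * cnj (plane y) ^ (q - p)) * (plane y ^ p * cnj (plane y) ^ p)"
          by (simp only: mult_ac)
        moreover have "c * cnj (plane y) ^ (q - p) = cnj (cnj c * plane y ^ (q - p))" by simp
        ultimately show ?thesis by (simp only: power_mult_cnj_power rho Re_of_real cnj.simps)
      qed
      moreover have "degree g + (q - p) + 2 * p \<le> n" using 0 False by auto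
      ultimately show ?thesis using step2[of g "q - p" p "cnj c"] by (simp add: ab)
    qed
  next
    case (Suc s)
    show ?case
    proof (cases a)
      case (Suc a')
      have "U (\<lambda>y. poly g (y $ 3) * (Re (c / 2 * plane y ^ Suc p * cnj (plane y) ^ q) * (y $ 1) ^ a' * (y $ 2) ^ b) +
         poly g (y $ 3) * (Re (c / 2 * plane y ^ p * cnj (plane y) ^ Suc q) * (y $ 1) ^ a' * (y $ 2) ^ b))"
        using Suc.hyps(2) Suc.prems \<open>a = Suc a'\<close> by (intro add Suc.hyps(1)) auto
      moreover have E: "Re (c / 2 * plane y ^ Suc p * cnj (plane y) ^ q) + Re (c / 2 * plane y ^ p * cnj (plane y) ^ Suc q) =
          Re (c * plane y ^ p * cnj (plane y) ^ q) * y $ 1" for y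
      proof -
        have "c / 2 * plane y ^ Suc p * cnj (plane y) ^ q + c / 2 * plane y ^ p * cnj (plane y) ^ Suc q =
           c * plane y ^ p * cnj (plane y) ^ q * ((plane y + cnj (plane y)) / 2)"
          by (simp add: field_simps)
        also have "(plane y + cnj (plane y)) / 2 = complex_of_real (y $ 1)"
          by (simp add: complex_add_cnj plane_def)
        finally show ?thesis unfolding plus_complex.simps(1)[symmetric] by (simp only: Re_of_real)
      qed
      ultimately show ?thesis unfolding Suc alg1[OF E] by blast
    next
      case 0
      then obtain b' where b: "b = Suc b'" using Suc.hyps(2) by (cases b) auto
      have "U (\<lambda>y. poly g (y $ 3) * (Re (c / (2 * \<i>) * plane y ^ Suc p * cnj (plane y) ^ q) * (y $ 1) ^ a * (y $ 2) ^ b') +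
         poly g (y $ 3) * (Re (- c / (2 * \<i>) * plane y ^ p * cnj (plane y) ^ Suc q) * (y $ 1) ^ a * (y $ 2) ^ b'))"
        using Suc.hyps(2) Suc.prems b by (intro add Suc.hyps(1)) auto
      moreover have E: "Re (c / (2 * \<i>) * plane y ^ Suc p * cnj (plane y) ^ q) + Re (- c / (2 * \<i>) * plane y ^ p * cnj (plane y) ^ Suc q) =
          Re (c * plane y ^ p * cnj (plane y) ^ q) * y $ 2" for y
      proof -
        have "c / (2 * \<i>) * plane y ^ Suc p * cnj (plane y) ^ q + - c / (2 * \<i>) * plane y ^ p * cnj (plane y) ^ Suc q =
           c * plane y ^ p * cnj (plane y) ^ q * ((plane y - cnj (plane y)) / (2 * \<i>))"
          by (simp add: field_simps)
        also have "plane y - cnj (plane y) = 2 * \<i> * complex_of_real (y $ 2)"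
          by (simp add: complex_eq_iff plane_def)
        also have "2 * \<i> * complex_of_real (y $ 2) / (2 * \<i>) = complex_of_real (y $ 2)" by simp
        finally show ?thesis unfolding plus_complex.simps(1)[symmetric] by (simp only: Re_of_real)
      qed
      ultimately show ?thesis unfolding b alg2[OF E] by blast
    qed
  qed
  show ?thesis
    using p
  proof (rule poly3_less_closed_induct)
    fix \<alpha> :: "3 \<Rightarrow> nat" assume \<alpha>: "sum \<alpha> UNIV < Suc n"
    then have "U (\<lambda>y. poly (monom 1 (\<alpha> 3)) (y $ 3) * (Re (1 * plane y ^ 0 * cnj (plane y) ^ 0) * (y $ 1) ^ \<alpha> 1 * (y $ 2) ^ \<alpha> 2))"
      by (intro step3) (simp add: degree_monom_eq sum_3)
    moreover have "poly (monom 1 (\<alpha> 3)) (y $ 3) * (Re (1 * plane y ^ 0 * cnj (plane y) ^ 0) * (y $ 1) ^ \<alpha> 1 * (y $ 2) ^ \<alpha> 2) =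
        (\<Prod>i\<in>UNIV. y $ i ^ \<alpha> i)" for y
      by (simp add: poly_monom prod_UNIV_3 mult_ac)
    ultimately show "U (\<lambda>x. \<Prod>i\<in>UNIV. x $ i ^ \<alpha> i)" by (simp only:)
  qed (use add scale zero in auto)
qed

lemma sum_cis_nodes:
  fixes q :: int
  assumes q: "even q" "\<bar>q\<bar> \<le> 4 * int m"
  shows "(\<Sum>\<nu>\<le>2 * m. cis (real_of_int q * (2 * real \<nu> * pi / (2 * real m + 1)))) =
    (if q = 0 then 2 * of_nat m + 1 else 0)"
proof (cases "q = 0")
  case False
  define N where "N = 2 * real m + 1"
  have N: "N > 0" by (simp add: N_def add_nonneg_pos)
  define x where "x = cis (2 * pi * real_of_int q / N)"
  have "x \<noteq> 1"
  proof
    assume "x = 1"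
    then have "cos (2 * pi * real_of_int q / N) = 1" by (simp add: x_def complex_eq_iff)
    then obtain k :: int where "2 * pi * real_of_int q / N = real_of_int k * (2 * pi)"
      by (auto simp: cos_one_2pi_int)
    then have "real_of_int q = real_of_int k * N" using N by (simp add: field_simps)
    also have "N = real_of_int (2 * int m + 1)" by (simp add: N_def)
    finally have qk: "q = k * (2 * int m + 1)" by (metis of_int_eq_iff of_int_mult)
    \<comment> \<open>As 2 m + 1 is odd, k inherits the parity of q; a nonzero q would then have
      modulus at least 4 m + 2.\<close>
    then have "even k" using q(1) by simp
    then obtain e where e: "k = 2 * e" by (rule evenE)
    have "e \<noteq> 0" using qk e False by auto
    then have "\<bar>e\<bar> \<ge> 1" by simp
    then have "\<bar>q\<bar> \<ge> 2 * (2 * int m + 1)"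
      using mult_left_mono[of 1 "\<bar>e\<bar>" "2 * (2 * int m + 1)"]
      unfolding qk e abs_mult by (simp add: mult_ac)
    then show False using q(2) by simp
  qed
  have "x ^ (2 * m + 1) = 1"
  proof -
    have "x ^ (2 * m + 1) = cis (real (2 * m + 1) * (2 * pi * real_of_int q / N))"
      unfolding x_def by (rule Complex.DeMoivre)
    also have "real (2 * m + 1) = N" by (simp add: N_def)
    also have "N * (2 * pi * real_of_int q / N) = 2 * pi * real_of_int q"
      using N by simp
    finally show ?thesis by (simp add: cis_multiple_2pi)
  qed
  have "(\<Sum>\<nu>\<le>2 * m. cis (real_of_int q * (2 * real \<nu> * pi / (2 * real m + 1)))) = (\<Sum>\<nu>\<le>2 * m. x ^ \<nu>)"
  proof (intro sum.cong refl)
    fix \<nu>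
    have "x ^ \<nu> = cis (real \<nu> * (2 * pi * real_of_int q / N))"
      unfolding x_def by (rule Complex.DeMoivre)
    then show "cis (real_of_int q * (2 * real \<nu> * pi / (2 * real m + 1))) = x ^ \<nu>"
      by (simp add: N_def mult_ac)
  qed
  also have "\<dots> = (\<Sum>\<nu><2 * m + 1. x ^ \<nu>)" by (simp add: lessThan_Suc_atMost)
  also have "\<dots> = (x ^ (2 * m + 1) - 1) / (x - 1)"
    using \<open>x \<noteq> 1\<close> by (rule geometric_sum)
  finally show ?thesis using \<open>x ^ (2 * m + 1) = 1\<close> False by simp
qed simp

text \<open>Product formulas leave the frequencies j - j' and j + j'. The condition \<epsilon> \<le>
  j rules out the sine of frequency 0, so the sum frequency is nonzero when both factors are sines.
  For j = j' = 0 both frequencies vanish, hence 1 in place of 1/2.\<close>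

lemma sum_trig_nodes:
  assumes j: "j \<le> 2 * m" "j' \<le> 2 * m" "even (j + j')" and \<epsilon>: "\<epsilon> \<le> 1" "\<epsilon>' \<le> 1" "\<epsilon> \<le> j" "\<epsilon>' \<le> j'"
  shows "(\<Sum>\<nu>\<le>2 * m. trig j \<epsilon> (2 * real \<nu> * pi / (2 * real m + 1)) * trig j' \<epsilon>' (2 * real \<nu> * pi / (2 * real m + 1))) =
    (if j = j' \<and> \<epsilon> = \<epsilon>' then (2 * real m + 1) * (if j > 0 then 1/2 else 1) else 0)"
proof -
  define \<psi> where "\<psi> \<nu> = 2 * real \<nu> * pi / (2 * real m + 1)" for \<nu>
  have S: "(\<Sum>\<nu>\<le>2 * m. cos (real_of_int q * \<psi> \<nu>)) = (if q = 0 then 2 * real m + 1 else 0)"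
    "(\<Sum>\<nu>\<le>2 * m. sin (real_of_int q * \<psi> \<nu>)) = 0" if "even q" "\<bar>q\<bar> \<le> 4 * int m" for q
    using arg_cong[OF sum_cis_nodes[OF that], of Re] arg_cong[OF sum_cis_nodes[OF that], of Im]
    by (auto simp: \<psi>_def split: if_splits)
  have d: "even (int j - int j')" "\<bar>int j - int j'\<bar> \<le> 4 * int m" "even (int j + int j')" "\<bar>int j + int j'\<bar> \<le> 4 * int m"
    using j by auto
  note S' = S[OF d(1,2)] S[OF d(3,4)]
  consider "\<epsilon> = 0" "\<epsilon>' = 0" | "\<epsilon> = 1" "\<epsilon>' = 0" | "\<epsilon> = 0" "\<epsilon>' = 1" | "\<epsilon> = 1" "\<epsilon>' = 1"
    using \<epsilon> by linarith
  then have "(\<Sum>\<nu>\<le>2 * m. trig j \<epsilon> (\<psi> \<nu>) * trig j' \<epsilon>' (\<psi> \<nu>)) =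
    (if j = j' \<and> \<epsilon> = \<epsilon>' then (2 * real m + 1) * (if j > 0 then 1/2 else 1) else 0)"
  proof cases
    case 1
    have "(\<Sum>\<nu>\<le>2 * m. trig j \<epsilon> (\<psi> \<nu>) * trig j' \<epsilon>' (\<psi> \<nu>)) =
       ((\<Sum>\<nu>\<le>2 * m. cos (real_of_int (int j - int j') * \<psi> \<nu>)) + (\<Sum>\<nu>\<le>2 * m. cos (real_of_int (int j + int j') * \<psi> \<nu>))) / 2"
      unfolding sum.distrib[symmetric] sum_divide_distrib
      by (intro sum.cong) (auto simp: trig_def 1 cos_times_cos left_diff_distrib distrib_right)
    then show ?thesis unfolding S' using 1 by auto
  next
    case 2
    have "(\<Sum>\<nu>\<le>2 * m. trig j \<epsilon> (\<psi> \<nu>) * trig j' \<epsilon>' (\<psi> \<nu>)) =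
       ((\<Sum>\<nu>\<le>2 * m. sin (real_of_int (int j + int j') * \<psi> \<nu>)) + (\<Sum>\<nu>\<le>2 * m. sin (real_of_int (int j - int j') * \<psi> \<nu>))) / 2"
      unfolding sum.distrib[symmetric] sum_divide_distrib
      by (intro sum.cong) (auto simp: trig_def 2 sin_times_cos left_diff_distrib distrib_right)
    then show ?thesis unfolding S' using 2 by auto
  next
    case 3
    have "(\<Sum>\<nu>\<le>2 * m. trig j \<epsilon> (\<psi> \<nu>) * trig j' \<epsilon>' (\<psi> \<nu>)) =
       ((\<Sum>\<nu>\<le>2 * m. sin (real_of_int (int j + int j') * \<psi> \<nu>)) - (\<Sum>\<nu>\<le>2 * m. sin (real_of_int (int j - int j') * \<psi> \<nu>))) / 2"
      unfolding sum_subtractf[symmetric] sum_divide_distrib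
      by (intro sum.cong) (auto simp: trig_def 3 cos_times_sin left_diff_distrib distrib_right)
    then show ?thesis unfolding S' using 3 by auto
  next
    case 4
    have "(\<Sum>\<nu>\<le>2 * m. trig j \<epsilon> (\<psi> \<nu>) * trig j' \<epsilon>' (\<psi> \<nu>)) =
       ((\<Sum>\<nu>\<le>2 * m. cos (real_of_int (int j - int j') * \<psi> \<nu>)) - (\<Sum>\<nu>\<le>2 * m. cos (real_of_int (int j + int j') * \<psi> \<nu>))) / 2"
      unfolding sum_subtractf[symmetric] sum_divide_distrib
      by (intro sum.cong) (auto simp: trig_def 4 sin_times_sin left_diff_distrib distrib_right)
    then show ?thesis unfolding S' using 4 \<epsilon> by auto
  qed
  then show ?thesis by (simp add: \<psi>_def)
qed

text \<open>The factor 1/2 or 1 is the mean square of the trigonometric part and cancels d_{i,k} in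
  \<open>disk_norm\<close>. The rest is the Jacobi value at 1 against Pochhammer symbols, split by
  (a)_(j+i) = (a)_j (a + j)_i.\<close>

lemma disk_lambda_normalization:
  assumes \<mu>: "\<mu> \<ge> 0" and i: "2 * i \<le> k"
  shows "disk_lambda \<mu> k i * (disk_norm \<mu> k i * poly (jacobi (\<mu> - 1/2) (real (k - 2 * i)) i) 1)\<^sup>2 *
    (if 2 * i < k then 1/2 else 1) = 1"
proof -
  define j where "j = k - 2 * i"
  have k: "k = j + 2 * i" using i by (simp add: j_def)
  define d :: real where "d = (if 2 * i < k then 1/2 else 1)"
  have d: "d > 0" by (simp add: d_def)
  define g where "g = pochhammer (\<mu> + 3/2) j / fact j"
  have "Gamma (real j + \<mu> + 3/2) / (Gamma (\<mu> + 3/2) * Gamma (real j + 1)) = g"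
    unfolding g_def using \<mu> by (simp add: pochhammer_Gamma pos_not_nonpos_Ints Gamma_fact add_ac)
  then have dn: "(disk_norm \<mu> k i)\<^sup>2 = g / d"
    unfolding disk_norm_def j_def[symmetric] d_def[symmetric]
    using d \<mu> by (subst real_sqrt_pow2) (auto simp: g_def intro!: mult_nonneg_nonneg divide_nonneg_nonneg pochhammer_nonneg)
  have p1: "(poly (jacobi (\<mu> - 1/2) (real j) i) 1)\<^sup>2 =
    pochhammer (\<mu> + 1/2) i * pochhammer (\<mu> + 3/2 + real j) i * (\<mu> + 1/2 + real k) /
    (fact i * pochhammer (real j + 1) i * (\<mu> + 1/2 + real (k - i)))"
    using poly_jacobi_1_squared[of "\<mu> - 1/2" "real j" i] \<mu> k by (simp add: algebra_simps)
  have f1: "pochhammer (real j + 1) i = fact (k - i) / fact j"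
  proof -
    have "fact (j + i) = (fact j * pochhammer (1 + real j) i :: real)"
      using pochhammer_product'[of "1::real" j i] by (simp add: pochhammer_fact)
    moreover have "k - i = j + i" using k by simp
    ultimately show ?thesis by (simp add: add.commute)
  qed
  have f2: "pochhammer (\<mu> + 3/2) (k - i) = pochhammer (\<mu> + 3/2) j * pochhammer (\<mu> + 3/2 + real j) i"
  proof -
    have "k - i = j + i" using k by simp
    then show ?thesis using pochhammer_product'[of "\<mu> + 3/2" j i] by (simp only:)
  qed
  have pos: "pochhammer (\<mu> + 3/2) j > 0" "pochhammer (\<mu> + 3/2 + real j) i > 0" "pochhammer (\<mu> + 1/2) i > 0"
    "\<mu> + 1/2 + real k > 0" "\<mu> + 1/2 + real (k - i) > 0"
    using \<mu> by (auto intro!: pochhammer_pos)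
  have "disk_lambda \<mu> k i * (g / d) * (pochhammer (\<mu> + 1/2) i * pochhammer (\<mu> + 3/2 + real j) i * (\<mu> + 1/2 + real k) /
    (fact i * (fact (k - i) / fact j) * (\<mu> + 1/2 + real (k - i)))) * d = 1"
    unfolding disk_lambda_def f2 g_def using pos d by (simp add: divide_simps) (simp add: add_ac)
  then show ?thesis
    unfolding power_mult_distrib dn j_def[symmetric] p1 f1 d_def[symmetric] by (simp only: mult_ac)
qed

lemma disk_quadrature:
  assumes \<mu>: "\<mu> \<ge> 0" and k: "k \<le> 2 * m" and I: "(i, \<epsilon>) \<in> disk_index k" "(i', \<epsilon>') \<in> disk_index k"
    and \<phi>: "\<And>\<nu>. \<nu> \<le> 2 * m \<Longrightarrow> \<phi> \<nu> = 2 * real \<nu> * pi / (2 * real m + 1)"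
  shows "(\<Sum>\<nu>\<le>2 * m. disk_lambda \<mu> k i / (2 * real m + 1) * disk_basis \<mu> k i \<epsilon> (cos (\<phi> \<nu>)) (sin (\<phi> \<nu>)) *
     disk_basis \<mu> k i' \<epsilon>' (cos (\<phi> \<nu>)) (sin (\<phi> \<nu>))) = (if (i, \<epsilon>) = (i', \<epsilon>') then 1 else 0)"
proof -
  define D where "D i = disk_norm \<mu> k i * poly (jacobi (\<mu> - 1/2) (real (k - 2 * i)) i) 1" for i
  have "(\<Sum>\<nu>\<le>2 * m. disk_lambda \<mu> k i / (2 * real m + 1) * disk_basis \<mu> k i \<epsilon> (cos (\<phi> \<nu>)) (sin (\<phi> \<nu>)) *
     disk_basis \<mu> k i' \<epsilon>' (cos (\<phi> \<nu>)) (sin (\<phi> \<nu>))) =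
     disk_lambda \<mu> k i / (2 * real m + 1) * D i * D i' * (\<Sum>\<nu>\<le>2 * m.
       trig (k - 2 * i) \<epsilon> (2 * real \<nu> * pi / (2 * real m + 1)) * trig (k - 2 * i') \<epsilon>' (2 * real \<nu> * pi / (2 * real m + 1)))"
    unfolding sum_distrib_left disk_basis_circle D_def[symmetric]
    by (intro sum.cong) (auto simp: \<phi>)
  also have "(\<Sum>\<nu>\<le>2 * m. trig (k - 2 * i) \<epsilon> (2 * real \<nu> * pi / (2 * real m + 1)) *
      trig (k - 2 * i') \<epsilon>' (2 * real \<nu> * pi / (2 * real m + 1))) =
      (if k - 2 * i = k - 2 * i' \<and> \<epsilon> = \<epsilon>' then (2 * real m + 1) * (if k - 2 * i > 0 then 1/2 else 1) else 0)"
    using k I by (intro sum_trig_nodes) (auto simp: disk_index_def)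
  \<comment> \<open>For fixed k the frequency determines i, since 2 i \<le> k prevents truncation in
    the subtraction.\<close>
  also have "(k - 2 * i = k - 2 * i' \<and> \<epsilon> = \<epsilon>') \<longleftrightarrow> (i, \<epsilon>) = (i', \<epsilon>')"
    using I by (auto simp: disk_index_def)
  also have "disk_lambda \<mu> k i / (2 * real m + 1) * D i * D i' *
      (if (i, \<epsilon>) = (i', \<epsilon>') then (2 * real m + 1) * (if k - 2 * i > 0 then 1/2 else 1) else 0) =
      (if (i, \<epsilon>) = (i', \<epsilon>') then disk_lambda \<mu> k i * (D i)\<^sup>2 * (if k - 2 * i > 0 then 1/2 else 1) else 0)"
  proof -
    have "2 * real m + 1 \<noteq> 0" by (simp add: add_nonneg_eq_0_iff)
    then have "a / (2 * real m + 1) * d * d * ((2 * real m + 1) * e) = a * d\<^sup>2 * e" for a d e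
      by (simp add: power2_eq_square)
    then show ?thesis by auto
  qed
  also have "disk_lambda \<mu> k i * (D i)\<^sup>2 * (if k - 2 * i > 0 then 1/2 else 1) = 1"
    using disk_lambda_normalization[OF \<mu>, of i k] I unfolding D_def by (simp add: disk_index_def)
  finally show ?thesis .
qed

section \<open>Normalizing constants\<close>

text \<open>Legendre's duplication formula, applied over the complex numbers and read back on the
  reals, turns 2^(2 \<alpha> + 1) B(\<alpha> + 1, \<alpha> + 1) into a quotient of Gamma values that
  telescopes in products.\<close>

lemma jint_symmetric_weight:
  assumes "\<alpha> > -1"
  shows "jint \<alpha> \<alpha> 1 = sqrt pi * Gamma (\<alpha> + 1) / Gamma (\<alpha> + 3/2)"
proof -
  let ?z = "\<alpha> + 1"
  have n1: "?z \<notin> \<int>\<^sub>\<le>\<^sub>0" and n2: "?z + 1/2 \<notin> \<int>\<^sub>\<le>\<^sub>0"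
    using assms by (auto intro!: pos_not_nonpos_Ints)
  have c0: "complex_of_real ?z + 1/2 = complex_of_real (?z + 1/2)" by simp
  have c1: "2 * complex_of_real ?z = complex_of_real (2 * ?z)" by simp
  have c2: "(1 - complex_of_real (2 * ?z)) * of_real (ln 2) = complex_of_real ((1 - 2 * ?z) * ln 2)" by simp
  have "complex_of_real (Gamma ?z * Gamma (?z + 1/2)) = Gamma (complex_of_real ?z) * Gamma (complex_of_real ?z + 1/2)"
    by (simp only: c0 of_real_mult Gamma_complex_of_real)
  also have "\<dots> = exp ((1 - 2 * complex_of_real ?z) * of_real (ln 2)) * of_real (sqrt pi) * Gamma (2 * complex_of_real ?z)"
    using n1 n2
    by (intro Gamma_legendre_duplication) (simp_all only: c0 of_real_in_nonpos_Ints_iff simp_thms)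
  also have "\<dots> = complex_of_real (exp ((1 - 2 * ?z) * ln 2) * sqrt pi * Gamma (2 * ?z))"
    unfolding c1 c2 exp_of_real Gamma_complex_of_real by (simp only: of_real_mult)
  finally have "complex_of_real (Gamma ?z * Gamma (?z + 1/2)) =
      complex_of_real (exp ((1 - 2 * ?z) * ln 2) * sqrt pi * Gamma (2 * ?z))" .
  then have "Gamma ?z * Gamma (?z + 1/2) = exp ((1 - 2 * ?z) * ln 2) * sqrt pi * Gamma (2 * ?z)"
    by (simp only: of_real_eq_iff)
  also have "exp ((1 - 2 * ?z) * ln 2) = 2 powr (1 - 2 * ?z)" by (simp add: powr_def)
  finally have L: "Gamma ?z * Gamma (\<alpha> + 3/2) = 2 powr (1 - 2 * ?z) * sqrt pi * Gamma (2 * ?z)"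
    by (simp add: add_ac)
  have pos: "Gamma (\<alpha> + 3/2) > 0" "Gamma (2 * ?z) > 0"
    using assms by (auto intro!: Gamma_real_pos)
  have "2 powr (\<alpha> + \<alpha> + 1) * 2 powr (1 - 2 * ?z) = (1 :: real)"
    by (simp flip: powr_add)
  then have "2 powr (\<alpha> + \<alpha> + 1) * (Gamma ?z * Gamma (\<alpha> + 3/2)) = sqrt pi * Gamma (2 * ?z)"
    unfolding L by (simp flip: mult.assoc)
  then have "2 powr (\<alpha> + \<alpha> + 1) * (Gamma ?z * Gamma ?z / Gamma (2 * ?z)) = sqrt pi * Gamma ?z / Gamma (\<alpha> + 3/2)"
    using pos by (simp add: field_simps)
  moreover have "jint \<alpha> \<alpha> 1 = 2 powr (\<alpha> + \<alpha> + 1) * Beta ?z ?z"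
    using jint_powers[OF assms assms, of 0 0] by simp
  moreover have "?z + ?z = 2 * ?z" by simp
  ultimately show ?thesis unfolding Beta_def by metis
qed

text \<open>The three integrals belong to the chord variable, to t and to w. Their Gamma quotients
  telescope; \<open>ball_const \<mu>\<close> then leaves (\<mu> + 3/2)_k / (\<mu> + 2)_k, which is 1
  / h_k^2.\<close>

lemma ball_normalization:
  assumes \<mu>: "\<mu> \<ge> 0"
  shows "ball_const \<mu> * (pochhammer (\<mu> + 2) k / pochhammer (\<mu> + 3/2) k) * jint (\<mu> - 1/2) (\<mu> - 1/2) 1 * jint \<mu> \<mu> 1 *
    jint (real k + \<mu> + 1/2) (real k + \<mu> + 1/2) 1 = 1"
proof -
  have pos: "Gamma (\<mu> + 1/2) > 0" "Gamma (\<mu> + 1) > 0" "Gamma (\<mu> + 3/2) > 0" "Gamma (\<mu> + 2) > 0"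
    "Gamma (real k + \<mu> + 3/2) > 0" "Gamma (real k + \<mu> + 2) > 0"
    using \<mu> by (auto intro!: Gamma_real_pos)
  have j: "jint (\<mu> - 1/2) (\<mu> - 1/2) 1 = sqrt pi * Gamma (\<mu> + 1/2) / Gamma (\<mu> + 1)"
    "jint \<mu> \<mu> 1 = sqrt pi * Gamma (\<mu> + 1) / Gamma (\<mu> + 3/2)"
    "jint (real k + \<mu> + 1/2) (real k + \<mu> + 1/2) 1 = sqrt pi * Gamma (real k + \<mu> + 3/2) / Gamma (real k + \<mu> + 2)"
    using \<mu> by (subst jint_symmetric_weight; simp add: add_ac)+
  have p: "pochhammer (\<mu> + 2) k = Gamma (real k + \<mu> + 2) / Gamma (\<mu> + 2)"
    "pochhammer (\<mu> + 3/2) k = Gamma (real k + \<mu> + 3/2) / Gamma (\<mu> + 3/2)"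
    using \<mu> by (simp_all add: pochhammer_Gamma pos_not_nonpos_Ints add_ac)
  have "pi powr (3/2) = sqrt pi * sqrt pi * sqrt pi"
  proof -
    have "pi powr (3/2) = pi powr (1/2 + 1/2 + 1/2)" by simp
    also have "\<dots> = sqrt pi * sqrt pi * sqrt pi" by (simp only: powr_add powr_half_sqrt pi_ge_zero)
    finally show ?thesis .
  qed
  then show ?thesis unfolding ball_const_def j p using pos by (simp add: field_simps)
qed

section \<open>Weighted integrals over the ball\<close>

lemma measurable_ball_weight [measurable]: "ball_weight \<mu> \<in> borel_measurable borel"
  unfolding ball_weight_def[abs_def] by measurable

lemma ball_weight_nonneg: "ball_weight \<mu> y \<ge> 0"
  by (simp add: ball_weight_def)

lemma measurable_indicator_cball [measurable]:
  "indicat_real (cball (0 :: real ^ 3) 1) \<in> borel_measurable borel"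
  by (intro borel_measurable_indicator) simp

text \<open>On a horizontal line at distance t < 1 from the center, the weight integrates to
  \<open>\<gamma>\<close> (1 - t^2)^\<mu>, which is at most \<open>\<gamma>\<close>, even where the
  weight is unbounded. Tonelli over a square in (p, w) gives finiteness.\<close>

lemma integrable_ball_weight:
  assumes \<mu>: "\<mu> \<ge> 0"
  shows "integrable lborel (\<lambda>y. indicator (cball 0 1) y * ball_weight \<mu> y)"
proof (rule integrableI_nonneg)
  define h :: "real ^ 3 \<Rightarrow> real" where "h y = indicator (cball 0 1) y * ball_weight \<mu> y" for y
  define \<gamma> where "\<gamma> = jint (\<mu> - 1/2) (\<mu> - 1/2) 1"
  have \<gamma>: "\<gamma> > 0" unfolding \<gamma>_def using \<mu> by (intro jint_1_pos) auto
  have hm [measurable]: "h \<in> borel_measurable borel" unfolding h_def[abs_def] by measurable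
  have inner: "(\<integral>\<^sup>+q. h (vector [p, q, w]) \<partial>lborel) \<le> ennreal \<gamma> * indicator {-1..1} p * indicator {-1..1} w" for p w
  proof -
    define t where "t = sqrt (w\<^sup>2 + p\<^sup>2)"
    have t2: "t\<^sup>2 = w\<^sup>2 + p\<^sup>2" by (simp add: t_def)
    have n: "(norm (vector [p, q, w] :: real ^ 3))\<^sup>2 = t\<^sup>2 + q\<^sup>2" for q
      by (simp add: norm_vec3 t2)
    have hq: "h (vector [p, q, w]) = slice_fun \<mu> (\<lambda>t s. t ^ 0 * s ^ 0) t q" for q
    proof (cases "t\<^sup>2 + q\<^sup>2 < 1")
      case True
      then have "(norm (vector [p, q, w] :: real ^ 3))\<^sup>2 \<le> 1" unfolding n by simp
      then have "norm (vector [p, q, w] :: real ^ 3) \<le> 1"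
        unfolding abs_square_le_1 by simp
      then show ?thesis using True Complex_in_ball[of t q]
        by (simp add: h_def slice_fun_def ball_weight_def n algebra_simps)
    next
      case False
      have "Complex t q \<notin> ball 0 1" using False Complex_in_ball by blast
      moreover have "h (vector [p, q, w]) = 0"
      proof (cases "t\<^sup>2 + q\<^sup>2 = 1")
        case False
        then have "(norm (vector [p, q, w] :: real ^ 3))\<^sup>2 > 1" using \<open>\<not> t\<^sup>2 + q\<^sup>2 < 1\<close> n[of q] by linarith
        then have "\<not> norm (vector [p, q, w] :: real ^ 3) \<le> 1"
          by (metis norm_ge_zero not_le power_le_one_iff)
        then show ?thesis by (simp add: h_def)
      qed (simp add: h_def ball_weight_def n)
      ultimately show ?thesis by (simp add: slice_fun_def)
    qed
    show ?thesis
    proof (cases "t < 1")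
      case True
      have "t \<ge> 0" by (simp add: t_def)
      with True have at: "\<bar>t\<bar> < 1" by simp
      obtain A where A: "degree A \<le> 0 + 0" "poly A 1 = \<gamma> * (1 ^ 0 * 0 ^ 0)"
        "integrable lborel (slice_fun \<mu> (\<lambda>t s. t ^ 0 * s ^ 0) t)"
        "(LINT s|lborel. slice_fun \<mu> (\<lambda>t s. t ^ 0 * s ^ 0) t s) = (1 - t\<^sup>2) powr \<mu> * poly A t"
        using slice_poly_monomial[OF \<mu>, of 0 0] at unfolding slice_poly_def \<gamma>_def by blast
      \<comment> \<open>A constant polynomial has at t the value prescribed at 1.\<close>
      have "degree A = 0" using A(1) by simp
      then obtain a where "A = [:a:]" by (rule degree_eq_zeroE)
      then have At: "poly A t = \<gamma>" using A(2) by simp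
      have "(\<integral>\<^sup>+q. h (vector [p, q, w]) \<partial>lborel) = ennreal ((1 - t\<^sup>2) powr \<mu> * \<gamma>)"
      proof -
        have "(\<integral>\<^sup>+q. slice_fun \<mu> (\<lambda>t s. t ^ 0 * s ^ 0) t q \<partial>lborel) =
            ennreal (LINT s|lborel. slice_fun \<mu> (\<lambda>t s. t ^ 0 * s ^ 0) t s)"
          by (rule nn_integral_eq_integral[OF A(3)]) (auto simp: slice_fun_def)
        then show ?thesis unfolding hq A(4) At .
      qed
      also have "\<dots> \<le> ennreal \<gamma>"
      proof (intro ennreal_leI)
        have "t\<^sup>2 \<le> 1" using at by (simp add: abs_square_le_1)
        then have "(1 - t\<^sup>2) powr \<mu> \<le> 1" using \<mu> by (intro powr_le1) auto
        then show "(1 - t\<^sup>2) powr \<mu> * \<gamma> \<le> \<gamma>" using \<gamma> by (simp add: mult_left_le_one_le)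
      qed
      also have "ennreal \<gamma> = ennreal \<gamma> * indicator {-1..1} p * indicator {-1..1} w"
      proof -
        have "w\<^sup>2 + p\<^sup>2 < 1" using t2 at by (metis abs_square_less_1)
        then have "w\<^sup>2 < 1" "p\<^sup>2 < 1" using zero_le_power2[of w] zero_le_power2[of p] by linarith+
        then have "\<bar>w\<bar> < 1" "\<bar>p\<bar> < 1" by (simp_all add: abs_square_less_1)
        then show ?thesis by (auto simp: indicator_def)
      qed
      finally show ?thesis .
    next
      case False
      then have "t\<^sup>2 \<ge> 1" by (simp add: one_le_power)
      then have "slice_fun \<mu> (\<lambda>t s. t ^ 0 * s ^ 0) t q = 0" for q
        using Complex_in_ball[of t q] zero_le_power2[of q] by (auto simp: slice_fun_def indicator_def)
      then show ?thesis by (simp add: hq)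
    qed
  qed
  note m = measurable_vec3_triple
  have m' [measurable]: "(\<lambda>(w, p, q). vector [p, q, w] :: real ^ 3) \<in> borel \<Otimes>\<^sub>M (borel \<Otimes>\<^sub>M borel) \<rightarrow>\<^sub>M borel"
    using m by (simp add: borel_prod)
  have "(\<integral>\<^sup>+y. h y \<partial>lborel) = (\<integral>\<^sup>+z. h ((\<lambda>(w, p, q). vector [p, q, w]) z) \<partial>(lborel :: (real \<times> real \<times> real) measure))"
    using m by (subst lborel_eq_distr_vec3) (subst nn_integral_distr, auto)
  also have "\<dots> = (\<integral>\<^sup>+w. \<integral>\<^sup>+z. h ((\<lambda>(w, p, q). vector [p, q, w]) (w, z)) \<partial>(lborel :: (real \<times> real) measure) \<partial>lborel)"
  proof -
    have "(\<lambda>z. ennreal (h ((\<lambda>(w, p, q). vector [p, q, w]) z))) \<in> borel_measurable (lborel \<Otimes>\<^sub>M lborel)"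
      unfolding lborel_prod by (rule measurable_compose[OF m]) simp
    from lborel.nn_integral_fst[OF this] show ?thesis unfolding lborel_prod by (rule sym)
  qed
  also have "\<dots> = (\<integral>\<^sup>+w. \<integral>\<^sup>+p. \<integral>\<^sup>+q. h (vector [p, q, w]) \<partial>lborel \<partial>lborel \<partial>lborel)"
  proof (rule nn_integral_cong)
    fix w
    have [measurable]: "(\<lambda>z. h ((\<lambda>(w, p, q). vector [p, q, w]) (w, z))) \<in> borel_measurable (borel \<Otimes>\<^sub>M borel)"
      by measurable
    show "(\<integral>\<^sup>+z. h ((\<lambda>(w, p, q). vector [p, q, w]) (w, z)) \<partial>(lborel :: (real \<times> real) measure)) =
       (\<integral>\<^sup>+p. \<integral>\<^sup>+q. h (vector [p, q, w]) \<partial>lborel \<partial>lborel)"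
      unfolding lborel_prod[symmetric, where ?'b = real]
      by (subst lborel.nn_integral_fst[symmetric]) (auto cong: measurable_cong_sets)
  qed
  also have "\<dots> \<le> (\<integral>\<^sup>+w. \<integral>\<^sup>+p. ennreal \<gamma> * indicator {-1..1} p * indicator {-1..1} w \<partial>(lborel :: real measure) \<partial>(lborel :: real measure))"
    by (rule nn_integral_mono, rule nn_integral_mono, rule inner)
  also have "\<dots> = (\<integral>\<^sup>+w. ennreal \<gamma> * 2 * indicator {-1..1} w \<partial>(lborel :: real measure))"
    by (simp add: nn_integral_cmult nn_integral_multc mult.assoc)
  also have "\<dots> = ennreal \<gamma> * 2 * 2"
    by (simp add: nn_integral_cmult)
  also have "\<dots> < \<infinity>" by (simp add: ennreal_mult_less_top)
  finally show "(\<integral>\<^sup>+y. ennreal (indicator (cball 0 1) y * ball_weight \<mu> y) \<partial>lborel) < \<infinity>"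
    by (simp add: h_def)
qed (auto simp: ball_weight_nonneg)

text \<open>Integrability against the weight is what makes every pairing with a polynomial
  finite.\<close>

definition ball_L1 :: "real \<Rightarrow> (real ^ 3 \<Rightarrow> real) \<Rightarrow> bool" where
  "ball_L1 \<mu> f \<longleftrightarrow> set_integrable lebesgue (cball 0 1) (\<lambda>y. f y * ball_weight \<mu> y)"

lemma set_integrable_ball_weight: "\<mu> \<ge> 0 \<Longrightarrow> set_integrable lebesgue (cball 0 1) (ball_weight \<mu>)"
  unfolding set_integrable_def using integrable_ball_weight[of \<mu>]
  by (subst integrable_completion) auto

text \<open>Uses |f| \<le> 1 + f^2 and the finite mass of the weight.\<close>

lemma ball_L2_imp_L1:
  assumes \<mu>: "\<mu> \<ge> 0" and f: "f \<in> ball_L2 \<mu>"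
  shows "ball_L1 \<mu> f"
  unfolding ball_L1_def set_integrable_def
proof (rule Bochner_Integration.integrable_bound)
  show "integrable lebesgue (\<lambda>y. indicator (cball 0 1) y *\<^sub>R (ball_weight \<mu> y) +
      indicator (cball 0 1) y *\<^sub>R ((f y)\<^sup>2 * ball_weight \<mu> y))"
  proof (rule Bochner_Integration.integrable_add)
    show "integrable lebesgue (\<lambda>y. indicator (cball 0 1) y *\<^sub>R (ball_weight \<mu> y))"
      using set_integrable_ball_weight[OF \<mu>] unfolding set_integrable_def .
    show "integrable lebesgue (\<lambda>y. indicator (cball 0 1) y *\<^sub>R ((f y)\<^sup>2 * ball_weight \<mu> y))"
      using f unfolding ball_L2_def set_integrable_def by simp
  qed
  have "(\<lambda>y. indicator (cball 0 1) y *\<^sub>R f y) \<in> borel_measurable lebesgue"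
    using f unfolding ball_L2_def by (subst borel_measurable_restrict_space_iff[symmetric]) simp_all
  moreover have "ball_weight \<mu> \<in> borel_measurable lebesgue" by (rule measurable_completion) simp
  ultimately have "(\<lambda>y. indicator (cball 0 1) y *\<^sub>R f y * ball_weight \<mu> y) \<in> borel_measurable lebesgue"
    by (rule borel_measurable_times)
  then show "(\<lambda>y. indicator (cball 0 1) y *\<^sub>R (f y * ball_weight \<mu> y)) \<in> borel_measurable lebesgue"
    by (simp add: mult.assoc)
  show "AE y in lebesgue. norm (indicator (cball 0 1) y *\<^sub>R (f y * ball_weight \<mu> y)) \<le>
     norm (indicator (cball 0 1) y *\<^sub>R (ball_weight \<mu> y) + indicator (cball 0 1) y *\<^sub>R ((f y)\<^sup>2 * ball_weight \<mu> y))"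
  proof (rule AE_I2)
    fix y
    have "\<bar>f y\<bar> \<le> 1 + (f y)\<^sup>2"
    proof (cases "\<bar>f y\<bar> \<le> 1")
      case False
      then have "\<bar>f y\<bar> * 1 \<le> \<bar>f y\<bar> * \<bar>f y\<bar>" by (intro mult_left_mono) auto
      then show ?thesis by (simp add: power2_eq_square)
    qed (use zero_le_power2[of "f y"] in linarith)
    then have "\<bar>f y\<bar> * ball_weight \<mu> y \<le> (1 + (f y)\<^sup>2) * ball_weight \<mu> y"
      by (intro mult_right_mono ball_weight_nonneg)
    then have "norm (f y * ball_weight \<mu> y) \<le> norm (ball_weight \<mu> y + (f y)\<^sup>2 * ball_weight \<mu> y)"
      using ball_weight_nonneg[of \<mu> y] by (simp add: abs_mult distrib_right)
    then show "norm (indicator (cball 0 1) y *\<^sub>R (f y * ball_weight \<mu> y)) \<le>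
       norm (indicator (cball 0 1) y *\<^sub>R (ball_weight \<mu> y) + indicator (cball 0 1) y *\<^sub>R ((f y)\<^sup>2 * ball_weight \<mu> y))"
      by (cases "y \<in> cball 0 1") simp_all
  qed
qed

lemma ball_L1_mult:
  assumes "ball_L1 \<mu> f" "continuous_on UNIV g"
  shows "set_integrable lebesgue (cball 0 1) (\<lambda>y. f y * g y * ball_weight \<mu> y)"
proof -
  have g: "continuous_on (cball 0 1) g" using assms(2) by (rule continuous_on_subset) simp
  have "set_integrable lebesgue (cball 0 1) (\<lambda>y. g y * (f y * ball_weight \<mu> y))"
    using assms(1) unfolding ball_L1_def
    by (intro absolutely_integrable_bounded_measurable_product[OF bilinear_times, where f = g and g = "\<lambda>y. f y * ball_weight \<mu> y"]
       continuous_imp_measurable_on_sets_lebesgue[OF g] compact_imp_bounded compact_continuous_image g) auto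
  then show ?thesis by (simp add: mult_ac)
qed

lemma continuous_on_poly3: "p \<in> poly3_less n \<Longrightarrow> continuous_on S p"
  by (intro continuous_on_subset[OF continuous_on_polymonial_function])
     (auto simp: real_polynomial_function_eq[symmetric] intro: real_polynomial_function_poly3)

lemma poly3_less_L1:
  assumes "\<mu> \<ge> 0" "p \<in> poly3_less n"
  shows "ball_L1 \<mu> p"
proof -
  have "ball_L1 \<mu> (\<lambda>_. 1)"
    using set_integrable_ball_weight[OF assms(1)] by (simp add: ball_L1_def)
  from ball_L1_mult[OF this continuous_on_poly3[OF assms(2)]] show ?thesis
    by (simp add: ball_L1_def)
qed

lemma ball_L1_integrable:
  assumes "ball_L1 \<mu> f" "q \<in> poly3_less n"
  shows "set_integrable lebesgue (cball 0 1) (\<lambda>y. f y * q y * ball_weight \<mu> y)"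
  using assms by (intro ball_L1_mult continuous_on_poly3)

lemma ball_inner_commute: "ball_inner \<mu> f g = ball_inner \<mu> g f"
  by (simp add: ball_inner_def mult.commute)

lemma ball_inner_diff_left:
  assumes "ball_L1 \<mu> f" "ball_L1 \<mu> g" "q \<in> poly3_less n"
  shows "ball_inner \<mu> (\<lambda>x. f x - g x) q = ball_inner \<mu> f q - ball_inner \<mu> g q"
  unfolding ball_inner_def left_diff_distrib right_diff_distrib[symmetric]
  using assms by (subst set_integral_diff[OF ball_L1_integrable ball_L1_integrable]) auto

lemma ball_inner_scale_right: "ball_inner \<mu> f (\<lambda>x. c * q x) = c * ball_inner \<mu> f q"
proof -
  have "f x * (c * q x) * ball_weight \<mu> x = c * (f x * q x * ball_weight \<mu> x)" for x by simp
  then show ?thesis unfolding ball_inner_def by (simp only: set_integral_mult_right) simp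
qed

lemma ball_inner_add_right:
  assumes "ball_L1 \<mu> f" "q \<in> poly3_less n" "r \<in> poly3_less n"
  shows "ball_inner \<mu> f (\<lambda>x. q x + r x) = ball_inner \<mu> f q + ball_inner \<mu> f r"
  unfolding ball_inner_def distrib_left distrib_right
  using assms by (subst set_integral_add[OF ball_L1_integrable ball_L1_integrable]) (auto simp: distrib_left)

lemma ball_inner_sum_right:
  assumes "ball_L1 \<mu> f" "\<And>i. i \<in> I \<Longrightarrow> q i \<in> poly3_less n"
  shows "ball_inner \<mu> f (\<lambda>x. \<Sum>i\<in>I. q i x) = (\<Sum>i\<in>I. ball_inner \<mu> f (q i))"
  using assms(2)
proof (induction I rule: infinite_finite_induct)
  case (insert i I)
  then show ?case
    using ball_inner_add_right[OF assms(1), of "q i" n "\<lambda>x. \<Sum>i\<in>I. q i x"] by (simp add: poly3_less_sum)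
qed (simp_all add: ball_inner_def)

section \<open>Radon data and ridge polynomials\<close>

lemma chord_line_nth:
  "chord_line \<theta> t w s $ 1 = t * sqrt (1 - w\<^sup>2) * cos \<theta> - s * sin \<theta>"
  "chord_line \<theta> t w s $ 2 = t * sqrt (1 - w\<^sup>2) * sin \<theta> + s * cos \<theta>"
  "chord_line \<theta> t w s $ 3 = w"
  by (simp_all add: chord_line_def)

lemma norm_chord_line: "(norm (chord_line \<theta> t w s))\<^sup>2 = (t * sqrt (1 - w\<^sup>2))\<^sup>2 + s\<^sup>2 + w\<^sup>2"
  unfolding chord_line_def norm_chord ..

text \<open>The two equations in \<open>chord\<close> hold along the whole parametrized line, so
  membership in the ball is the remaining condition.\<close>

lemma radon_altdef:
  "radon \<mu> \<theta> f t w = (LINT s|lebesgue. indicator (cball 0 1) (chord_line \<theta> t w s) *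
     (f (chord_line \<theta> t w s) * ball_weight \<mu> (chord_line \<theta> t w s)))"
proof -
  have "chord_line \<theta> t w s $ 1 * cos \<theta> + chord_line \<theta> t w s $ 2 * sin \<theta> = t * sqrt (1 - w\<^sup>2)" for s
    using sin_cos_squared_add[of \<theta>] unfolding chord_line_nth by algebra
  then have "chord_line \<theta> t w s \<in> chord \<theta> t w \<longleftrightarrow> chord_line \<theta> t w s \<in> cball 0 1" for s
    by (simp add: chord_def chord_line_nth)
  then show ?thesis
    unfolding radon_def set_lebesgue_integral_def by (simp add: indicator_def)
qed

text \<open>Moments of the Radon data against \<Psi> become ball integrals of f against the
  pull-back g. Points of the ball with |y_3| = 1 lie on the sphere, where \<open>ball_weight\<close>
  is 0.\<close>

lemma radon_integral:
  fixes \<Psi> :: "real \<Rightarrow> real \<Rightarrow> real"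
  assumes f: "ball_L1 \<mu> f" and g: "continuous_on UNIV g"
    and \<Psi>: "(\<lambda>z. \<Psi> (fst z) (snd z)) \<in> borel_measurable (borel \<Otimes>\<^sub>M borel)"
    and eq: "\<And>y. norm y \<le> 1 \<Longrightarrow> \<bar>y $ 3\<bar> < 1 \<Longrightarrow>
      \<Psi> ((y $ 1 * cos \<theta> + y $ 2 * sin \<theta>) / sqrt (1 - (y $ 3)\<^sup>2)) (y $ 3) = g y"
  shows "(LINT w:{-1<..<1}|lebesgue. (LINT t:{-1<..<1}|lebesgue. radon \<mu> \<theta> f t w * \<Psi> t w) * sqrt (1 - w\<^sup>2)) =
    (LINT y:cball 0 1|lebesgue. f y * g y * ball_weight \<mu> y)"
proof -
  define F where "F y = indicator (cball 0 1) y * (f y * ball_weight \<mu> y)" for y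
  have Fint: "integrable lebesgue F"
    using f unfolding ball_L1_def set_integrable_def F_def by simp
  have eq': "F y * \<Psi> ((y $ 1 * cos \<theta> + y $ 2 * sin \<theta>) / sqrt (1 - (y $ 3)\<^sup>2)) (y $ 3) =
      indicator (cball 0 1) y *\<^sub>R (f y * g y * ball_weight \<mu> y)" for y
  proof (cases "norm y \<le> 1 \<and> \<bar>y $ 3\<bar> < 1")
    case True
    then show ?thesis using eq[of y] by (simp add: F_def mult_ac)
  next
    case False
    have "ball_weight \<mu> y = 0" if "norm y \<le> 1"
    proof -
      have "norm y = 1" using that False component_le_norm_cart[of y 3] by linarith
      then show ?thesis by (simp add: ball_weight_def)
    qed
    then have "indicator (cball 0 1) y * ball_weight \<mu> y = 0" by (auto simp: indicator_def)
    then show ?thesis unfolding F_def by auto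
  qed
  have C: "(LINT w:{-1<..<1}|lebesgue. (LINT t:{-1<..<1}|lebesgue.
       (LINT s|lebesgue. F (chord_line \<theta> t w s)) * \<Psi> t w) * sqrt (1 - w\<^sup>2)) =
     (LINT y|lebesgue. F y * \<Psi> ((y $ 1 * cos \<theta> + y $ 2 * sin \<theta>) / sqrt (1 - (y $ 3)\<^sup>2)) (y $ 3))"
  proof (rule chord_integral[OF _ _ \<Psi>])
    show "F \<in> borel_measurable lebesgue" using Fint by auto
    show "integrable lebesgue (\<lambda>y. F y * \<Psi> ((y $ 1 * cos \<theta> + y $ 2 * sin \<theta>) / sqrt (1 - (y $ 3)\<^sup>2)) (y $ 3))"
      unfolding eq' using ball_L1_mult[OF f g] by (simp add: set_integrable_def)
  qed (simp add: F_def)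
  have R: "radon \<mu> \<theta> f t w = (LINT s|lebesgue. F (chord_line \<theta> t w s))" for t w
    by (simp only: radon_altdef F_def)
  have E: "(LINT y|lebesgue. F y * \<Psi> ((y $ 1 * cos \<theta> + y $ 2 * sin \<theta>) / sqrt (1 - (y $ 3)\<^sup>2)) (y $ 3)) =
      (LINT y:cball 0 1|lebesgue. f y * g y * ball_weight \<mu> y)"
    unfolding eq' set_lebesgue_integral_def ..
  show ?thesis unfolding R by (rule trans[OF C E])
qed

text \<open>The pull-back to the ball of the factor of the kernel that depends on t and w;
  \<open>hom_even\<close> makes it a polynomial across the poles.\<close>

definition ball_ridge :: "real \<Rightarrow> nat \<Rightarrow> nat \<Rightarrow> real \<Rightarrow> real ^ 3 \<Rightarrow> real" where
  "ball_ridge \<mu> l k \<xi> y = hom_even k (gegenbauer (\<mu> + 1/2) k) (y $ 1 * cos \<xi> + y $ 2 * sin \<xi>) (1 - (y $ 3)\<^sup>2) *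
     gegenbauer_normed (real k + \<mu> + 1) (l - k) (y $ 3)"

lemma poly3_less_gegenbauer_normed:
  assumes "a > 0"
  shows "(\<lambda>y. gegenbauer_normed a d (y $ 3)) \<in> poly3_less (Suc d)"
proof -
  have "(\<lambda>y. 1 / sqrt (a * pochhammer (2 * a) d / ((real d + a) * fact d)) * poly (gegenbauer a d) (y $ 3)) \<in> poly3_less (Suc d)"
    by (intro poly3_less_scale poly3_less_poly[OF poly3_less_coord]) (simp add: degree_gegenbauer assms)
  then show ?thesis unfolding gegenbauer_normed_def[abs_def] by simp
qed

lemma poly3_less_ball_basis:
  assumes "\<mu> \<ge> 0" "k \<le> l" "(i, \<epsilon>) \<in> disk_index k"
  shows "ball_basis \<mu> l k i \<epsilon> \<in> poly3_less (Suc l)"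
proof -
  have "(\<lambda>y. solid_basis \<mu> k i \<epsilon> y * gegenbauer_normed (real k + \<mu> + 1) (l - k) (y $ 3)) \<in> poly3_less (Suc (k + (l - k)))"
    using assms by (intro poly3_less_mult poly3_less_solid_basis poly3_less_gegenbauer_normed) (auto simp: disk_index_def)
  then show ?thesis using assms(2) by (simp add: ball_basis_def[abs_def])
qed

lemma poly3_less_ball_ridge:
  assumes "\<mu> \<ge> 0" "k \<le> l"
  shows "ball_ridge \<mu> l k \<xi> \<in> poly3_less (Suc l)"
proof -
  have "(\<lambda>y. cos \<xi> * y $ 1 + sin \<xi> * y $ 2) \<in> poly3_less (Suc 1)"
    by (intro poly3_less_add poly3_less_scale poly3_less_coord)
  then have "(\<lambda>y. y $ 1 * cos \<xi> + y $ 2 * sin \<xi>) \<in> poly3_less (Suc 1)" by (simp add: mult.commute)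
  then have "(\<lambda>y. hom_even k (gegenbauer (\<mu> + 1/2) k) (y $ 1 * cos \<xi> + y $ 2 * sin \<xi>) (1 - (y $ 3)\<^sup>2) *
     gegenbauer_normed (real k + \<mu> + 1) (l - k) (y $ 3)) \<in> poly3_less (Suc (k + (l - k)))"
    using assms by (intro poly3_less_mult poly3_less_hom_even poly3_less_vert poly3_less_gegenbauer_normed) auto
  then show ?thesis using assms(2) by (simp add: ball_ridge_def[abs_def])
qed

lemma ball_ridge_eq:
  assumes "\<mu> \<ge> 0" "\<bar>y $ 3\<bar> < 1"
  shows "ball_ridge \<mu> l k \<xi> y = poly (gegenbauer (\<mu> + 1/2) k) ((y $ 1 * cos \<xi> + y $ 2 * sin \<xi>) / sqrt (1 - (y $ 3)\<^sup>2)) *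
     (sqrt (1 - (y $ 3)\<^sup>2) ^ k * gegenbauer_normed (real k + \<mu> + 1) (l - k) (y $ 3))"
proof -
  have "1 - (y $ 3)\<^sup>2 > 0" using assms(2) by (simp add: abs_square_less_1)
  then have "sqrt (1 - (y $ 3)\<^sup>2) ^ k * poly (gegenbauer (\<mu> + 1/2) k) ((y $ 1 * cos \<xi> + y $ 2 * sin \<xi>) / sqrt (1 - (y $ 3)\<^sup>2)) =
      hom_even k (gegenbauer (\<mu> + 1/2) k) (y $ 1 * cos \<xi> + y $ 2 * sin \<xi>) (1 - (y $ 3)\<^sup>2)"
    by (rule hom_even_eq) (use assms(1) in \<open>simp_all add: degree_gegenbauer gegenbauer_parity\<close>)
  from this[symmetric] show ?thesis unfolding ball_ridge_def by (simp only: mult_ac)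
qed

section \<open>Biorthogonality and the projections\<close>

text \<open>Scaling the slice by sqrt (1 - w^2) and rotating it by -\<xi> produces the chord x = t
  of the unit disk; the rotation merely multiplies the angular part by a constant, collected in
  \<open>c\<close>. Hence the data split into a sample on the circle, a function of w and a function
  of t.\<close>

lemma radon_ball_basis:
  assumes \<mu>: "\<mu> \<ge> 0" and w: "\<bar>w\<bar> < 1" and t: "\<bar>t\<bar> < 1" and i: "2 * i \<le> k"
  shows "radon \<mu> \<xi> (ball_basis \<mu> l k i \<epsilon>) t w =
    (disk_basis \<mu> k i \<epsilon> (cos \<xi>) (sin \<xi>) * jint (\<mu> - 1/2) (\<mu> - 1/2) 1) *
    (gegenbauer_normed (real k + \<mu> + 1) (l - k) w * sqrt (1 - w\<^sup>2) ^ k * (1 - w\<^sup>2) powr \<mu>) *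
    ((1 - t\<^sup>2) powr \<mu> * (poly (gegenbauer (\<mu> + 1/2) k) t / poly (gegenbauer (\<mu> + 1/2) k) 1))"
proof -
  let ?\<alpha> = "\<mu> - 1/2"
  define j where "j = k - 2 * i"
  have k: "k = j + 2 * i" using i by (simp add: j_def)
  define r where "r = sqrt (1 - w\<^sup>2)"
  have pos: "1 - w\<^sup>2 > 0" using w by (simp add: abs_square_less_1)
  then have r: "r > 0" and r2: "r\<^sup>2 = 1 - w\<^sup>2" by (simp_all add: r_def)
  define c where "c = trig_unit \<epsilon> * cis (real j * \<xi>)"
  define B where "B = (\<lambda>t s. Re (c * Complex t s ^ j) * poly (jacobi ?\<alpha> (real j) i) (2 * (t\<^sup>2 + s\<^sup>2) - 1))"
  define g where "g = gegenbauer_normed (real k + \<mu> + 1) (l - k) w"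
  define F where "F y = indicator (cball 0 1) y * (ball_basis \<mu> l k i \<epsilon> y * ball_weight \<mu> y)" for y
  have bb: "ball_basis \<mu> l k i \<epsilon> (chord_line \<xi> t w (r * s)) = disk_norm \<mu> k i * r ^ k * B t s * g" for s
  proof -
    let ?y = "chord_line \<xi> t w (r * s)"
    have "plane ?y = r *\<^sub>R (cis \<xi> * Complex t s)"
      by (simp add: plane_def chord_line_nth r_def[symmetric] complex_eq_iff algebra_simps)
    then have "trig_unit \<epsilon> * plane ?y ^ j = r ^ j *\<^sub>R (c * Complex t s ^ j)"
      by (simp only: scaleR_power mult_scaleR_right power_mult_distrib Complex.DeMoivre c_def mult.assoc)
    then have 1: "Re (trig_unit \<epsilon> * plane ?y ^ j) = r ^ j * Re (c * Complex t s ^ j)"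
      by (simp only: scaleR_complex.simps)
    have "(?y $ 1)\<^sup>2 + (?y $ 2)\<^sup>2 = r\<^sup>2 * (t\<^sup>2 + s\<^sup>2)"
      unfolding chord_line_nth r_def[symmetric] using sin_cos_squared_add[of \<xi>] by algebra
    moreover have "1 - (?y $ 3)\<^sup>2 = r\<^sup>2" by (simp add: chord_line_nth r2)
    moreover have "(r\<^sup>2) ^ i * poly (radial_poly \<mu> j i) (r\<^sup>2 * (t\<^sup>2 + s\<^sup>2) / r\<^sup>2) =
        hom_poly i (radial_poly \<mu> j i) (r\<^sup>2 * (t\<^sup>2 + s\<^sup>2)) (r\<^sup>2)"
      using r by (intro hom_poly_eq) (auto simp: degree_radial_poly[OF \<mu>])
    ultimately have 2: "hom_poly i (radial_poly \<mu> j i) ((?y $ 1)\<^sup>2 + (?y $ 2)\<^sup>2) (1 - (?y $ 3)\<^sup>2) =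
        (r\<^sup>2) ^ i * poly (jacobi ?\<alpha> (real j) i) (2 * (t\<^sup>2 + s\<^sup>2) - 1)"
      using r by (simp add: poly_radial_poly)
    have "r ^ k = r ^ j * (r\<^sup>2) ^ i" by (simp add: k power_add power_mult)
    then show ?thesis
      unfolding ball_basis_def solid_basis_def j_def[symmetric] 1 2
      unfolding B_def g_def chord_line_nth
      by (simp only: mult_ac)
  qed
  have Fr: "F (chord_line \<xi> t w (0 + r * s)) = disk_norm \<mu> k i * r ^ k * g * (1 - w\<^sup>2) powr ?\<alpha> * slice_fun \<mu> B t s" for s
  proof -
    let ?y = "chord_line \<xi> t w (r * s)"
    have n: "1 - (norm ?y)\<^sup>2 = (1 - w\<^sup>2) * (1 - t\<^sup>2 - s\<^sup>2)"
      unfolding norm_chord_line r_def[symmetric] power_mult_distrib r2 by (simp add: algebra_simps)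
    show ?thesis
    proof (cases "t\<^sup>2 + s\<^sup>2 < 1")
      case True
      then have "0 < (1 - w\<^sup>2) * (1 - t\<^sup>2 - s\<^sup>2)" using pos by (intro mult_pos_pos) auto
      then have "(norm ?y)\<^sup>2 \<le> 1" using n by linarith
      then have "norm ?y \<le> 1" unfolding abs_square_le_1 by simp
      moreover have "ball_weight \<mu> ?y = (1 - w\<^sup>2) powr ?\<alpha> * (1 - t\<^sup>2 - s\<^sup>2) powr ?\<alpha>"
        unfolding ball_weight_def n by (rule powr_mult)
      moreover have "Complex t s \<in> ball 0 1" using True Complex_in_ball by blast
      ultimately show ?thesis by (simp add: F_def bb slice_fun_def)
    next
      case False
      then have "Complex t s \<notin> ball 0 1" using Complex_in_ball by blast
      moreover have "F ?y = 0"
      proof (cases "t\<^sup>2 + s\<^sup>2 = 1")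
        case True
        then have "1 - (norm ?y)\<^sup>2 = 0" unfolding n by (simp add: algebra_simps)
        then show ?thesis by (simp add: F_def ball_weight_def)
      next
        case False
        then have "1 - t\<^sup>2 - s\<^sup>2 < 0" using \<open>\<not> t\<^sup>2 + s\<^sup>2 < 1\<close> by linarith
        then have "1 - (norm ?y)\<^sup>2 < 0" unfolding n using pos by (intro mult_pos_neg)
        then have "\<not> (norm ?y)\<^sup>2 \<le> 1" by linarith
        then have "\<not> norm ?y \<le> 1" unfolding abs_square_le_1 by simp
        then show ?thesis by (simp add: F_def)
      qed
      ultimately show ?thesis by (simp add: slice_fun_def)
    qed
  qed
  have contbb: "continuous_on UNIV (ball_basis \<mu> l k i \<epsilon>)"
  proof -
    have "(\<lambda>y. solid_basis \<mu> k i \<epsilon> y * gegenbauer_normed (real k + \<mu> + 1) (l - k) (y $ 3)) \<in> poly3_less (Suc (k + (l - k)))"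
      using \<mu> i by (intro poly3_less_mult poly3_less_solid_basis poly3_less_gegenbauer_normed) auto
    then show ?thesis unfolding ball_basis_def[abs_def] by (rule continuous_on_poly3)
  qed
  have [measurable]: "ball_basis \<mu> l k i \<epsilon> \<in> borel_measurable borel"
    by (rule borel_measurable_continuous_onI[OF contbb])
  have Fm: "F \<in> borel_measurable borel" unfolding F_def[abs_def] by measurable
  have cm: "chord_line \<xi> t w \<in> borel_measurable borel" unfolding chord_line_def[abs_def] by measurable
  have Fc: "(\<lambda>s. F (chord_line \<xi> t w s)) \<in> borel_measurable borel" using measurable_compose[OF cm Fm] .
  have "radon \<mu> \<xi> (ball_basis \<mu> l k i \<epsilon>) t w = (LINT s|lebesgue. F (chord_line \<xi> t w s))"
    by (simp only: radon_altdef F_def)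
  also have "\<dots> = (LINT s|lborel. F (chord_line \<xi> t w s))"
    by (rule integral_completion) (use Fc in simp)
  also have "\<dots> = r * (LINT s|lborel. F (chord_line \<xi> t w (0 + r * s)))"
    using r lborel_integral_real_affine[of r "\<lambda>s. F (chord_line \<xi> t w s)" 0] by simp
  also have "(LINT s|lborel. F (chord_line \<xi> t w (0 + r * s))) =
      disk_norm \<mu> k i * r ^ k * g * (1 - w\<^sup>2) powr ?\<alpha> * (LINT s|lborel. slice_fun \<mu> B t s)"
    unfolding Fr by simp
  also have "(LINT s|lborel. slice_fun \<mu> B t s) = jint ?\<alpha> ?\<alpha> 1 * Re c * poly (jacobi ?\<alpha> (real j) i) 1 *
      (1 - t\<^sup>2) powr \<mu> * (poly (gegenbauer (\<mu> + 1/2) k) t / poly (gegenbauer (\<mu> + 1/2) k) 1)"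
    unfolding B_def k by (rule slice_integral_basis(2)[OF \<mu> t])
  also have "Re c = trig j \<epsilon> \<xi>"
    using trig_eq_Re[of 1 j \<epsilon> \<xi>] by (simp only: c_def rcis_def of_real_1 mult_1_left power_one Complex.DeMoivre)
  finally have "radon \<mu> \<xi> (ball_basis \<mu> l k i \<epsilon>) t w =
      (disk_norm \<mu> k i * poly (jacobi ?\<alpha> (real j) i) 1 * trig j \<epsilon> \<xi> * jint ?\<alpha> ?\<alpha> 1) *
      (g * r ^ k * (r * (1 - w\<^sup>2) powr ?\<alpha>)) *
      ((1 - t\<^sup>2) powr \<mu> * (poly (gegenbauer (\<mu> + 1/2) k) t / poly (gegenbauer (\<mu> + 1/2) k) 1))"
    by (simp only: mult_ac)
  \<comment> \<open>The Jacobian of s in the slice raises the exponent from \<mu> - 1/2 to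
    \<mu>.\<close>
  also have "r * (1 - w\<^sup>2) powr ?\<alpha> = (1 - w\<^sup>2) powr \<mu>"
    using pos unfolding r_def by (simp add: powr_half_sqrt[symmetric] powr_add[symmetric])
  finally show ?thesis
    unfolding disk_basis_circle j_def[symmetric] g_def r_def .
qed

lemma set_integral_open_symmetric:
  assumes "\<And>t. \<bar>t\<bar> < 1 \<Longrightarrow> f t = c * (poly p t * (1 - t\<^sup>2) powr \<alpha>)"
  shows "(LINT t:{-1<..<1}|lebesgue. f t) = c * jint \<alpha> \<alpha> p"
proof -
  have "(LINT t:{-1<..<1}|lebesgue. f t) = (LINT t:{-1..1}|lebesgue. c * (poly p t * jacobi_weight \<alpha> \<alpha> t))"
    unfolding set_lebesgue_integral_def
  proof (intro Bochner_Integration.integral_cong refl)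
    fix t :: real
    consider "\<bar>t\<bar> < 1" | "t = 1 \<or> t = -1" | "t \<notin> {-1..1}" by fastforce
    then show "indicat_real {-1<..<1} t *\<^sub>R f t = indicat_real {-1..1} t *\<^sub>R (c * (poly p t * jacobi_weight \<alpha> \<alpha> t))"
    proof cases
      case 1
      then have "t \<in> {-1<..<1}" "t \<in> {-1..1}" by auto
      with assms[OF 1] show ?thesis by (simp add: gegenbauer_weight_eq)
    qed (auto simp: jacobi_weight_def indicator_def)
  qed
  then show ?thesis by (simp add: jint_def)
qed

lemma jint_gegenbauer_orth:
  assumes a: "a > 0" and kk': "k \<noteq> k'"
  shows "jint (a - 1/2) (a - 1/2) (gegenbauer a k * gegenbauer a k') = 0"
proof (cases "k' < k")
  case True
  then show ?thesis using a by (intro jint_gegenbauer_lower) (auto simp: degree_gegenbauer)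
next
  case False
  then have "jint (a - 1/2) (a - 1/2) (gegenbauer a k' * gegenbauer a k) = 0"
    using a kk' by (intro jint_gegenbauer_lower) (auto simp: degree_gegenbauer)
  then show ?thesis by (simp add: mult.commute)
qed

text \<open>The product of h_k^2 with the factor in front of the Gegenbauer polynomial in
  \<open>disk_Dt\<close>; its reciprocal is the constant in the pairing of a basis element with a
  ridge polynomial.\<close>

definition ridge_coeff :: "real \<Rightarrow> nat \<Rightarrow> real" where
  "ridge_coeff \<mu> k = pochhammer (\<mu> + 2) k / pochhammer (\<mu> + 3/2) k * ((real k + \<mu> + 1/2) / (\<mu> + 1/2))"

lemma ball_inner_radon:
  assumes \<mu>: "\<mu> \<ge> 0" and f: "ball_L1 \<mu> f" and k: "k \<le> l"
  shows "ball_inner \<mu> f (ball_ridge \<mu> l k \<xi>) = ball_const \<mu> *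
    (LINT w:{-1<..<1}|lebesgue. (LINT t:{-1<..<1}|lebesgue. radon \<mu> \<xi> f t w *
      (poly (gegenbauer (\<mu> + 1/2) k) t * (sqrt (1 - w\<^sup>2) ^ k * gegenbauer_normed (real k + \<mu> + 1) (l - k) w))) *
      sqrt (1 - w\<^sup>2))"
  unfolding ball_inner_def
proof (subst radon_integral[OF f])
  show "continuous_on UNIV (ball_ridge \<mu> l k \<xi>)"
    using poly3_less_ball_ridge[OF \<mu> k] by (rule continuous_on_poly3)
  show "(\<lambda>z. poly (gegenbauer (\<mu> + 1/2) k) (fst z) * (sqrt (1 - (snd z)\<^sup>2) ^ k * gegenbauer_normed (real k + \<mu> + 1) (l - k) (snd z)))
      \<in> borel_measurable (borel \<Otimes>\<^sub>M borel)"
    unfolding gegenbauer_normed_def by measurable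
qed (use \<mu> in \<open>simp_all add: ball_ridge_eq\<close>)

text \<open>The double integral factors. The t-integral gives orthogonality in k; once both k agree,
  the w-integral gives orthogonality in l.\<close>

lemma ball_inner_basis_ridge:
  assumes \<mu>: "\<mu> \<ge> 0" and k: "k \<le> l" and k0: "k0 \<le> l0" and i0: "(i0, \<epsilon>0) \<in> disk_index k0"
  shows "ball_inner \<mu> (ball_basis \<mu> l0 k0 i0 \<epsilon>0) (ball_ridge \<mu> l k \<xi>) =
    (if l = l0 \<and> k = k0 then disk_basis \<mu> k i0 \<epsilon>0 (cos \<xi>) (sin \<xi>) / ridge_coeff \<mu> k else 0)"
proof -
  let ?C = "gegenbauer (\<mu> + 1/2)"
  let ?g = "\<lambda>k l. gegenbauer_normed (real k + \<mu> + 1) (l - k)"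
  define d where "d = disk_basis \<mu> k0 i0 \<epsilon>0 (cos \<xi>) (sin \<xi>) * jint (\<mu> - 1/2) (\<mu> - 1/2) 1"
  let ?S = "\<lambda>w. (d * (?g k0 l0 w * sqrt (1 - w\<^sup>2) ^ k0 * (1 - w\<^sup>2) powr \<mu>) *
       (sqrt (1 - w\<^sup>2) ^ k * ?g k l w) / poly (?C k0) 1) * jint \<mu> \<mu> (?C k0 * ?C k)"
  let ?I = "\<lambda>w. (LINT t:{-1<..<1}|lebesgue. radon \<mu> \<xi> (ball_basis \<mu> l0 k0 i0 \<epsilon>0) t w *
      (poly (?C k) t * (sqrt (1 - w\<^sup>2) ^ k * ?g k l w)))"
  have i0': "2 * i0 \<le> k0" using i0 by (simp add: disk_index_def)
  have "ball_inner \<mu> (ball_basis \<mu> l0 k0 i0 \<epsilon>0) (ball_ridge \<mu> l k \<xi>) = ball_const \<mu> *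
    (LINT w:{-1<..<1}|lebesgue. ?I w * sqrt (1 - w\<^sup>2))"
    by (rule ball_inner_radon[OF \<mu> poly3_less_L1[OF \<mu> poly3_less_ball_basis[OF \<mu> k0 i0]] k])
  also have "(LINT w:{-1<..<1}|lebesgue. ?I w * sqrt (1 - w\<^sup>2)) =
     (LINT w:{-1<..<1}|lebesgue. ?S w * sqrt (1 - w\<^sup>2))"
  proof (intro set_lebesgue_integral_cong allI impI)
    fix w :: real assume "w \<in> {-1<..<1}"
    then have w: "\<bar>w\<bar> < 1" by auto
    have "?I w = ?S w"
      by (rule set_integral_open_symmetric)
         (simp add: radon_ball_basis[OF \<mu> w _ i0'] d_def)
    then show "?I w * sqrt (1 - w\<^sup>2) = ?S w * sqrt (1 - w\<^sup>2)" by simp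
  qed simp
  finally have I: "ball_inner \<mu> (ball_basis \<mu> l0 k0 i0 \<epsilon>0) (ball_ridge \<mu> l k \<xi>) = ball_const \<mu> *
     (LINT w:{-1<..<1}|lebesgue. ?S w * sqrt (1 - w\<^sup>2))" .
  show ?thesis
  proof (cases "k = k0")
    case False
    have "jint \<mu> \<mu> (?C k0 * ?C k) = 0"
      using jint_gegenbauer_orth[of "\<mu> + 1/2" k0 k] \<mu> False by simp
    then show ?thesis unfolding I using False by simp
  next
    case True
    let ?a = "real k + \<mu> + 1"
    have a: "?a > 0" using \<mu> by simp
    define N where "N l = sqrt (?a * pochhammer (2 * ?a) (l - k) / ((real (l - k) + ?a) * fact (l - k)))" for l
    have N2: "N l * N l = ?a * pochhammer (2 * ?a) (l - k) / ((real (l - k) + ?a) * fact (l - k))" "N l \<noteq> 0" for l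
    proof -
      have sq: "sqrt x * sqrt x = x" "sqrt x \<noteq> 0" if "x > 0" for x :: real
        using that by simp_all
      show "N l * N l = ?a * pochhammer (2 * ?a) (l - k) / ((real (l - k) + ?a) * fact (l - k))" "N l \<noteq> 0"
        unfolding N_def by (rule sq[OF gegenbauer_norm_const_pos[OF a]])+
    qed
    let ?G = "\<lambda>l. gegenbauer ?a (l - k)"
    define e where "e = d / poly (?C k) 1 * jint \<mu> \<mu> (?C k * ?C k)"
    have "(LINT w:{-1<..<1}|lebesgue. ?S w * sqrt (1 - w\<^sup>2)) =
       e / (N l0 * N l) * jint (real k + \<mu> + 1/2) (real k + \<mu> + 1/2) (?G l0 * ?G l)"
    proof (rule set_integral_open_symmetric)
      fix w :: real assume w: "\<bar>w\<bar> < 1"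
      have pos: "1 - w\<^sup>2 > 0" using w by (simp add: abs_square_less_1)
      have g: "?g k l w = poly (?G l) w / N l" for l unfolding gegenbauer_normed_def N_def by simp
      \<comment> \<open>The basis and the ridge contribute k/2 each, the Jacobian 1/2 and the chord
        integral \<mu>: exactly the weight exponent for the Gegenbauer index k + \<mu> + 1.\<close>
      have "sqrt (1 - w\<^sup>2) ^ k * sqrt (1 - w\<^sup>2) ^ k * sqrt (1 - w\<^sup>2) * (1 - w\<^sup>2) powr \<mu> =
          (1 - w\<^sup>2) powr (real k + \<mu> + 1/2)"
      proof -
        have "sqrt (1 - w\<^sup>2) ^ k * sqrt (1 - w\<^sup>2) ^ k = (1 - w\<^sup>2) powr real k"
          using pos by (simp add: powr_realpow flip: power_mult_distrib)
        moreover have "sqrt (1 - w\<^sup>2) = (1 - w\<^sup>2) powr (1/2)" using pos by (simp add: powr_half_sqrt)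
        ultimately show ?thesis by (simp only: powr_add[symmetric]) (simp add: add_ac)
      qed
      then show "?S w * sqrt (1 - w\<^sup>2) =
       e / (N l0 * N l) * (poly (?G l0 * ?G l) w * (1 - w\<^sup>2) powr (real k + \<mu> + 1/2))"
        unfolding True[symmetric] g e_def poly_mult by (simp add: mult_ac flip: \<open>_ = (1 - w\<^sup>2) powr (real k + \<mu> + 1/2)\<close>)
    qed
    then have I': "ball_inner \<mu> (ball_basis \<mu> l0 k0 i0 \<epsilon>0) (ball_ridge \<mu> l k \<xi>) =
        ball_const \<mu> * (e / (N l0 * N l) * jint (real k + \<mu> + 1/2) (real k + \<mu> + 1/2) (?G l0 * ?G l))"
      unfolding I by simp
    have a2: "?a - 1/2 = real k + \<mu> + 1/2" by simp
    show ?thesis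
    proof (cases "l = l0")
      case False
      then have "l0 - k \<noteq> l - k" using k k0 True by auto
      then have "jint (real k + \<mu> + 1/2) (real k + \<mu> + 1/2) (?G l0 * ?G l) = 0"
        using jint_gegenbauer_orth[OF a, of "l0 - k" "l - k"] unfolding a2 by simp
      then show ?thesis unfolding I' using False by simp
    next
      case l: True
      have "jint (real k + \<mu> + 1/2) (real k + \<mu> + 1/2) (?G l * ?G l) =
          jint (real k + \<mu> + 1/2) (real k + \<mu> + 1/2) 1 * (N l * N l)"
        using jint_gegenbauer_self[OF a, of "l - k"] unfolding a2 N2(1) .
      then have J: "e / (N l0 * N l) * jint (real k + \<mu> + 1/2) (real k + \<mu> + 1/2) (?G l0 * ?G l) =
          e * jint (real k + \<mu> + 1/2) (real k + \<mu> + 1/2) 1"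
        using N2(2)[of l] l by simp
      have pp: "pochhammer (2 * (\<mu> + 1/2)) k > 0" using \<mu> by (intro pochhammer_pos) auto
      have A1: "jint \<mu> \<mu> (?C k * ?C k) = jint \<mu> \<mu> 1 * ((\<mu> + 1/2) * pochhammer (2 * (\<mu> + 1/2)) k / ((real k + (\<mu> + 1/2)) * fact k))"
        using jint_gegenbauer_self[of "\<mu> + 1/2" k] \<mu> by simp
      have A2: "poly (?C k) 1 = pochhammer (2 * (\<mu> + 1/2)) k / fact k"
        using \<mu> by (intro poly_gegenbauer_1) auto
      \<comment> \<open>With \<lambda> = \<mu> + 1/2, the norm divided by the value at 1 leaves
        \<lambda> / (k + \<lambda>); this is the origin of the factor (k + \<lambda>) / \<lambda> in
        the kernel.\<close>
      have A3: "jint \<mu> \<mu> (?C k * ?C k) / poly (?C k) 1 = jint \<mu> \<mu> 1 * ((\<mu> + 1/2) / (real k + (\<mu> + 1/2)))"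
      proof -
        have alg: "(J * (a * P / (s * F))) / (P / F) = J * (a / s)" if "P > 0" "F > 0" for J a P s F :: real
          using that by (cases "s = 0") (auto simp: field_simps)
        show ?thesis unfolding A1 A2 by (rule alg[OF pp fact_gt_zero])
      qed
      have e0: "e = d * (jint \<mu> \<mu> (?C k * ?C k) / poly (?C k) 1)" by (simp add: e_def)
      have e: "e = d * (jint \<mu> \<mu> 1 * ((\<mu> + 1/2) / (real k + (\<mu> + 1/2))))"
        unfolding e0 A3 ..
      define h where "h = pochhammer (\<mu> + 2) k / pochhammer (\<mu> + 3/2) k"
      have h: "h > 0" unfolding h_def using \<mu> by (intro divide_pos_pos pochhammer_pos) auto
      define q where "q = (real k + \<mu> + 1/2) / (\<mu> + 1/2)"
      have q: "q > 0" unfolding q_def using \<mu> by (intro divide_pos_pos) auto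
      have qi: "(\<mu> + 1/2) / (real k + (\<mu> + 1/2)) = 1 / q" by (simp add: q_def add_ac)
      define b where "b = disk_basis \<mu> k i0 \<epsilon>0 (cos \<xi>) (sin \<xi>)"
      have dd: "d = b * jint (\<mu> - 1/2) (\<mu> - 1/2) 1" by (simp add: d_def b_def True)
      have n: "ball_const \<mu> * h * jint (\<mu> - 1/2) (\<mu> - 1/2) 1 * jint \<mu> \<mu> 1 * jint (real k + \<mu> + 1/2) (real k + \<mu> + 1/2) 1 = 1"
        unfolding h_def by (rule ball_normalization[OF \<mu>])
      have alg: "ca * (b * j1 * (j2 * (1 / q)) * j3) = b / (h * q)" if "ca * h * j1 * j2 * j3 = 1" for ca j1 j2 j3
      proof -
        have "ca * (b * j1 * (j2 * (1 / q)) * j3) = (ca * h * j1 * j2 * j3) * b / (h * q)"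
          using h q by (simp add: field_simps)
        then show ?thesis using that by simp
      qed
      have "ball_const \<mu> * (e * jint (real k + \<mu> + 1/2) (real k + \<mu> + 1/2) 1) = b / (h * q)"
        unfolding e qi dd by (rule alg[OF n])
      then show ?thesis unfolding I' J b_def[symmetric] using l True by (simp add: ridge_coeff_def h_def q_def)
    qed
  qed
qed


section \<open>The dual family and the finite expansion\<close>

text \<open>The strict bound on l matches \<open>poly3_less n\<close>; for n = 0 the expansion is
  empty.\<close>

definition ball_index :: "nat \<Rightarrow> (nat \<times> nat \<times> nat \<times> nat) set" where
  "ball_index n = (SIGMA l:{..<n}. SIGMA k:{..l}. disk_index k)"

lemma finite_ball_index [simp]: "finite (ball_index n)"
  unfolding ball_index_def by (intro finite_SigmaI) auto

text \<open>\<open>ridge_coeff\<close> undoes the constant of the ridge pairing,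
  \<open>disk_lambda\<close> and 2 m + 1 undo the discrete mean square of the samples.\<close>

definition node_weight :: "real \<Rightarrow> nat \<Rightarrow> nat \<Rightarrow> nat \<Rightarrow> nat \<Rightarrow> real \<Rightarrow> real" where
  "node_weight \<mu> m k i \<epsilon> \<xi> =
     ridge_coeff \<mu> k * disk_lambda \<mu> k i / (2 * real m + 1) * disk_basis \<mu> k i \<epsilon> (cos \<xi>) (sin \<xi>)"

definition basis_of :: "real \<Rightarrow> nat \<times> nat \<times> nat \<times> nat \<Rightarrow> real ^ 3 \<Rightarrow> real" where
  "basis_of \<mu> = (\<lambda>(l, k, i, \<epsilon>). ball_basis \<mu> l k i \<epsilon>)"

definition dual_of :: "real \<Rightarrow> nat \<Rightarrow> (nat \<Rightarrow> real) \<Rightarrow> nat \<times> nat \<times> nat \<times> nat \<Rightarrow> real ^ 3 \<Rightarrow> real" where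
  "dual_of \<mu> m \<phi> = (\<lambda>(l, k, i, \<epsilon>) y. \<Sum>\<nu>\<le>2 * m. node_weight \<mu> m k i \<epsilon> (\<phi> \<nu>) * ball_ridge \<mu> l k (\<phi> \<nu>) y)"

definition expansion :: "real \<Rightarrow> nat \<Rightarrow> (nat \<Rightarrow> real) \<Rightarrow> nat \<Rightarrow> (real ^ 3 \<Rightarrow> real) \<Rightarrow> real ^ 3 \<Rightarrow> real" where
  "expansion \<mu> m \<phi> n f x = (\<Sum>r\<in>ball_index n. ball_inner \<mu> f (dual_of \<mu> m \<phi> r) * basis_of \<mu> r x)"

lemma poly3_less_basis_of:
  assumes "\<mu> \<ge> 0" "r \<in> ball_index n"
  shows "basis_of \<mu> r \<in> poly3_less n"
  using assms by (auto simp: ball_index_def basis_of_def intro: poly3_less_mono[OF poly3_less_ball_basis])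

lemma poly3_less_dual_of:
  assumes "\<mu> \<ge> 0" "r \<in> ball_index n"
  shows "dual_of \<mu> m \<phi> r \<in> poly3_less n"
  using assms
  by (auto simp: ball_index_def dual_of_def intro!: poly3_less_sum poly3_less_scale poly3_less_mono[OF poly3_less_ball_ridge])

lemma ridge_coeff_pos: "\<mu> \<ge> 0 \<Longrightarrow> ridge_coeff \<mu> k > 0"
  unfolding ridge_coeff_def by (intro mult_pos_pos divide_pos_pos pochhammer_pos) auto

text \<open>Pairing with one ridge polynomial settles (l, k) and returns a sample on the circle; the
  weighted sum over the nodes settles (i, \<epsilon>) by \<open>disk_quadrature\<close>.\<close>

lemma biorthogonal:
  assumes \<mu>: "\<mu> \<ge> 0" and \<phi>: "\<And>\<nu>. \<nu> \<le> 2 * m \<Longrightarrow> \<phi> \<nu> = 2 * real \<nu> * pi / (2 * real m + 1)"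
    and r: "r \<in> ball_index (Suc (2 * m))" and r': "r' \<in> ball_index (Suc (2 * m))"
  shows "ball_inner \<mu> (basis_of \<mu> r') (dual_of \<mu> m \<phi> r) = (if r = r' then 1 else 0)"
proof -
  obtain l k i \<epsilon> where re: "r = (l, k, i, \<epsilon>)" by (metis prod_cases4)
  obtain l' k' i' \<epsilon>' where re': "r' = (l', k', i', \<epsilon>')" by (metis prod_cases4)
  have I: "l \<le> 2 * m" "k \<le> l" "(i, \<epsilon>) \<in> disk_index k" "l' \<le> 2 * m" "k' \<le> l'" "(i', \<epsilon>') \<in> disk_index k'"
    using r r' by (auto simp: ball_index_def re re')
  have "ball_inner \<mu> (basis_of \<mu> r') (dual_of \<mu> m \<phi> r) =
     (\<Sum>\<nu>\<le>2 * m. ball_inner \<mu> (ball_basis \<mu> l' k' i' \<epsilon>') (\<lambda>y. node_weight \<mu> m k i \<epsilon> (\<phi> \<nu>) * ball_ridge \<mu> l k (\<phi> \<nu>) y))"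
    unfolding re re' basis_of_def dual_of_def split
    by (rule ball_inner_sum_right[where n = "Suc l"])
       (use \<mu> I in \<open>auto intro: poly3_less_L1 poly3_less_ball_basis poly3_less_scale poly3_less_ball_ridge\<close>)
  also have "\<dots> = (\<Sum>\<nu>\<le>2 * m. if l = l' \<and> k = k' then disk_lambda \<mu> k i / (2 * real m + 1) *
      disk_basis \<mu> k i \<epsilon> (cos (\<phi> \<nu>)) (sin (\<phi> \<nu>)) * disk_basis \<mu> k i' \<epsilon>' (cos (\<phi> \<nu>)) (sin (\<phi> \<nu>)) else 0)"
    using ridge_coeff_pos[OF \<mu>, of k]
    unfolding ball_inner_scale_right ball_inner_basis_ridge[OF \<mu> I(2,5,6)]
    by (intro sum.cong refl) (auto simp: node_weight_def)
  also have "\<dots> = (if r = r' then 1 else 0)"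
  proof (cases "l = l' \<and> k = k'")
    case True
    then show ?thesis
      using disk_quadrature[OF \<mu> _ I(3), of m i' \<epsilon>' \<phi>] I \<phi> by (auto simp: re re')
  qed (auto simp: re re')
  finally show ?thesis .
qed

text \<open>Biorthogonality gives the identity on basis elements, and \<open>ball_basis_span\<close>
  extends it by linearity. Membership in \<open>poly3_less n\<close> is part of \<open>U\<close> so
  that the pairings stay additive.\<close>

lemma expansion_reproduces:
  assumes \<mu>: "\<mu> \<ge> 0" and \<phi>: "\<And>\<nu>. \<nu> \<le> 2 * m \<Longrightarrow> \<phi> \<nu> = 2 * real \<nu> * pi / (2 * real m + 1)"
    and n: "n \<le> Suc (2 * m)" and q: "q \<in> poly3_less n"
  shows "expansion \<mu> m \<phi> n q = q"
proof (cases n)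
  case 0
  then show ?thesis using q by (auto simp: expansion_def ball_index_def poly3_less_def)
next
  case (Suc n')
  have sub: "ball_index n \<subseteq> ball_index (Suc (2 * m))" using n by (auto simp: ball_index_def)
  define U where "U p \<longleftrightarrow> p \<in> poly3_less n \<and> expansion \<mu> m \<phi> n p = p" for p
  have "U q"
  proof (rule ball_basis_span[OF \<mu>])
    fix f g assume "U f" "U g"
    then have fg: "f \<in> poly3_less n" "g \<in> poly3_less n" "expansion \<mu> m \<phi> n f = f" "expansion \<mu> m \<phi> n g = g"
      by (auto simp: U_def)
    have "ball_inner \<mu> (\<lambda>x. f x + g x) (dual_of \<mu> m \<phi> r) = ball_inner \<mu> f (dual_of \<mu> m \<phi> r) + ball_inner \<mu> g (dual_of \<mu> m \<phi> r)"
      if "r \<in> ball_index n" for r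
      unfolding ball_inner_commute[of \<mu> _ "dual_of \<mu> m \<phi> r"]
      using that fg \<mu> by (intro ball_inner_add_right poly3_less_L1[OF \<mu> poly3_less_dual_of])
    then have "expansion \<mu> m \<phi> n (\<lambda>x. f x + g x) x = expansion \<mu> m \<phi> n f x + expansion \<mu> m \<phi> n g x" for x
      unfolding expansion_def sum.distrib[symmetric] by (intro sum.cong) (auto simp: distrib_right)
    then show "U (\<lambda>x. f x + g x)" unfolding U_def using fg by (auto intro: poly3_less_add)
  next
    fix c f assume "U f"
    then have f: "f \<in> poly3_less n" "expansion \<mu> m \<phi> n f = f" by (auto simp: U_def)
    have "ball_inner \<mu> (\<lambda>x. c * f x) h = c * ball_inner \<mu> f h" for h
      unfolding ball_inner_commute[of \<mu> _ h] by (rule ball_inner_scale_right)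
    then have "expansion \<mu> m \<phi> n (\<lambda>x. c * f x) x = c * expansion \<mu> m \<phi> n f x" for x
      unfolding expansion_def sum_distrib_left by (intro sum.cong) auto
    then show "U (\<lambda>x. c * f x)" unfolding U_def using f by (auto intro: poly3_less_scale)
  next
    show "U (\<lambda>x. 0)" by (auto simp: U_def poly3_less_zero expansion_def ball_inner_def)
  next
    fix l k i \<epsilon> assume I: "l \<le> n'" "k \<le> l" "(i, \<epsilon>) \<in> disk_index k"
    define s where "s = (l, k, i, \<epsilon>)"
    have s: "s \<in> ball_index n" using I Suc by (auto simp: s_def ball_index_def)
    have "ball_inner \<mu> (basis_of \<mu> s) (dual_of \<mu> m \<phi> r) = (if r = s then 1 else 0)" if "r \<in> ball_index n" for r
      using that s sub by (intro biorthogonal[OF \<mu> \<phi>]) auto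
    then have "expansion \<mu> m \<phi> n (basis_of \<mu> s) x = (\<Sum>r\<in>ball_index n. if r = s then basis_of \<mu> s x else 0)" for x
      unfolding expansion_def by (intro sum.cong refl) simp
    then have "expansion \<mu> m \<phi> n (basis_of \<mu> s) = basis_of \<mu> s" using s by (auto simp: fun_eq_iff)
    moreover have "basis_of \<mu> s \<in> poly3_less n" using s by (rule poly3_less_basis_of[OF \<mu>])
    ultimately have "U (basis_of \<mu> s)" by (simp add: U_def)
    then show "U (ball_basis \<mu> l k i \<epsilon>)" by (simp add: s_def basis_of_def)
  qed (use q Suc in simp)
  then show ?thesis by (simp add: U_def)
qed

lemma poly3_less_expansion: "\<mu> \<ge> 0 \<Longrightarrow> expansion \<mu> m \<phi> n f \<in> poly3_less n"
  unfolding expansion_def[abs_def] by (intro poly3_less_sum poly3_less_scale poly3_less_basis_of)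

text \<open>
  The kernel of the expansion is not visibly symmetric, so the residual is first controlled for the
  transposed expansion, which the reproducing property then shows to be the same function.
\<close>

lemma expansion_residual:
  assumes \<mu>: "\<mu> \<ge> 0" and \<phi>: "\<And>\<nu>. \<nu> \<le> 2 * m \<Longrightarrow> \<phi> \<nu> = 2 * real \<nu> * pi / (2 * real m + 1)"
    and n: "n \<le> Suc (2 * m)" and f: "ball_L1 \<mu> f" and q: "q \<in> poly3_less n"
  shows "ball_inner \<mu> (expansion \<mu> m \<phi> n f) q = ball_inner \<mu> f q"
proof -
  define P where "P y = (\<Sum>r\<in>ball_index n. ball_inner \<mu> f (basis_of \<mu> r) * dual_of \<mu> m \<phi> r y)" for y
  have P: "P \<in> poly3_less n"
    unfolding P_def[abs_def] by (intro poly3_less_sum poly3_less_scale poly3_less_dual_of \<mu>)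
  have Pq: "ball_inner \<mu> P q = ball_inner \<mu> f q" if q: "q \<in> poly3_less n" for q
  proof -
    have "ball_inner \<mu> P q = ball_inner \<mu> q P" by (rule ball_inner_commute)
    also have "\<dots> = (\<Sum>r\<in>ball_index n. ball_inner \<mu> q (\<lambda>y. ball_inner \<mu> f (basis_of \<mu> r) * dual_of \<mu> m \<phi> r y))"
      unfolding P_def[abs_def]
      by (rule ball_inner_sum_right[where n = n]) (use q \<mu> in \<open>auto intro: poly3_less_L1 poly3_less_scale poly3_less_dual_of\<close>)
    also have "\<dots> = (\<Sum>r\<in>ball_index n. ball_inner \<mu> f (\<lambda>y. ball_inner \<mu> q (dual_of \<mu> m \<phi> r) * basis_of \<mu> r y))"
      unfolding ball_inner_scale_right by (simp only: mult.commute)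
    also have "\<dots> = ball_inner \<mu> f (expansion \<mu> m \<phi> n q)"
      unfolding expansion_def[abs_def]
      by (rule ball_inner_sum_right[symmetric, where n = n]) (use f \<mu> in \<open>auto intro: poly3_less_scale poly3_less_basis_of\<close>)
    also have "expansion \<mu> m \<phi> n q = q" by (rule expansion_reproduces[OF \<mu> \<phi> n q])
    finally show ?thesis .
  qed
  \<comment> \<open>The duals are polynomials, and against polynomials \<open>P\<close> pairs as f
    does; so both have the same coefficients.\<close>
  have "expansion \<mu> m \<phi> n f = expansion \<mu> m \<phi> n P"
    unfolding expansion_def[abs_def] by (intro ext sum.cong refl) (simp add: Pq poly3_less_dual_of \<mu>)
  also have "\<dots> = P" by (rule expansion_reproduces[OF \<mu> \<phi> n P])
  finally show ?thesis using Pq[OF q] by simp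
qed

text \<open>All coefficients of p vanish, while p equals its own expansion. This stands in for
  definiteness of the inner product.\<close>

lemma ball_inner_nondegenerate:
  assumes \<mu>: "\<mu> \<ge> 0" and \<phi>: "\<And>\<nu>. \<nu> \<le> 2 * m \<Longrightarrow> \<phi> \<nu> = 2 * real \<nu> * pi / (2 * real m + 1)"
    and n: "n \<le> Suc (2 * m)" and p: "p \<in> poly3_less n" and z: "\<And>q. q \<in> poly3_less n \<Longrightarrow> ball_inner \<mu> p q = 0"
  shows "p = (\<lambda>x. 0)"
proof -
  have "expansion \<mu> m \<phi> n p = (\<lambda>x. 0)"
    unfolding expansion_def[abs_def] by (simp add: z poly3_less_dual_of \<mu>)
  then show ?thesis using expansion_reproduces[OF \<mu> \<phi> n p] by simp
qed

text \<open>The two expansions are the orthogonal projections onto degrees at most l and below l, so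
  their difference has the defining properties of the projection onto
  \<open>ball_V \<mu> l\<close>.\<close>

lemma ball_proj_eq:
  assumes \<mu>: "\<mu> \<ge> 0" and \<phi>: "\<And>\<nu>. \<nu> \<le> 2 * m \<Longrightarrow> \<phi> \<nu> = 2 * real \<nu> * pi / (2 * real m + 1)"
    and l: "l \<le> 2 * m" and f: "ball_L1 \<mu> f"
  shows "ball_proj \<mu> l f = (\<lambda>x. expansion \<mu> m \<phi> (Suc l) f x - expansion \<mu> m \<phi> l f x)"
proof -
  let ?E = "expansion \<mu> m \<phi>"
  define D where "D x = ?E (Suc l) f x - ?E l f x" for x
  have l': "Suc l \<le> Suc (2 * m)" "l \<le> Suc (2 * m)" using l by auto
  have res1: "ball_inner \<mu> (?E (Suc l) g) q = ball_inner \<mu> g q" if "ball_L1 \<mu> g" "q \<in> poly3_less (Suc l)" for g q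
    by (rule expansion_residual[OF \<mu> \<phi> l'(1) that])
  have res2: "ball_inner \<mu> (?E l g) q = ball_inner \<mu> g q" if "ball_L1 \<mu> g" "q \<in> poly3_less l" for g q
    by (rule expansion_residual[OF \<mu> \<phi> l'(2) that])
  have up: "p \<in> poly3_less (Suc l)" if "p \<in> poly3_less l" for p using that by (rule poly3_less_mono) simp
  note E = poly3_less_expansion[OF \<mu>]
  note L1 = poly3_less_L1[OF \<mu>]
  \<comment> \<open>\<open>ball_V\<close> demands exact degree l or the zero function; a polynomial
    of lower degree that is orthogonal to all of its kind must be zero.\<close>
  have VI: "p \<in> ball_V \<mu> l" if p: "p \<in> poly3_less (Suc l)" "\<And>q. q \<in> poly3_less l \<Longrightarrow> ball_inner \<mu> p q = 0" for p
  proof (cases "p \<in> poly3_less l")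
    case True
    then have "p = (\<lambda>x. 0)" using ball_inner_nondegenerate[OF \<mu> \<phi> l'(2) True p(2)] by simp
    then show ?thesis using p by (simp add: ball_V_def)
  next
    case False
    then show ?thesis using p by (simp add: ball_V_def)
  qed
  have VD: "p \<in> poly3_less (Suc l)" "\<And>q. q \<in> poly3_less l \<Longrightarrow> ball_inner \<mu> p q = 0" if "p \<in> ball_V \<mu> l" for p
    using that by (auto simp: ball_V_def poly3_less_zero)
  have D: "D \<in> poly3_less (Suc l)" unfolding D_def[abs_def] by (intro poly3_less_diff E up)
  have Dq: "ball_inner \<mu> D q = ball_inner \<mu> f q - ball_inner \<mu> (?E l f) q" if "q \<in> poly3_less (Suc l)" for q
    unfolding D_def[abs_def] using that f
    by (subst ball_inner_diff_left[OF L1[OF E] L1[OF E]]) (auto simp: res1)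
  have DV: "D \<in> ball_V \<mu> l"
    by (rule VI[OF D]) (simp add: Dq up res2 f)
  have El: "ball_inner \<mu> (?E l g) q = 0" if "q \<in> ball_V \<mu> l" for q g
    using VD(2)[OF that E] by (simp add: ball_inner_commute)
  show ?thesis
    unfolding ball_proj_def D_def[abs_def, symmetric]
  proof (rule the_equality)
    show "D \<in> ball_V \<mu> l \<and> (\<forall>q\<in>ball_V \<mu> l. ball_inner \<mu> (\<lambda>x. f x - D x) q = 0)"
      using DV by (auto simp: ball_inner_diff_left[OF f L1[OF D] VD(1)] Dq VD(1) El)
  next
    fix p assume p: "p \<in> ball_V \<mu> l \<and> (\<forall>q\<in>ball_V \<mu> l. ball_inner \<mu> (\<lambda>x. f x - p x) q = 0)"
    then have pV: "p \<in> ball_V \<mu> l" by simp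
    define d where "d x = p x - D x" for x
    have d: "d \<in> poly3_less (Suc l)" unfolding d_def[abs_def] by (intro poly3_less_diff VD(1) pV D)
    have dq: "ball_inner \<mu> d q = ball_inner \<mu> p q - ball_inner \<mu> D q" if "q \<in> poly3_less (Suc l)" for q
      unfolding d_def[abs_def] by (rule ball_inner_diff_left[OF L1[OF VD(1)[OF pV]] L1[OF D] that])
    have low: "ball_inner \<mu> d q = 0" if "q \<in> poly3_less l" for q
      using VD(2)[OF pV that] VD(2)[OF DV that] by (simp add: dq[OF up[OF that]])
    have top: "ball_inner \<mu> d q = 0" if q: "q \<in> ball_V \<mu> l" for q
    proof -
      have "ball_inner \<mu> f q - ball_inner \<mu> p q = 0"
        using p q ball_inner_diff_left[OF f L1[OF VD(1)[OF pV]] VD(1)[OF q]] by simp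
      then show ?thesis using VD(1)[OF q] q by (simp add: dq Dq El)
    qed
    \<comment> \<open>Every q of degree at most l is the sum of an element of
      \<open>ball_V \<mu> l\<close> and its lower expansion, and d is orthogonal to both.\<close>
    have "d = (\<lambda>x. 0)"
    proof (rule ball_inner_nondegenerate[OF \<mu> \<phi> l'(1) d])
      fix q assume q: "q \<in> poly3_less (Suc l)"
      define q' where "q' x = q x - ?E l q x" for x
      have q': "q' \<in> poly3_less (Suc l)" unfolding q'_def[abs_def] by (intro poly3_less_diff q up E)
      have "q' \<in> ball_V \<mu> l"
      proof (rule VI[OF q'])
        fix s assume s: "s \<in> poly3_less l"
        show "ball_inner \<mu> q' s = 0"
          unfolding q'_def[abs_def] using ball_inner_diff_left[OF L1[OF q] L1[OF E] s] res2[OF L1[OF q] s] by simp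
      qed
      then have "ball_inner \<mu> d q' = 0" by (rule top)
      moreover have "ball_inner \<mu> d (?E l q) = 0" by (rule low[OF E])
      moreover have "q = (\<lambda>x. q' x + ?E l q x)" by (simp add: q'_def fun_eq_iff)
      ultimately show "ball_inner \<mu> d q = 0"
        using ball_inner_add_right[OF L1[OF d] q' up[OF E]] by (metis add_0)
    qed
    then show "p = D" by (simp add: d_def fun_eq_iff)
  qed
qed

lemma ball_partial_sum_eq:
  assumes \<mu>: "\<mu> \<ge> 0" and \<phi>: "\<And>\<nu>. \<nu> \<le> 2 * m \<Longrightarrow> \<phi> \<nu> = 2 * real \<nu> * pi / (2 * real m + 1)"
    and f: "ball_L1 \<mu> f"
  shows "ball_partial_sum \<mu> (2 * m) f x = expansion \<mu> m \<phi> (Suc (2 * m)) f x"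
proof -
  have "ball_partial_sum \<mu> (2 * m) f x =
      (\<Sum>l<Suc (2 * m). expansion \<mu> m \<phi> (Suc l) f x - expansion \<mu> m \<phi> l f x)"
    unfolding ball_partial_sum_def lessThan_Suc_atMost
    by (intro sum.cong refl) (simp add: ball_proj_eq[OF \<mu> \<phi> _ f])
  also have "\<dots> = expansion \<mu> m \<phi> (Suc (2 * m)) f x - expansion \<mu> m \<phi> 0 f x"
    by (rule sum_lessThan_telescope)
  also have "expansion \<mu> m \<phi> 0 f x = 0" by (simp add: expansion_def ball_index_def)
  finally show ?thesis by simp
qed

lemma sum_ball_index:
  "(\<Sum>l<n. \<Sum>k\<le>l. \<Sum>(i, \<epsilon>)\<in>disk_index k. h l k i \<epsilon>) = (\<Sum>(l, k, i, \<epsilon>)\<in>ball_index n. h l k i \<epsilon>)"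
proof -
  have "(\<Sum>l<n. \<Sum>k\<le>l. sum (case_prod (h l k)) (disk_index k)) =
      (\<Sum>l<n. sum (case_prod (\<lambda>k. case_prod (h l k))) (Sigma {..l} disk_index))"
    by (intro sum.cong refl sum.Sigma) auto
  also have "\<dots> = sum (case_prod (\<lambda>l. case_prod (\<lambda>k. case_prod (h l k)))) (Sigma {..<n} (\<lambda>l. Sigma {..l} disk_index))"
    by (rule sum.Sigma) auto
  finally show ?thesis by (simp only: ball_index_def)
qed

text \<open>Each summand becomes a factor depending on x times a factor depending on (t, w); the
  latter pulls back to a ridge polynomial.\<close>

lemma kernel_Phi_eq:
  assumes \<mu>: "\<mu> \<ge> 0"
  shows "kernel_Phi \<mu> n \<xi> t w x = ball_const \<mu> * (\<Sum>(l, k, i, \<epsilon>)\<in>ball_index (Suc n).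
     (ridge_coeff \<mu> k * disk_lambda \<mu> k i * disk_basis \<mu> k i \<epsilon> (cos \<xi>) (sin \<xi>) * ball_basis \<mu> l k i \<epsilon> x) *
     (poly (gegenbauer (\<mu> + 1/2) k) t * (sqrt (1 - w\<^sup>2) ^ k * gegenbauer_normed (real k + \<mu> + 1) (l - k) w)))"
proof -
  have "kernel_Phi \<mu> n \<xi> t w x = ball_const \<mu> * (\<Sum>l<Suc n. \<Sum>k\<le>l. \<Sum>(i, \<epsilon>)\<in>disk_index k.
     (ridge_coeff \<mu> k * disk_lambda \<mu> k i * disk_basis \<mu> k i \<epsilon> (cos \<xi>) (sin \<xi>) * ball_basis \<mu> l k i \<epsilon> x) *
     (poly (gegenbauer (\<mu> + 1/2) k) t * (sqrt (1 - w\<^sup>2) ^ k * gegenbauer_normed (real k + \<mu> + 1) (l - k) w)))"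
    unfolding kernel_Phi_def kernel_G_def lessThan_Suc_atMost sum_distrib_left D_hom_eq[OF \<mu>] solid_D_def
      sum_distrib_right ridge_coeff_def ball_basis_def
    by (intro sum.cong refl) (auto simp: mult_ac)
  then show ?thesis unfolding sum_ball_index .
qed

theorem proposition4p6:
  fixes \<mu> :: real and m :: nat and \<phi> :: "nat \<Rightarrow> real"
    and f :: "real ^ 3 \<Rightarrow> real" and x :: "real ^ 3"
  assumes "\<mu> \<ge> 0"
    and "\<And>\<nu>. \<nu> \<le> 2 * m \<Longrightarrow> \<phi> \<nu> = 2 * real \<nu> * pi / (2 * real m + 1)"
    and "f \<in> ball_L2 \<mu>"
    and "x \<in> cball 0 1"
  shows "ball_partial_sum \<mu> (2 * m) f x =
    1 / (2 * real m + 1) * (\<Sum>\<nu>\<le>2 * m.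
      LINT w:{-1<..<1}|lebesgue.
        (LINT t:{-1<..<1}|lebesgue.
           radon \<mu> (\<phi> \<nu>) f t w * kernel_Phi \<mu> (2 * m) (\<phi> \<nu>) t w x) * sqrt (1 - w\<^sup>2))"
proof -
  note \<mu> = assms(1) and \<phi> = assms(2)
  have f: "ball_L1 \<mu> f" by (rule ball_L2_imp_L1[OF \<mu> assms(3)])
  let ?J = "ball_index (Suc (2 * m))"
  define c where "c \<xi> = (\<lambda>(l, k, i, \<epsilon>). ridge_coeff \<mu> k * disk_lambda \<mu> k i *
     disk_basis \<mu> k i \<epsilon> (cos \<xi>) (sin \<xi>) * ball_basis \<mu> l k i \<epsilon> x)" for \<xi>
  define R where "R \<xi> = (\<lambda>(l, k, i :: nat, \<epsilon> :: nat). ball_ridge \<mu> l k \<xi>)" for \<xi>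
  have R: "R \<xi> r \<in> poly3_less (Suc (2 * m))" if "r \<in> ?J" for r \<xi>
    using that by (auto simp: R_def ball_index_def intro: poly3_less_mono[OF poly3_less_ball_ridge[OF \<mu>]])
  \<comment> \<open>For fixed x the kernel pulls back to a linear combination of ridge polynomials,
    so each node contributes pairings of f with polynomials.\<close>
  have int: "(LINT w:{-1<..<1}|lebesgue. (LINT t:{-1<..<1}|lebesgue.
      radon \<mu> \<xi> f t w * kernel_Phi \<mu> (2 * m) \<xi> t w x) * sqrt (1 - w\<^sup>2)) =
      (\<Sum>r\<in>?J. c \<xi> r * ball_inner \<mu> f (R \<xi> r))" for \<xi>
  proof -
    define g where "g y = (\<Sum>r\<in>?J. c \<xi> r * R \<xi> r y)" for y
    have g: "g \<in> poly3_less (Suc (2 * m))"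
      unfolding g_def[abs_def] by (intro poly3_less_sum poly3_less_scale R)
    have "(LINT w:{-1<..<1}|lebesgue. (LINT t:{-1<..<1}|lebesgue.
      radon \<mu> \<xi> f t w * kernel_Phi \<mu> (2 * m) \<xi> t w x) * sqrt (1 - w\<^sup>2)) =
      (LINT y:cball 0 1|lebesgue. f y * (ball_const \<mu> * g y) * ball_weight \<mu> y)"
    proof (rule radon_integral[OF f])
      show "continuous_on UNIV (\<lambda>y. ball_const \<mu> * g y)"
        by (rule continuous_on_poly3[OF poly3_less_scale[OF g]])
      show "(\<lambda>z. kernel_Phi \<mu> (2 * m) \<xi> (fst z) (snd z) x) \<in> borel_measurable (borel \<Otimes>\<^sub>M borel)"
        unfolding kernel_Phi_eq[OF \<mu>] split_def gegenbauer_normed_def by measurable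
      show "kernel_Phi \<mu> (2 * m) \<xi> ((y $ 1 * cos \<xi> + y $ 2 * sin \<xi>) / sqrt (1 - (y $ 3)\<^sup>2)) (y $ 3) x = ball_const \<mu> * g y"
        if "\<bar>y $ 3\<bar> < 1" for y
        unfolding kernel_Phi_eq[OF \<mu>] g_def c_def R_def split_def
        by (simp only: ball_ridge_eq[OF \<mu> that])
    qed
    also have "\<dots> = ball_inner \<mu> f g"
    proof -
      have "f y * (ball_const \<mu> * g y) * ball_weight \<mu> y = ball_const \<mu> * (f y * g y * ball_weight \<mu> y)" for y by simp
      then show ?thesis unfolding ball_inner_def by (simp only: set_integral_mult_right)
    qed
    also have "\<dots> = (\<Sum>r\<in>?J. ball_inner \<mu> f (\<lambda>y. c \<xi> r * R \<xi> r y))"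
      unfolding g_def[abs_def] by (rule ball_inner_sum_right[OF f, where n = "Suc (2 * m)"]) (intro poly3_less_scale R)
    finally show ?thesis unfolding ball_inner_scale_right .
  qed
  have "ball_partial_sum \<mu> (2 * m) f x = expansion \<mu> m \<phi> (Suc (2 * m)) f x"
    by (rule ball_partial_sum_eq[OF \<mu> \<phi> f])
  \<comment> \<open>\<open>node_weight\<close> times the basis value at x is \<open>c\<close>
    divided by 2 m + 1; what remains is to exchange the sums over nodes and indices.\<close>
  also have "\<dots> = (\<Sum>r\<in>?J. \<Sum>\<nu>\<le>2 * m. 1 / (2 * real m + 1) * (c (\<phi> \<nu>) r * ball_inner \<mu> f (R (\<phi> \<nu>) r)))"
    unfolding expansion_def
  proof (intro sum.cong refl)
    fix r assume r: "r \<in> ?J"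
    obtain l k i \<epsilon> where re: "r = (l, k, i, \<epsilon>)" by (metis prod_cases4)
    have "ball_inner \<mu> f (dual_of \<mu> m \<phi> r) =
        (\<Sum>\<nu>\<le>2 * m. ball_inner \<mu> f (\<lambda>y. node_weight \<mu> m k i \<epsilon> (\<phi> \<nu>) * R (\<phi> \<nu>) r y))"
      unfolding re dual_of_def R_def split
      by (rule ball_inner_sum_right[OF f, where n = "Suc (2 * m)"]) (use R[OF r] in \<open>auto simp: re R_def intro: poly3_less_scale\<close>)
    also have "\<dots> = (\<Sum>\<nu>\<le>2 * m. node_weight \<mu> m k i \<epsilon> (\<phi> \<nu>) * ball_inner \<mu> f (R (\<phi> \<nu>) r))"
      by (simp only: ball_inner_scale_right)
    finally have E: "ball_inner \<mu> f (dual_of \<mu> m \<phi> r) =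
        (\<Sum>\<nu>\<le>2 * m. node_weight \<mu> m k i \<epsilon> (\<phi> \<nu>) * ball_inner \<mu> f (R (\<phi> \<nu>) r))" .
    show "ball_inner \<mu> f (dual_of \<mu> m \<phi> r) * basis_of \<mu> r x =
        (\<Sum>\<nu>\<le>2 * m. 1 / (2 * real m + 1) * (c (\<phi> \<nu>) r * ball_inner \<mu> f (R (\<phi> \<nu>) r)))"
      unfolding E sum_distrib_right
      by (intro sum.cong refl) (simp add: node_weight_def c_def basis_of_def re mult_ac)
  qed
  also have "\<dots> = (\<Sum>\<nu>\<le>2 * m. \<Sum>r\<in>?J. 1 / (2 * real m + 1) * (c (\<phi> \<nu>) r * ball_inner \<mu> f (R (\<phi> \<nu>) r)))"
    by (rule sum.swap)
  finally show ?thesis unfolding int sum_distrib_left .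
qed

end
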